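(* Let $(A,1)$ and $(A',1')$ be MV-algebras and $n\ge1$. (1) $(A,1)$ is $n$-pseudofinite if, and only if, $A$ is projectable and is isomorphic to a product $[0,1_1]\times\cdots\times[0,1_n]$ of $n$ MV-chains such that for every $i\in\{1,\dots,n\}$ the MV-chain $[0,1_i]$ is either finite or infinite, atomic and regular. (2) If $(A,1)$ and $(A',1')$ are $n$-pseudofinite, with decompositions $A\cong[0,1_1]\times\cdots\times[0,1_n]$ and $A'\cong[0,1'_1]\times\cdots\times[0,1'_n]$ as in (1), then $(A,1_1,\dots,1_n)\equiv(A',1'_1,\dots,1'_n)$ in the language $L_{MVn}$ if, and only if, for every $i\in\{1,\dots,n\}$ either the MV-chains $[0,1_i]$ and $[0,1'_i]$ are finite and isomorphic, or they are both infinite regular and satisfy the same formulas $D_{p^m,k}$.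
   Context: An MV-algebra is $(A,\oplus,\neg,0)$ with $1=\neg0$ and natural order $x\le y\Leftrightarrow\exists z\,x\oplus z=y$; an MV-chain is a linearly ordered one. $n.x=x\oplus\cdots\oplus x$. If $A\cong A_1\times\cdots\times A_n$ with MV-chains $A_i$, $1_i$ denotes the element whose $i$-th coordinate is the top of $A_i$ and others are $0$, and $[0,1_i]=\{x\in A\mid x\le1_i\}$ is identified with $A_i$. $L_{MVn}=(0,\oplus,\neg,1_1,\dots,1_n)$ adds $n$ constants interpreted by these elements. Two elements $a,b$ are orthogonal if $a\wedge b=0$; $B^\perp=\{a\mid\forall b\in B,\ a\wedge b=0\}$; $A$ is projectable if for all $a,b\in A$, $b$ can be written uniquely as $b=b_1\oplus b_2$ with $b_1\in\{a\}^\perp$, $b_2\in\{a\}^{\perp\perp}$. $A$ is $n$-pseudofinite if it is elementarily equivalent to some ultraproduct of finite MV-algebras each isomorphic to a product of $n$ MV-chains. An MV-chain is atomic if it has an atom (a least positive element $\varepsilon$); it is regular if for every $k\ge2$ and all $0<x_1<\cdots<x_k$ there is $x$ with $x_1\le k.x\le x_k$ and $0<x<2.x<\cdots<k.x$. For an infinite atomic MV-chain $B$ with Chang $\ell$-group $(G_B,u_B)$ ($B\cong[0,u_B]$, $x\oplus y=\min(x+y,u_B)$, $\neg x=u_B-x$), $p$ prime, $m\ge1$, $0\le k\le p^m-1$: $D_{p^m,k}$ states that there is $x\in B$ with $0<x<2.x<\cdots<(p^m-1).x$ and $p^mx-k\varepsilon\in\mathbb{Z}u_B$ in $G_B$. 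*)

theory Defs
  imports "HOL-Algebra.Group" "HOL-Computational_Algebra.Primes" "HOL-Library.Infinite_Typeclass"
begin

section \<open>MV-algebras\<close>

record 'a mv = "'a partial_object" +
  mv_plus :: "'a \<Rightarrow> 'a \<Rightarrow> 'a"
  mv_neg :: "'a \<Rightarrow> 'a"
  mv_zero :: 'a

definition mv_one :: "'a mv \<Rightarrow> 'a" where
  "mv_one A = mv_neg A (mv_zero A)"

locale mv_algebra =
  fixes A :: "'a mv"
  assumes zero_closed: "mv_zero A \<in> carrier A"
    and plus_closed: "\<lbrakk>x \<in> carrier A; y \<in> carrier A\<rbrakk> \<Longrightarrow> mv_plus A x y \<in> carrier A"
    and neg_closed: "x \<in> carrier A \<Longrightarrow> mv_neg A x \<in> carrier A"
    and plus_assoc: "\<lbrakk>x \<in> carrier A; y \<in> carrier A; z \<in> carrier A\<rbrakk>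
      \<Longrightarrow> mv_plus A (mv_plus A x y) z = mv_plus A x (mv_plus A y z)"
    and plus_comm: "\<lbrakk>x \<in> carrier A; y \<in> carrier A\<rbrakk> \<Longrightarrow> mv_plus A x y = mv_plus A y x"
    and plus_zero: "x \<in> carrier A \<Longrightarrow> mv_plus A x (mv_zero A) = x"
    and neg_neg: "x \<in> carrier A \<Longrightarrow> mv_neg A (mv_neg A x) = x"
    and plus_one: "x \<in> carrier A \<Longrightarrow> mv_plus A x (mv_one A) = mv_one A"
    and lukasiewicz: "\<lbrakk>x \<in> carrier A; y \<in> carrier A\<rbrakk>
      \<Longrightarrow> mv_plus A (mv_neg A (mv_plus A (mv_neg A x) y)) y
        = mv_plus A (mv_neg A (mv_plus A (mv_neg A y) x)) x"

definition mv_le :: "'a mv \<Rightarrow> 'a \<Rightarrow> 'a \<Rightarrow> bool" where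
  "mv_le A x y \<longleftrightarrow> (\<exists>z\<in>carrier A. mv_plus A x z = y)"

definition mv_less :: "'a mv \<Rightarrow> 'a \<Rightarrow> 'a \<Rightarrow> bool" where
  "mv_less A x y \<longleftrightarrow> mv_le A x y \<and> x \<noteq> y"

definition mv_times :: "'a mv \<Rightarrow> 'a \<Rightarrow> 'a \<Rightarrow> 'a" where
  "mv_times A x y = mv_neg A (mv_plus A (mv_neg A x) (mv_neg A y))"

(* the usual term for the infimum of the natural order *)
definition mv_meet :: "'a mv \<Rightarrow> 'a \<Rightarrow> 'a \<Rightarrow> 'a" where
  "mv_meet A x y = mv_times A x (mv_plus A (mv_neg A x) y)"

primrec mv_mult :: "'a mv \<Rightarrow> nat \<Rightarrow> 'a \<Rightarrow> 'a" where
  "mv_mult A 0 x = mv_zero A"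
| "mv_mult A (Suc k) x = mv_plus A (mv_mult A k x) x"

(* As for MV-algebras, the one-element algebra is not excluded. *)
definition mv_chain :: "'a mv \<Rightarrow> bool" where
  "mv_chain A \<longleftrightarrow>
     mv_algebra A \<and> (\<forall>x\<in>carrier A. \<forall>y\<in>carrier A. mv_le A x y \<or> mv_le A y x)"

definition mv_iso :: "'a mv \<Rightarrow> 'b mv \<Rightarrow> ('a \<Rightarrow> 'b) set" where
  "mv_iso A B = {h. bij_betw h (carrier A) (carrier B)
     \<and> h (mv_zero A) = mv_zero B
     \<and> (\<forall>x\<in>carrier A. h (mv_neg A x) = mv_neg B (h x))
     \<and> (\<forall>x\<in>carrier A. \<forall>y\<in>carrier A. h (mv_plus A x y) = mv_plus B (h x) (h y))}"

definition mv_prod :: "'i set \<Rightarrow> ('i \<Rightarrow> 'a mv) \<Rightarrow> ('i \<Rightarrow> 'a) mv" where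
  "mv_prod I C = \<lparr>
     carrier = (\<Pi>\<^sub>E i\<in>I. carrier (C i)),
     mv_plus = (\<lambda>f g. \<lambda>i\<in>I. mv_plus (C i) (f i) (g i)),
     mv_neg = (\<lambda>f. \<lambda>i\<in>I. mv_neg (C i) (f i)),
     mv_zero = (\<lambda>i\<in>I. mv_zero (C i))\<rparr>"

definition mv_chain_decomposition ::
    "nat \<Rightarrow> 'a mv \<Rightarrow> (nat \<Rightarrow> 'c mv) \<Rightarrow> ('a \<Rightarrow> nat \<Rightarrow> 'c) \<Rightarrow> bool" where
  "mv_chain_decomposition n A C h \<longleftrightarrow>
     (\<forall>i\<in>{1..n}. mv_chain (C i)) \<and> h \<in> mv_iso A (mv_prod {1..n} C)"

(* The element 1_i of A for a decomposition given by h; the interval [0, 1_i] of A is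
   identified with the factor C i. *)
definition mv_component_one ::
    "nat \<Rightarrow> 'a mv \<Rightarrow> (nat \<Rightarrow> 'c mv) \<Rightarrow> ('a \<Rightarrow> nat \<Rightarrow> 'c) \<Rightarrow> nat \<Rightarrow> 'a" where
  "mv_component_one n A C h i =
     inv_into (carrier A) h
       (\<lambda>j\<in>{1..n}. if j = i then mv_one (C j) else mv_zero (C j))"

section \<open>Projectable algebras, atomic and regular chains\<close>

definition mv_perp :: "'a mv \<Rightarrow> 'a set \<Rightarrow> 'a set" where
  "mv_perp A B = {a \<in> carrier A. \<forall>b\<in>B. mv_meet A a b = mv_zero A}"

definition mv_projectable :: "'a mv \<Rightarrow> bool" where
  "mv_projectable A \<longleftrightarrow> (\<forall>a\<in>carrier A. \<forall>b\<in>carrier A.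
     \<exists>!p. fst p \<in> mv_perp A {a} \<and> snd p \<in> mv_perp A (mv_perp A {a})
        \<and> b = mv_plus A (fst p) (snd p))"

definition mv_atom :: "'a mv \<Rightarrow> 'a \<Rightarrow> bool" where
  "mv_atom B e \<longleftrightarrow> e \<in> carrier B \<and> e \<noteq> mv_zero B
     \<and> (\<forall>x\<in>carrier B. x \<noteq> mv_zero B \<longrightarrow> mv_le B e x)"

definition mv_atomic :: "'a mv \<Rightarrow> bool" where
  "mv_atomic B \<longleftrightarrow> (\<exists>e. mv_atom B e)"

(* 0 < x < 2.x < ... < k.x, for k \<ge> 1 *)
definition mv_increasing_multiples :: "'a mv \<Rightarrow> nat \<Rightarrow> 'a \<Rightarrow> bool" where
  "mv_increasing_multiples B k x \<longleftrightarrow> mv_less B (mv_zero B) x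
     \<and> (\<forall>j\<in>{1..<k}. mv_less B (mv_mult B j x) (mv_mult B (j + 1) x))"

definition mv_regular :: "'a mv \<Rightarrow> bool" where
  "mv_regular B \<longleftrightarrow> (\<forall>k\<ge>2. \<forall>s :: nat \<Rightarrow> 'a.
     (\<forall>i\<in>{1..k}. s i \<in> carrier B) \<and> mv_less B (mv_zero B) (s 1)
       \<and> (\<forall>i\<in>{1..<k}. mv_less B (s i) (s (i + 1)))
     \<longrightarrow> (\<exists>x\<in>carrier B. mv_le B (s 1) (mv_mult B k x) \<and> mv_le B (mv_mult B k x) (s k)
            \<and> mv_increasing_multiples B k x))"

section \<open>The Chang group of an MV-chain\<close>

text \<open>
  Chang's construction for a nontrivial chain B: the pair (m, x) with x < 1 stands for the
  element m u + x of the group, so that the lexicographic order on pairs is the group order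
  (which the formulas D below do not mention). The group is written multiplicatively, as
  always in HOL-Algebra. The chain B is embedded as the interval [0, u], with 1 mapped to u.
\<close>

definition chang_group :: "'a mv \<Rightarrow> (int \<times> 'a) monoid" where
  "chang_group B = \<lparr>
     carrier = UNIV \<times> (carrier B - {mv_one B}),
     monoid.mult = (\<lambda>(m, x) (n, y).
        if mv_plus B x y = mv_one B then (m + n + 1, mv_times B x y)
        else (m + n, mv_plus B x y)),
     one = (0, mv_zero B)\<rparr>"

definition chang_unit :: "'a mv \<Rightarrow> int \<times> 'a" where
  "chang_unit B = (1, mv_zero B)"

definition chang_embed :: "'a mv \<Rightarrow> 'a \<Rightarrow> int \<times> 'a" where
  "chang_embed B x = (if x = mv_one B then chang_unit B else (0, x))"

(* D_{q,k} for a prime power q; \<epsilon> is the unique atom, and the last condition is: q x - k \<epsilon> is an integer multiple of u *)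
definition mv_D :: "'a mv \<Rightarrow> nat \<Rightarrow> nat \<Rightarrow> bool" where
  "mv_D B q k \<longleftrightarrow> (let G = chang_group B; \<epsilon> = (THE e. mv_atom B e) in
     \<exists>x\<in>carrier B. mv_increasing_multiples B (q - 1) x
       \<and> (\<exists>j::int. (chang_embed B x [^]\<^bsub>G\<^esub> q) \<otimes>\<^bsub>G\<^esub> inv\<^bsub>G\<^esub> (chang_embed B \<epsilon> [^]\<^bsub>G\<^esub> k)
                    = chang_unit B [^]\<^bsub>G\<^esub> j))"

section \<open>First-order logic\<close>

text \<open>The constant symbol \<open>Const i\<close> belongs to the language L_MVn iff \<open>i \<in> {1..n}\<close>;
  for n = 0 this is the language of MV-algebras.\<close>

datatype mv_term = Var nat | Const nat | Zero | Plus mv_term mv_term | Neg mv_term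

datatype mv_form =
  FEq mv_term mv_term | FNot mv_form | FAnd mv_form mv_form | FAll nat mv_form

primrec term_vars :: "mv_term \<Rightarrow> nat set" where
  "term_vars (Var x) = {x}"
| "term_vars (Const i) = {}"
| "term_vars Zero = {}"
| "term_vars (Plus s t) = term_vars s \<union> term_vars t"
| "term_vars (Neg t) = term_vars t"

primrec free_vars :: "mv_form \<Rightarrow> nat set" where
  "free_vars (FEq s t) = term_vars s \<union> term_vars t"
| "free_vars (FNot \<phi>) = free_vars \<phi>"
| "free_vars (FAnd \<phi> \<psi>) = free_vars \<phi> \<union> free_vars \<psi>"
| "free_vars (FAll x \<phi>) = free_vars \<phi> - {x}"

primrec term_consts :: "mv_term \<Rightarrow> nat set" where
  "term_consts (Var x) = {}"
| "term_consts (Const i) = {i}"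
| "term_consts Zero = {}"
| "term_consts (Plus s t) = term_consts s \<union> term_consts t"
| "term_consts (Neg t) = term_consts t"

primrec form_consts :: "mv_form \<Rightarrow> nat set" where
  "form_consts (FEq s t) = term_consts s \<union> term_consts t"
| "form_consts (FNot \<phi>) = form_consts \<phi>"
| "form_consts (FAnd \<phi> \<psi>) = form_consts \<phi> \<union> form_consts \<psi>"
| "form_consts (FAll x \<phi>) = form_consts \<phi>"

primrec term_val :: "'a mv \<Rightarrow> (nat \<Rightarrow> 'a) \<Rightarrow> (nat \<Rightarrow> 'a) \<Rightarrow> mv_term \<Rightarrow> 'a" where
  "term_val A c v (Var x) = v x"
| "term_val A c v (Const i) = c i"
| "term_val A c v Zero = mv_zero A"
| "term_val A c v (Plus s t) = mv_plus A (term_val A c v s) (term_val A c v t)"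
| "term_val A c v (Neg t) = mv_neg A (term_val A c v t)"

primrec sat :: "'a mv \<Rightarrow> (nat \<Rightarrow> 'a) \<Rightarrow> (nat \<Rightarrow> 'a) \<Rightarrow> mv_form \<Rightarrow> bool" where
  "sat A c v (FEq s t) \<longleftrightarrow> term_val A c v s = term_val A c v t"
| "sat A c v (FNot \<phi>) \<longleftrightarrow> \<not> sat A c v \<phi>"
| "sat A c v (FAnd \<phi> \<psi>) \<longleftrightarrow> sat A c v \<phi> \<and> sat A c v \<psi>"
| "sat A c v (FAll x \<phi>) \<longleftrightarrow> (\<forall>a\<in>carrier A. sat A c (v(x := a)) \<phi>)"

definition mv_sentences :: "nat \<Rightarrow> mv_form set" where
  "mv_sentences n = {\<phi>. free_vars \<phi> = {} \<and> form_consts \<phi> \<subseteq> {1..n}}"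

(* (A, c 1, ..., c n) \<equiv> (A', c' 1, ..., c' n); the valuations are irrelevant for sentences *)
definition mv_elem_equiv ::
    "nat \<Rightarrow> 'a mv \<Rightarrow> (nat \<Rightarrow> 'a) \<Rightarrow> 'b mv \<Rightarrow> (nat \<Rightarrow> 'b) \<Rightarrow> bool" where
  "mv_elem_equiv n A c A' c' \<longleftrightarrow> (\<forall>\<phi>\<in>mv_sentences n.
     sat A c (\<lambda>_. mv_zero A) \<phi> \<longleftrightarrow> sat A' c' (\<lambda>_. mv_zero A') \<phi>)"

section \<open>Ultraproducts and pseudofinite MV-algebras\<close>

definition ultrafilter_on :: "'i set \<Rightarrow> 'i filter \<Rightarrow> bool" where
  "ultrafilter_on I F \<longleftrightarrow> F \<le> principal I \<and> F \<noteq> bot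
     \<and> (\<forall>P. eventually P F \<or> eventually (\<lambda>i. \<not> P i) F)"

definition ultra_rel :: "'i set \<Rightarrow> 'i filter \<Rightarrow> ('i \<Rightarrow> 'a mv) \<Rightarrow> (('i \<Rightarrow> 'a) \<times> ('i \<Rightarrow> 'a)) set" where
  "ultra_rel I F B = {(f, g). f \<in> carrier (mv_prod I B) \<and> g \<in> carrier (mv_prod I B)
     \<and> eventually (\<lambda>i. f i = g i) F}"

definition mv_ultraproduct :: "'i set \<Rightarrow> 'i filter \<Rightarrow> ('i \<Rightarrow> 'a mv) \<Rightarrow> ('i \<Rightarrow> 'a) set mv" where
  "mv_ultraproduct I F B = (let P = mv_prod I B; R = ultra_rel I F B in \<lparr>
     carrier = carrier P // R,
     mv_plus = (\<lambda>X Y. \<Union>f\<in>X. \<Union>g\<in>Y. R `` {mv_plus P f g}),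
     mv_neg = (\<lambda>X. \<Union>f\<in>X. R `` {mv_neg P f}),
     mv_zero = R `` {mv_zero P}\<rparr>)"

text \<open>
  The index sets are the subsets of the type \<open>'i\<close>, and the finite MV-algebras have their
  carriers in the type \<open>'b\<close>. Both types are arbitrary infinite types. A product of chains
  isomorphic to B has its factors isomorphic to intervals of B, so it is no restriction to take
  the chains in \<open>'b\<close> too.
\<close>

definition mv_pseudofinite ::
    "'i::infinite itself \<Rightarrow> 'b::infinite itself \<Rightarrow> nat \<Rightarrow> 'a mv \<Rightarrow> bool" where
  "mv_pseudofinite _ _ n A \<longleftrightarrow> (\<exists>(I :: 'i set) F (B :: 'i \<Rightarrow> 'b mv).
     ultrafilter_on I F
     \<and> (\<forall>i\<in>I. mv_algebra (B i) \<and> finite (carrier (B i))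
          \<and> (\<exists>(C :: nat \<Rightarrow> 'b mv) h. mv_chain_decomposition n (B i) C h))
     \<and> mv_elem_equiv 0 A (\<lambda>_. mv_zero A)
         (mv_ultraproduct I F B) (\<lambda>_. mv_zero (mv_ultraproduct I F B)))"

end

theory Submission
  imports Defs "HOL-Algebra.Free_Abelian_Groups" "HOL-Library.Multiset"
begin

text \<open>
  The Chang group of an atomic regular infinite chain is a discretely ordered group with division
  by integers with remainder, in which the chain is the interval \<open>[0, u]\<close>; a finite chain is such an
  interval in the integers. A bounded form of the quantifier elimination of Presburger arithmetic,
  stated as one step of an Ehrenfeucht-Fraisse game, shows that the sentences of a bounded size
  that hold in the chain depend only on the size of \<open>u\<close>, up to a bound, and on the residues of \<open>u\<close> modulo the small integers.
  These data are realized by an integer \<open>N\<close>, hence by a finite chain, and games can be played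
  componentwise on products. With the theorem of Los this yields pseudofiniteness. Conversely, that
  an algebra is a product of \<open>n\<close> chains, and that each of them has an atom and division with remainder,
  is expressed by sentences, which hold in all finite products of \<open>n\<close> chains. Finally, for
  a prime power \<open>q \<ge> 5\<close> the condition \<open>D\<close> with parameters \<open>q\<close> and \<open>k\<close> means that \<open>q\<close> divides \<open>u + k\<epsilon>\<close>,
  so these conditions determine all residues of \<open>u\<close>.
\<close>

section \<open>MV-algebras and their natural order\<close>

text \<open>The bounds carry the argument. No finite chain is elementarily equivalent to an infinite
  one, so only forms with coefficients and moduli at most M are compared, and each round of the game
  has to be prepared by raising M to about (M!)^2 M. For a fixed sentence only boundedly many
  residues of u matter, and one integer can realize them. The game is played in the group because,
  once the truncations are decided, an MV-term is an integer linear form in u, the atom and the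
  variables. The truncations are themselves decided by signs of such forms, and so is the question
  whether an answer found in the group lies in [0, u]. The threshold 5 comes from the freedom of the
  multiple of u in D: if q x = k eps + j u and (q - 2) x < u, then j >= 2 would give 2 (q - 2) u <=
  q u, which fails from q = 5 on. Prime powers below 5 cause no loss, because a residue modulo a
  higher power of the same prime determines the residue modulo the lower one.\<close>

context mv_algebra
begin

abbreviation plus_A (infixl "\<boxplus>" 65) where "x \<boxplus> y \<equiv> mv_plus A x y"
abbreviation neg_A ("\<sim> _" [81] 80) where "\<sim> x \<equiv> mv_neg A x"
abbreviation times_A (infixl "\<boxdot>" 70) where "x \<boxdot> y \<equiv> mv_times A x y"
abbreviation nought where "nought \<equiv> mv_zero A"
abbreviation unity where "unity \<equiv> mv_one A"
abbreviation le_A (infix "\<preceq>" 50) where "x \<preceq> y \<equiv> mv_le A x y"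
abbreviation K where "K \<equiv> carrier A"

lemma one_closed: "unity \<in> K"
  by (simp add: mv_one_def neg_closed zero_closed)

lemma times_closed: "x \<in> K \<Longrightarrow> y \<in> K \<Longrightarrow> x \<boxdot> y \<in> K"
  by (simp add: mv_times_def neg_closed plus_closed)

lemmas closed = zero_closed one_closed plus_closed neg_closed times_closed

lemma neg_one: "\<sim> unity = nought"
  by (simp add: mv_one_def neg_neg zero_closed)

lemma neg_zero: "\<sim> nought = unity"
  by (simp add: mv_one_def)

lemma zero_plus: "x \<in> K \<Longrightarrow> nought \<boxplus> x = x"
  using plus_comm plus_zero zero_closed by metis

lemma one_plus: "x \<in> K \<Longrightarrow> unity \<boxplus> x = unity"
  using plus_comm plus_one one_closed by metis

lemma plus_lcomm: "x \<in> K \<Longrightarrow> y \<in> K \<Longrightarrow> z \<in> K \<Longrightarrow> x \<boxplus> (y \<boxplus> z) = y \<boxplus> (x \<boxplus> z)"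
  by (metis plus_assoc plus_comm)

lemma neg_plus: "x \<in> K \<Longrightarrow> \<sim> x \<boxplus> x = unity"
  using lukasiewicz[of x unity] one_closed
  by (metis closed neg_one one_plus plus_one zero_plus)

lemma plus_neg: "x \<in> K \<Longrightarrow> x \<boxplus> \<sim> x = unity"
  using neg_plus plus_comm neg_closed by metis

lemma le_iff: "x \<in> K \<Longrightarrow> y \<in> K \<Longrightarrow> x \<preceq> y \<longleftrightarrow> \<sim> x \<boxplus> y = unity"
proof
  assume "x \<in> K" "y \<in> K" "x \<preceq> y"
  then show "\<sim> x \<boxplus> y = unity"
    unfolding mv_le_def by (metis neg_closed neg_plus one_plus plus_assoc)
next
  assume *: "x \<in> K" "y \<in> K" "\<sim> x \<boxplus> y = unity"
  \<comment> \<open>The witness is the truncated difference of y and x; the Lukasiewicz axiom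
    exchanges x and y in its sum with x.\<close>
  then have "x \<boxplus> \<sim> (\<sim> y \<boxplus> x) = y"
    by (metis lukasiewicz neg_closed neg_one plus_closed plus_comm zero_plus)
  then show "x \<preceq> y"
    unfolding mv_le_def using * closed by blast
qed

lemma diff_plus: "x \<in> K \<Longrightarrow> y \<in> K \<Longrightarrow> x \<preceq> y \<Longrightarrow> (y \<boxdot> \<sim> x) \<boxplus> x = y"
  by (metis le_iff lukasiewicz mv_times_def neg_closed neg_neg neg_one zero_plus)

lemma le_antisym: "x \<in> K \<Longrightarrow> y \<in> K \<Longrightarrow> x \<preceq> y \<Longrightarrow> y \<preceq> x \<Longrightarrow> x = y"
  by (metis le_iff lukasiewicz neg_one zero_plus)

lemma le_trans: "x \<in> K \<Longrightarrow> y \<in> K \<Longrightarrow> z \<in> K \<Longrightarrow> x \<preceq> y \<Longrightarrow> y \<preceq> z \<Longrightarrow> x \<preceq> z"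
  unfolding mv_le_def by (metis plus_assoc plus_closed)

lemma zero_le: "x \<in> K \<Longrightarrow> nought \<preceq> x"
  unfolding mv_le_def using zero_plus by blast

lemma le_one: "x \<in> K \<Longrightarrow> x \<preceq> unity"
  unfolding mv_le_def using plus_neg neg_closed by blast

lemma le_plus: "x \<in> K \<Longrightarrow> y \<in> K \<Longrightarrow> x \<preceq> x \<boxplus> y"
  unfolding mv_le_def by blast

lemma plus_mono: 
  assumes "x \<in> K" "y \<in> K" "z \<in> K" "x \<preceq> y" shows "x \<boxplus> z \<preceq> y \<boxplus> z"
proof -
  obtain w where "w \<in> K" "y = x \<boxplus> w" using assms unfolding mv_le_def by blast
  then have "y \<boxplus> z = (x \<boxplus> z) \<boxplus> w"
    using assms by (metis plus_assoc plus_comm)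
  then show ?thesis unfolding mv_le_def using \<open>w \<in> K\<close> by metis
qed

lemma neg_mono: "x \<in> K \<Longrightarrow> y \<in> K \<Longrightarrow> x \<preceq> y \<Longrightarrow> \<sim> y \<preceq> \<sim> x"
  by (simp add: le_iff neg_closed neg_neg plus_comm)

lemma times_comm: "x \<in> K \<Longrightarrow> y \<in> K \<Longrightarrow> x \<boxdot> y = y \<boxdot> x"
  by (simp add: mv_times_def neg_closed plus_comm)

lemma times_assoc: "x \<in> K \<Longrightarrow> y \<in> K \<Longrightarrow> z \<in> K \<Longrightarrow> x \<boxdot> y \<boxdot> z = x \<boxdot> (y \<boxdot> z)"
  by (simp add: mv_times_def neg_closed plus_assoc plus_closed neg_neg)

lemma neg_times: "x \<in> K \<Longrightarrow> y \<in> K \<Longrightarrow> \<sim> (x \<boxdot> y) = \<sim> x \<boxplus> \<sim> y"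
  by (simp add: mv_times_def closed neg_neg)

lemma neg_plus_distrib: "x \<in> K \<Longrightarrow> y \<in> K \<Longrightarrow> \<sim> (x \<boxplus> y) = \<sim> x \<boxdot> \<sim> y"
  by (simp add: mv_times_def closed neg_neg)

lemma times_one: "x \<in> K \<Longrightarrow> x \<boxdot> unity = x"
  by (simp add: mv_times_def neg_one plus_zero closed neg_neg)

lemma times_zero: "x \<in> K \<Longrightarrow> x \<boxdot> nought = nought"
  by (simp add: mv_times_def neg_zero plus_one closed neg_one)

lemma zero_times: "x \<in> K \<Longrightarrow> nought \<boxdot> x = nought"
  using times_comm times_zero closed by metis

lemma times_neg: "x \<in> K \<Longrightarrow> x \<boxdot> \<sim> x = nought"
  by (simp add: mv_times_def closed neg_neg neg_plus neg_one)

lemma times_le: "x \<in> K \<Longrightarrow> y \<in> K \<Longrightarrow> x \<boxdot> y \<preceq> x"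
  by (metis le_plus neg_closed neg_mono neg_neg neg_times plus_closed times_closed)

text \<open>Cancellation for a sum that stays below 1. It is \<open>diff_plus\<close> for b and the
  negation of w, read through negation.\<close>

lemma plus_diff: "w \<in> K \<Longrightarrow> b \<in> K \<Longrightarrow> w \<preceq> \<sim> b \<Longrightarrow> (w \<boxplus> b) \<boxdot> \<sim> b = w"
proof -
  assume *: "w \<in> K" "b \<in> K" "w \<preceq> \<sim> b"
  then have "b \<preceq> \<sim> w" by (metis neg_closed neg_mono neg_neg)
  then have "(\<sim> w \<boxdot> \<sim> b) \<boxplus> b = \<sim> w" using * diff_plus closed by blast
  then show ?thesis using *
    by (metis closed neg_neg neg_plus_distrib)
qed

lemma mult_closed: "x \<in> K \<Longrightarrow> mv_mult A k x \<in> K"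
  by (induction k) (auto simp: closed)

end

lemma chain_algebra: "mv_chain C \<Longrightarrow> mv_algebra C"
  by (simp add: mv_chain_def)

lemma chain_total: "mv_chain C \<Longrightarrow> x \<in> carrier C \<Longrightarrow> y \<in> carrier C \<Longrightarrow> mv_le C x y \<or> mv_le C y x"
  by (simp add: mv_chain_def)

section \<open>The Chang group of a nontrivial chain\<close>

locale nontrivial_chain = mv_algebra +
  assumes total: "\<lbrakk>x \<in> carrier A; y \<in> carrier A\<rbrakk> \<Longrightarrow> mv_le A x y \<or> mv_le A y x"
    and nontrivial: "mv_zero A \<noteq> mv_one A"
begin

text \<open>This is where linearity enters: in a chain a sum either reaches 1 or has no carry
  \<open>x \<boxdot> y\<close>. A good sequence is therefore a block of ones followed by at most one
  further entry, which is why a pair of an integer and an element can encode it.\<close>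

lemma plus_one_or_times_zero: "x \<in> K \<Longrightarrow> y \<in> K \<Longrightarrow> x \<boxplus> y = unity \<or> x \<boxdot> y = nought"
  using total[of "\<sim> x" y] le_iff[of "\<sim> x" y] le_iff[of y "\<sim> x"] closed
  by (metis mv_times_def neg_neg neg_one plus_comm)

text \<open>Both sides are x + y + z - 1, truncated at 1. Subtracting \<open>\<sim> y\<close> from x
  and from z is exact and leaves the two products; after that only associativity is needed.\<close>

lemma times_plus_carry:
  assumes "x \<in> K" "y \<in> K" "z \<in> K" "x \<boxplus> y = unity" "y \<boxplus> z = unity"
  shows "(x \<boxdot> y) \<boxplus> z = x \<boxplus> (y \<boxdot> z)"
proof -
  have le: "\<sim> y \<preceq> x" "\<sim> y \<preceq> z"
    using assms le_iff closed neg_neg plus_comm by metis+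
  define a where "a = x \<boxdot> y"
  define c where "c = y \<boxdot> z"
  have cl: "a \<in> K" "c \<in> K" "\<sim> y \<in> K" using assms closed a_def c_def by auto
  have x: "x = a \<boxplus> \<sim> y"
    using diff_plus[OF _ _ le(1)] assms cl by (simp add: neg_neg a_def)
  have z: "z = c \<boxplus> \<sim> y"
    using diff_plus[OF _ _ le(2)] assms cl by (simp add: neg_neg c_def times_comm)
  have "a \<boxplus> z = x \<boxplus> c"
    unfolding x z using cl by (simp add: plus_assoc plus_comm)
  then show ?thesis by (simp add: a_def c_def)
qed

text \<open>Again both sides are x + y + z - 1, now without overflow. Splitting
  \<open>\<sim> y\<close> into b and z makes x the sum of a, z and b, and b can be removed again
  because a + z stays below the complement of b.\<close>

lemma times_plus_mixed:
  assumes "x \<in> K" "y \<in> K" "z \<in> K" "x \<boxplus> y = unity" "y \<boxdot> z = nought"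
  shows "(x \<boxdot> y) \<boxplus> z = x \<boxdot> (y \<boxplus> z)"
proof -
  define a where "a = x \<boxdot> y"
  define b where "b = \<sim> y \<boxdot> \<sim> z"
  have cl: "a \<in> K" "b \<in> K" "\<sim> y \<in> K" "\<sim> z \<in> K" using assms closed a_def b_def by auto
  have le: "\<sim> y \<preceq> x" "z \<preceq> \<sim> y"
    using assms le_iff closed neg_neg plus_comm neg_times neg_zero by metis+
  have "x = a \<boxplus> \<sim> y"
    using diff_plus[OF _ _ le(1)] assms cl neg_neg a_def by metis
  moreover have y: "\<sim> y = b \<boxplus> z"
    using diff_plus[OF _ _ le(2)] assms cl b_def by metis
  ultimately have x: "x = (a \<boxplus> z) \<boxplus> b"
    using assms cl by (simp add: plus_assoc plus_comm)
  have nb: "\<sim> b = y \<boxplus> z" using assms cl b_def neg_times neg_neg by metis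
  have "a \<preceq> y" using times_le times_comm a_def assms by metis
  then have "a \<boxplus> z \<preceq> \<sim> b" using plus_mono nb cl assms by metis
  then have "((a \<boxplus> z) \<boxplus> b) \<boxdot> \<sim> b = a \<boxplus> z" using plus_diff cl assms closed by metis
  then show ?thesis using x nb a_def by metis
qed

text \<open>The second entry of the good sequence \<open>x + y + z\<close>, computed in two ways.\<close>

lemma good_sequence_middle:
  assumes "x \<in> K" "y \<in> K" "z \<in> K"
  shows "(x \<boxdot> y) \<boxplus> ((x \<boxplus> y) \<boxdot> z) = (z \<boxdot> y) \<boxplus> ((z \<boxplus> y) \<boxdot> x)"
proof -
  have xy: "x \<boxplus> y = unity \<or> x \<boxdot> y = nought" and yz: "y \<boxplus> z = unity \<or> y \<boxdot> z = nought"
    using plus_one_or_times_zero assms by auto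
  have c: "z \<boxdot> y = y \<boxdot> z" "z \<boxplus> y = y \<boxplus> z" "unity \<boxdot> x = x" "unity \<boxdot> z = z"
    using assms times_comm plus_comm times_one closed by metis+
  have swap: "(y \<boxplus> z) \<boxdot> x = x \<boxdot> (y \<boxplus> z)" using assms times_comm closed by metis
  consider "x \<boxplus> y = unity" "y \<boxplus> z = unity" | "x \<boxplus> y = unity" "y \<boxdot> z = nought"
    | "x \<boxdot> y = nought" "y \<boxplus> z = unity" | "x \<boxdot> y = nought" "y \<boxdot> z = nought"
    using xy yz by blast
  then show ?thesis
  proof cases
    case 1
    then show ?thesis using times_plus_carry[of x y z] assms c closed plus_comm by metis
  next
    case 2
    then show ?thesis using times_plus_mixed[of x y z] assms c swap closed zero_plus by metis
  next
    case 3
    then have "(z \<boxdot> y) \<boxplus> x = z \<boxdot> (y \<boxplus> x)"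
      using times_plus_mixed[of z y x] assms c times_comm by metis
    moreover have "(x \<boxplus> y) \<boxdot> z = z \<boxdot> (y \<boxplus> x)" using assms times_comm plus_comm closed by metis
    ultimately show ?thesis using 3 assms c zero_plus closed by metis
  next
    case 4
    \<comment> \<open>With no carry in either pair, negation leads back to the case of two
      carries.\<close>
    have n: "\<sim> x \<boxplus> \<sim> y = unity" "\<sim> y \<boxplus> \<sim> z = unity" using 4 assms neg_times neg_zero by metis+
    have "(\<sim> x \<boxdot> \<sim> y) \<boxplus> \<sim> z = \<sim> x \<boxplus> (\<sim> y \<boxdot> \<sim> z)"
      by (rule times_plus_carry) (use assms n closed in auto)
    then have "\<sim> ((x \<boxplus> y) \<boxdot> z) = \<sim> (x \<boxdot> (y \<boxplus> z))"
      using assms closed neg_plus_distrib neg_times by metis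
    then have "(x \<boxplus> y) \<boxdot> z = x \<boxdot> (y \<boxplus> z)" using assms closed neg_neg by metis
    then show ?thesis using 4 assms c swap zero_plus closed by metis
  qed
qed

section \<open>The abelian group laws of the Chang group\<close>

abbreviation "G \<equiv> chang_group A"

lemma chang_simps:
  "carrier G = UNIV \<times> (K - {unity})" "\<one>\<^bsub>G\<^esub> = (0, nought)"
  "(m, x) \<otimes>\<^bsub>G\<^esub> (n, y) = (if x \<boxplus> y = unity then (m + n + 1, x \<boxdot> y) else (m + n, x \<boxplus> y))"
  by (simp_all add: chang_group_def)

lemma times_eq_one: "x \<in> K \<Longrightarrow> y \<in> K \<Longrightarrow> x \<boxdot> y = unity \<Longrightarrow> x = unity"
  by (metis closed le_antisym le_one times_le)

lemma chang_closed: "g \<in> carrier G \<Longrightarrow> h \<in> carrier G \<Longrightarrow> g \<otimes>\<^bsub>G\<^esub> h \<in> carrier G"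
  by (cases g; cases h) (auto simp: chang_simps closed dest: times_eq_one[rotated 2])

lemma chang_comm: "g \<in> carrier G \<Longrightarrow> h \<in> carrier G \<Longrightarrow> g \<otimes>\<^bsub>G\<^esub> h = h \<otimes>\<^bsub>G\<^esub> g"
  by (cases g; cases h) (auto simp: chang_simps plus_comm times_comm)

text \<open>The entries are the good sequence of x + y + z, whose leading ones are absorbed into the
  integer. This normal form is symmetric in x and z by \<open>good_sequence_middle\<close>, and in
  the presence of commutativity that symmetry already is associativity.\<close>

lemma chang_triple:
  assumes "x \<in> K - {unity}" "y \<in> K - {unity}" "z \<in> K - {unity}"
  shows "(k, x) \<otimes>\<^bsub>G\<^esub> (m, y) \<otimes>\<^bsub>G\<^esub> (n, z) =
    (let t = (x \<boxdot> y) \<boxplus> ((x \<boxplus> y) \<boxdot> z) in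
     if x \<boxplus> y \<boxplus> z \<noteq> unity then (k + m + n, x \<boxplus> y \<boxplus> z)
     else if t \<noteq> unity then (k + m + n + 1, t) else (k + m + n + 2, x \<boxdot> y \<boxdot> z))"
proof (cases "x \<boxplus> y = unity")
  case True
  have s: "x \<boxplus> y \<boxplus> z = unity" using True assms one_plus by simp
  have t: "(x \<boxplus> y) \<boxdot> z = z" using True assms times_one times_comm[of unity z] closed by simp
  show ?thesis unfolding s t using True by (simp add: chang_simps Let_def)
next
  case False
  then have z: "x \<boxdot> y = nought" using plus_one_or_times_zero assms by blast
  have t: "(x \<boxdot> y) \<boxplus> ((x \<boxplus> y) \<boxdot> z) = (x \<boxplus> y) \<boxdot> z"
    unfolding z using assms closed zero_plus by simp
  have "(x \<boxplus> y) \<boxdot> z \<noteq> unity" using False times_eq_one assms closed by blast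
  then show ?thesis unfolding t using False by (simp add: chang_simps Let_def)
qed

lemma chang_assoc:
  assumes "f \<in> carrier G" "g \<in> carrier G" "h \<in> carrier G"
  shows "f \<otimes>\<^bsub>G\<^esub> g \<otimes>\<^bsub>G\<^esub> h = f \<otimes>\<^bsub>G\<^esub> (g \<otimes>\<^bsub>G\<^esub> h)"
proof -
  obtain k x m y n z where e: "f = (k, x)" "g = (m, y)" "h = (n, z)" by (metis surj_pair)
  then have cl: "x \<in> K - {unity}" "y \<in> K - {unity}" "z \<in> K - {unity}"
    using assms by (auto simp: chang_simps)
  have "f \<otimes>\<^bsub>G\<^esub> (g \<otimes>\<^bsub>G\<^esub> h) = h \<otimes>\<^bsub>G\<^esub> g \<otimes>\<^bsub>G\<^esub> f"
    using assms chang_comm chang_closed by metis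
  also have "\<dots> = f \<otimes>\<^bsub>G\<^esub> g \<otimes>\<^bsub>G\<^esub> h"
  proof -
    have p: "z \<boxplus> y \<boxplus> x = x \<boxplus> y \<boxplus> z" using cl by (simp add: plus_assoc plus_comm plus_lcomm plus_closed)
    have t: "z \<boxdot> y \<boxdot> x = x \<boxdot> y \<boxdot> z"
      using cl times_comm[of "z \<boxdot> y" x] times_comm[of z y] by (simp add: times_assoc times_closed)
    have m: "(x \<boxdot> y) \<boxplus> ((x \<boxplus> y) \<boxdot> z) = (z \<boxdot> y) \<boxplus> ((z \<boxplus> y) \<boxdot> x)"
      using good_sequence_middle cl by blast
    show ?thesis unfolding e chang_triple[OF cl] chang_triple[OF cl(3,2,1)] p t m
      by (simp add: Let_def ac_simps)
  qed
  finally show ?thesis by simp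
qed

text \<open>For nonzero x a unit has to be borrowed: - (m u + x) = (- m - 1) u + (u - x).\<close>

definition chang_inv where "chang_inv g = (case g of (m, x) \<Rightarrow> if x = nought then (- m, nought) else (- m - 1, \<sim> x))"

lemma neg_eq_one: "x \<in> K \<Longrightarrow> \<sim> x = unity \<Longrightarrow> x = nought"
  by (metis neg_neg neg_one)

lemma chang_inv: "g \<in> carrier G \<Longrightarrow> chang_inv g \<in> carrier G \<and> chang_inv g \<otimes>\<^bsub>G\<^esub> g = \<one>\<^bsub>G\<^esub>"
  using nontrivial neg_eq_one
  by (cases g) (auto simp: chang_simps chang_inv_def closed zero_plus neg_plus times_comm[of "\<sim> _"] times_neg)

lemma comm_group_chang: "comm_group G"
proof (rule comm_groupI)
  show "\<one>\<^bsub>G\<^esub> \<in> carrier G" using nontrivial by (simp add: chang_simps closed)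
  show "\<one>\<^bsub>G\<^esub> \<otimes>\<^bsub>G\<^esub> g = g" if "g \<in> carrier G" for g
    using that by (cases g) (auto simp: chang_simps closed zero_plus)
  show "\<exists>h\<in>carrier G. h \<otimes>\<^bsub>G\<^esub> g = \<one>\<^bsub>G\<^esub>" if "g \<in> carrier G" for g
    using that chang_inv by blast
  show "f \<otimes>\<^bsub>G\<^esub> g = g \<otimes>\<^bsub>G\<^esub> f" if "f \<in> carrier G" "g \<in> carrier G" for f g
    using that by (rule chang_comm)
qed (rule chang_closed chang_assoc; assumption)+

lemma inv_chang: "g \<in> carrier G \<Longrightarrow> inv\<^bsub>G\<^esub> g = chang_inv g"
  using chang_inv comm_group_chang by (metis comm_group_def group.inv_equality)

end

section \<open>Discretely preordered groups\<close>

text \<open>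
  Ordered groups are represented by preordered groups, given by the predicate \<open>Pos\<close> of being
  nonnegative: the ordered group in question is the quotient by the null elements.
  The multiplication of the ring type is only used to form integer multiples.
\<close>

definition null :: "('g::comm_ring_1 \<Rightarrow> bool) \<Rightarrow> 'g \<Rightarrow> bool" where
  "null Pos x \<longleftrightarrow> Pos x \<and> Pos (- x)"

definition Div :: "('g::comm_ring_1 \<Rightarrow> bool) \<Rightarrow> int \<Rightarrow> 'g \<Rightarrow> bool" where
  "Div Pos m x \<longleftrightarrow> (\<exists>z. null Pos (x - of_int m * z))"

locale discrete_group =
  fixes Pos :: "'g::comm_ring_1 \<Rightarrow> bool" and eps :: 'g
  assumes Pos_add: "Pos x \<Longrightarrow> Pos y \<Longrightarrow> Pos (x + y)"
    and Pos_total: "Pos x \<or> Pos (- x)"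
    and eps_pos: "\<not> Pos (- eps)"
    and eps_least: "\<not> Pos (- x) \<Longrightarrow> Pos (x - eps)"
begin

lemma Pos_0: "Pos 0"
  using Pos_total[of 0] by simp

lemma Pos_eps1: "Pos eps"
  using Pos_total eps_pos by blast

text \<open>By discreteness x < 0 means x \<le> - eps. Negated inequalities are thus again
  inequalities between linear forms, at the price of one more summand eps.\<close>

lemma not_Pos: "\<not> Pos x \<longleftrightarrow> Pos (- x - eps)"
proof
  show "\<not> Pos x \<Longrightarrow> Pos (- x - eps)" using eps_least[of "- x"] by simp
  show "Pos (- x - eps) \<Longrightarrow> \<not> Pos x" using Pos_add[of "- x - eps" x] eps_pos by auto
qed

lemma Pos_mult: "k \<ge> 0 \<Longrightarrow> Pos x \<Longrightarrow> Pos (of_int k * x)"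
proof (induction k rule: int_ge_induct)
  case base
  then show ?case using Pos_0 by simp
next
  case (step i)
  then show ?case using Pos_add[of "of_int i * x" x] by (simp add: algebra_simps)
qed

lemma Pos_of_int_eps: "Pos (of_int j * eps) \<longleftrightarrow> j \<ge> 0"
proof
  assume P: "Pos (of_int j * eps)"
  show "j \<ge> 0"
  proof (rule ccontr)
    assume "\<not> j \<ge> 0"
    then have "Pos (of_int (- 1 - j) * eps)" by (intro Pos_mult Pos_eps1) simp
    then have "Pos (of_int (- 1 - j) * eps + of_int j * eps)" using P Pos_add by blast
    then show False using eps_pos by (simp add: algebra_simps)
  qed
qed (use Pos_mult Pos_eps1 in blast)

text \<open>If x were negative, then x \<le> - eps, and k x could not exceed - k eps.\<close>

lemma Pos_cancel: "k > 0 \<Longrightarrow> Pos (of_int k * x) \<longleftrightarrow> Pos x"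
proof
  assume k: "k > 0" "Pos (of_int k * x)"
  show "Pos x"
  proof (rule ccontr)
    assume "\<not> Pos x"
    then have "Pos (of_int k * (- x - eps))" using k not_Pos Pos_mult by simp
    then have "Pos (of_int k * (- x - eps) + of_int k * x)" using k Pos_add by blast
    then have "Pos (of_int (- k) * eps)" by (simp add: algebra_simps)
    then show False using k Pos_of_int_eps[of "- k"] by linarith
  qed
qed (simp add: Pos_mult)

lemma null_0: "null Pos 0"
  by (simp add: null_def Pos_0)

lemma null_minus: "null Pos x \<Longrightarrow> null Pos (- x)"
  by (simp add: null_def)

lemma null_add: "null Pos x \<Longrightarrow> null Pos y \<Longrightarrow> null Pos (x + y)"
  using Pos_add[of "- x" "- y"] by (simp add: null_def Pos_add)

lemma null_diff: "null Pos x \<Longrightarrow> null Pos y \<Longrightarrow> null Pos (x - y)"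
  using null_add[of x "- y"] null_minus by simp

lemma null_mult: "null Pos x \<Longrightarrow> null Pos (of_int k * x)"
  using Pos_mult[of k x] Pos_mult[of k "- x"] Pos_mult[of "- k" x] Pos_mult[of "- k" "- x"]
  by (cases "k \<ge> 0") (auto simp: null_def)

lemma null_commute: "null Pos (x - y) \<longleftrightarrow> null Pos (y - x)"
  by (auto simp: null_def)

lemma null_trans: "null Pos (x - y) \<Longrightarrow> null Pos (y - z) \<Longrightarrow> null Pos (x - z)"
  using null_add[of "x - y" "y - z"] by simp

lemma Pos_null: "null Pos (x - y) \<Longrightarrow> Pos x \<longleftrightarrow> Pos y"
  using Pos_add[of "x - y" y] Pos_add[of "y - x" x] by (auto simp: null_def)

lemma null_eps: "null Pos (of_int j * eps) \<longleftrightarrow> j = 0"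
  using Pos_of_int_eps[of j] Pos_of_int_eps[of "- j"] by (auto simp: null_def)

section \<open>Divisibility up to null elements\<close>

lemma Div_add: "Div Pos m x \<Longrightarrow> Div Pos m y \<Longrightarrow> Div Pos m (x + y)"
proof -
  assume "Div Pos m x" "Div Pos m y"
  then obtain z w where "null Pos (x - of_int m * z)" "null Pos (y - of_int m * w)"
    unfolding Div_def by auto
  from null_add[OF this] have "null Pos (x + y - of_int m * (z + w))" by (simp add: algebra_simps)
  then show ?thesis unfolding Div_def by blast
qed

lemma Div_minus: "Div Pos m x \<Longrightarrow> Div Pos m (- x)"
proof -
  assume "Div Pos m x"
  then obtain z where "null Pos (x - of_int m * z)" unfolding Div_def by auto
  from null_minus[OF this] have "null Pos (- x - of_int m * (- z))" by (simp add: algebra_simps)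
  then show ?thesis unfolding Div_def by blast
qed

lemma Div_diff: "Div Pos m x \<Longrightarrow> Div Pos m y \<Longrightarrow> Div Pos m (x - y)"
  using Div_add[of m x "- y"] Div_minus by simp

lemma Div_self: "Div Pos m (of_int m * z)"
  unfolding Div_def using null_0 by (metis diff_self)

lemma Div_dvd: "Div Pos m x \<Longrightarrow> k dvd m \<Longrightarrow> Div Pos k x"
  unfolding Div_def by (metis dvdE mult.assoc of_int_mult)

lemma Div_dvd_mult: "m dvd k \<Longrightarrow> Div Pos m (of_int k * x)"
  using Div_self Div_dvd by blast

lemma Div_mult: "Div Pos m x \<Longrightarrow> Div Pos m (of_int k * x)"
proof -
  assume "Div Pos m x"
  then obtain z where "null Pos (x - of_int m * z)" unfolding Div_def by auto
  from null_mult[OF this, of k] have "null Pos (of_int k * x - of_int m * (of_int k * z))"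
    by (simp add: algebra_simps)
  then show ?thesis unfolding Div_def by blast
qed

lemma Div_null: "null Pos (x - y) \<Longrightarrow> Div Pos m x \<longleftrightarrow> Div Pos m y"
  unfolding Div_def using null_trans null_commute by meson

lemma Div_cong: "Div Pos m (x - y) \<Longrightarrow> Div Pos m x \<longleftrightarrow> Div Pos m y"
  using Div_diff[of m x "x - y"] Div_add[of m "x - y" y] by auto

text \<open>A negative multiple m z has z \<le> - eps, so there is a gap of length m below 0. This
  gap yields the uniqueness of remainders and locates the answer in the game.\<close>

lemma Div_gap:
  assumes "m \<ge> 1" "Div Pos m x" "\<not> Pos x" shows "Pos (- x - of_int m * eps)"
proof -
  obtain z where z: "null Pos (x - of_int m * z)" using assms unfolding Div_def by auto
  then have "\<not> Pos (of_int m * z)" using assms Pos_null by blast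
  then have "\<not> Pos z" using Pos_mult assms by auto
  then have "Pos (of_int m * (- z - eps))" using not_Pos Pos_mult assms by simp
  moreover have "null Pos ((- x - of_int m * eps) - (of_int m * (- z - eps)))"
    using null_minus[OF z] by (simp add: algebra_simps)
  ultimately show ?thesis using Pos_null by blast
qed

lemma Div_eps: "m \<ge> 1 \<Longrightarrow> Div Pos m (of_int j * eps) \<longleftrightarrow> m dvd j"
proof
  assume m: "m \<ge> 1" and D: "Div Pos m (of_int j * eps)"
  \<comment> \<open>The remainder is moved to - s with 0 < s \<le> m, so that the form is strictly
    negative and \<open>Div_gap\<close> applies. It forces s = m.\<close>
  define s where "s = m - j mod m"
  have s: "0 < s" "s \<le> m" using m by (simp_all add: s_def)
  have "of_int j * eps - of_int m * (of_int (j div m + 1) * eps) = of_int (- s) * eps"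
    by (simp add: s_def algebra_simps minus_mult_div_eq_mod[symmetric])
  then have "Div Pos m (of_int (- s) * eps)" using Div_diff[OF D Div_self] by metis
  moreover have "\<not> Pos (of_int (- s) * eps)" using s Pos_of_int_eps[of "- s"] by linarith
  ultimately have "Pos (- (of_int (- s) * eps) - of_int m * eps)" using Div_gap m by blast
  then have "Pos (of_int (s - m) * eps)" by (simp add: algebra_simps)
  then have "s \<ge> m" unfolding Pos_of_int_eps by simp
  then have "j mod m = 0" using s m pos_mod_sign[of m j] unfolding s_def by linarith
  then show "m dvd j" by auto
qed (simp add: Div_dvd_mult)

end

section \<open>Linear forms over groups with division by integers with remainder\<close>

locale zgroup = discrete_group +
  assumes division: "m \<ge> 1 \<Longrightarrow> \<exists>r. Div Pos m (x - of_int r * eps)"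
begin

text \<open>The window of remainders may start anywhere: the game uses 0, the approximation of u
  needs remainders beyond a given bound.\<close>

lemma remainder: "m \<ge> 1 \<Longrightarrow> \<exists>r\<in>{a..<a + m}. Div Pos m (x - of_int r * eps)"
proof -
  assume m: "m \<ge> 1"
  then obtain r where r: "Div Pos m (x - of_int r * eps)" using division by blast
  define s where "s = a + (r - a) mod m"
  have e: "r - s = m * ((r - a) div m)" by (simp add: s_def algebra_simps minus_mult_div_eq_mod[symmetric])
  then have "Div Pos m (of_int (r - s) * eps)" by (intro Div_dvd_mult) simp
  from Div_add[OF r this] have "Div Pos m (x - of_int s * eps)" by (simp add: algebra_simps)
  moreover have "s \<in> {a..<a + m}" using m by (simp add: s_def)
  ultimately show ?thesis by blast
qed

end

definition lin :: "nat \<Rightarrow> (nat \<Rightarrow> 'g::comm_ring_1) \<Rightarrow> (nat \<Rightarrow> int) \<Rightarrow> 'g" where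
  "lin N e c = (\<Sum>i<N. of_int (c i) * e i)"

text \<open>Agreement of the quantifier-free Presburger types of two tuples, restricted to
  coefficients and moduli up to M. This is the invariant of the game.\<close>

definition lin_eq :: "('g::comm_ring_1 \<Rightarrow> bool) \<Rightarrow> ('h::comm_ring_1 \<Rightarrow> bool) \<Rightarrow> nat \<Rightarrow> int
    \<Rightarrow> (nat \<Rightarrow> 'g) \<Rightarrow> (nat \<Rightarrow> 'h) \<Rightarrow> bool" where
  "lin_eq Pos Pos' N M e e' \<longleftrightarrow> (\<forall>c. (\<forall>i<N. \<bar>c i\<bar> \<le> M) \<longrightarrow>
     (Pos (lin N e c) \<longleftrightarrow> Pos' (lin N e' c))
     \<and> (\<forall>m\<in>{1..M}. Div Pos m (lin N e c) \<longleftrightarrow> Div Pos' m (lin N e' c)))"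

lemma lin_eq_sym: "lin_eq Pos Pos' N M e e' \<longleftrightarrow> lin_eq Pos' Pos N M e' e"
  unfolding lin_eq_def by blast

lemma lin_eq_mono: "lin_eq Pos Pos' N M e e' \<Longrightarrow> M' \<le> M \<Longrightarrow> lin_eq Pos Pos' N M' e e'"
  unfolding lin_eq_def by (meson atLeastAtMost_iff order_trans)

lemma lin_diff: "lin N e c - lin N e d = lin N e (\<lambda>i. c i - d i)"
  by (simp add: lin_def sum_subtractf algebra_simps)

lemma lin_scale: "of_int k * lin N e c = lin N e (\<lambda>i. k * c i)"
  by (simp add: lin_def sum_distrib_left algebra_simps)

lemma lin_cong: "(\<And>i. i < N \<Longrightarrow> c i = d i) \<Longrightarrow> lin N e c = lin N e d"
  by (simp add: lin_def)

lemma lin_single: "i < N \<Longrightarrow> lin N e (\<lambda>j. if j = i then k else 0) = of_int k * e i"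
proof -
  assume "i < N"
  have "lin N e (\<lambda>j. if j = i then k else 0) = (\<Sum>j<N. if j = i then of_int k * e j else 0)"
    unfolding lin_def by (intro sum.cong) auto
  then show ?thesis using \<open>i < N\<close> by simp
qed

lemma lin_add_single:
  "i < N \<Longrightarrow> lin N e (\<lambda>j. c j + (if j = i then k else 0)) = lin N e c + of_int k * e i"
proof -
  assume "i < N"
  have "lin N e (\<lambda>j. c j + (if j = i then k else 0)) = lin N e c + lin N e (\<lambda>j. if j = i then k else 0)"
    by (simp add: lin_def sum.distrib algebra_simps)
  then show ?thesis using lin_single[OF \<open>i < N\<close>, of e k] by simp
qed

lemma lin_upd: "i < N \<Longrightarrow> lin N (e(i := x)) c = of_int (c i) * x + lin N e (c(i := 0))"
proof -
  assume "i < N"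
  have "lin N (e(i := x)) c = (\<Sum>j<N. (if j = i then of_int (c j) * x else 0) + of_int ((c(i := 0)) j) * e j)"
    unfolding lin_def by (intro sum.cong) auto
  then show ?thesis using \<open>i < N\<close> by (simp add: sum.distrib lin_def)
qed

lemma (in discrete_group) exists_maximal:
  assumes "finite S" "S \<noteq> {}" shows "\<exists>g\<in>S. \<forall>h\<in>S. Pos (F g - F h)"
  using assms
proof (induction rule: finite_ne_induct)
  case (singleton x)
  then show ?case using Pos_0 by simp
next
  case (insert x S)
  then obtain g where g: "g \<in> S" "\<forall>h\<in>S. Pos (F g - F h)" by blast
  show ?case
  proof (cases "Pos (F g - F x)")
    case True
    then show ?thesis using g by blast
  next
    case False
    then have P: "Pos (F x - F g)" using Pos_total[of "F g - F x"] by simp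
    have "Pos (F x - F h)" if "h \<in> S" for h
      using Pos_add[OF P, of "F g - F h"] g that by simp
    then show ?thesis using Pos_0 by auto
  qed
qed

text \<open>
  The step of the Ehrenfeucht-Fraisse game. The new element \<open>x\<close> enters the forms
  only through \<open>Q x\<close> for \<open>Q = M!\<close> and through its remainder modulo \<open>Q\<close>. If \<open>g\<close> is a form
  with small coefficients whose value is the largest one below \<open>Q x\<close>, then the answer \<open>y\<close> is such
  that \<open>Q y\<close> is the smallest element above the value of \<open>g\<close> in the other group for which \<open>y\<close> has
  the right remainder.
\<close>

theorem lin_eq_step:
  fixes Pos :: "'g::comm_ring_1 \<Rightarrow> bool" and Pos' :: "'h::comm_ring_1 \<Rightarrow> bool"
  assumes "zgroup Pos eps" "zgroup Pos' eps'"
    and M: "M \<ge> 1" and Q: "Q = fact (nat M)"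
    and eq: "lin_eq Pos Pos' N (4 * (Q * Q * (M + 1))) e e'"
    and e: "e 1 = eps" "e' 1 = eps'" and i: "1 < i" "i < N" and x: "Pos x"
  shows "\<exists>y. lin_eq Pos Pos' N M (e(i := x)) (e'(i := y))"
proof -
  interpret A: zgroup Pos eps by fact
  interpret B: zgroup Pos' eps' by fact
  have N: "1 < N" using i by simp
  have Q1: "Q \<ge> 1" unfolding Q by (simp add: fact_ge_1)
  \<comment> \<open>Clearing a coefficient k of the new element multiplies a form by Q / k, which
    gives B; the 1 in M + 1 is for the eps of a negated inequality. L leaves room for a difference
    of two such forms, for a shift by up to Q^2 multiples of eps, and for the modulus Q^2.\<close>
  define B where "B = Q * (M + 1)"
  define L where "L = 4 * (Q * Q * (M + 1))"
  have QB: "Q * Q \<ge> Q" using Q1 by (simp add: mult_le_cancel_left1)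
  have "Q * Q * (M + 1) \<ge> Q * (M + 1)" using mult_right_mono[OF QB, of "M + 1"] M by simp
  moreover have "Q * Q * (M + 1) \<ge> Q * Q * 1" by (rule mult_left_mono) (use M in auto)
  moreover have "Q * (M + 1) \<ge> M + 1" using mult_right_mono[OF Q1, of "M + 1"] M by simp
  moreover have QM: "Q * (M + 1) = Q * M + Q" by (simp add: algebra_simps)
  moreover have "Q * M \<ge> M" using mult_right_mono[OF Q1, of M] M by simp
  ultimately have L: "L \<ge> 2 * B + 2 * (Q * Q)" "L \<ge> B + Q * Q + Q * Q" "L \<ge> Q * M + M + M + 1" "L \<ge> Q * Q"
      "L \<ge> M" "B \<ge> 0" "L \<ge> 0"
    using M Q1 unfolding L_def B_def by linarith+
  have L2: "2 * B + Q * Q \<le> L" "2 * B \<le> L" using L QB Q1 by linarith+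
  have P: "Pos (lin N e c) \<longleftrightarrow> Pos' (lin N e' c)" if "\<forall>i<N. \<bar>c i\<bar> \<le> L" for c
    using eq that unfolding lin_eq_def L_def by blast
  have D: "Div Pos m (lin N e c) \<longleftrightarrow> Div Pos' m (lin N e' c)"
    if "\<forall>i<N. \<bar>c i\<bar> \<le> L" "m \<ge> 1" "m \<le> L" for c m
    using eq that unfolding lin_eq_def L_def by auto
  have leps: "lin N e (\<lambda>j. c j + (if j = 1 then k else 0)) = lin N e c + of_int k * eps"
    "lin N e' (\<lambda>j. c j + (if j = 1 then k else 0)) = lin N e' c + of_int k * eps'" for c k
    using lin_add_single[OF N, of _ c k] e by metis+
  obtain r z where r: "r \<in> {0..<Q}" and z: "null Pos (x - of_int r * eps - of_int Q * z)"
    using A.remainder[OF Q1, of 0 x] unfolding Div_def by auto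
  \<comment> \<open>Coefficients beyond the first N indices are set to 0 so that S is finite and a
    largest form exists. The zero form lies in S because x is nonnegative.\<close>
  define S where "S = {c. (\<forall>i. (i \<in> {..<N} \<longrightarrow> c i \<in> {- B..B}) \<and> (i \<notin> {..<N} \<longrightarrow> c i = 0))
      \<and> Pos (of_int Q * x - lin N e c)}"
  have "finite S"
    unfolding S_def by (rule finite_subset[OF _ finite_set_of_finite_funs[of "{..<N}" "{- B..B}" 0]]) auto
  moreover have "(\<lambda>_. 0) \<in> S"
    using L A.Pos_mult[of Q x] x Q1 by (simp add: S_def lin_def)
  ultimately obtain g where g: "g \<in> S" and gmax: "\<And>h. h \<in> S \<Longrightarrow> Pos (lin N e g - lin N e h)"
    using A.exists_maximal[of S "lin N e"] by blast
  have gB: "\<bar>g j\<bar> \<le> B" if "j < N" for j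
    using g that by (auto simp: S_def abs_le_iff minus_le_iff)
  obtain t where t: "t \<in> {0..<Q * Q}"
    and Dt: "Div Pos (Q * Q) (of_int (Q * r) * eps - lin N e g - of_int t * eps)"
    using A.remainder[of "Q * Q" 0 "of_int (Q * r) * eps - lin N e g"] QB Q1 by auto
  \<comment> \<open>The value of c1 is divisible by Q^2, and this transfers. If w is the quotient in
    the other group, then y = r eps' + Q w has remainder r modulo Q, and Q y = g + t eps'.\<close>
  define c1 where "c1 = (\<lambda>j. g j + (if j = 1 then t - Q * r else 0))"
  have Qr: "0 \<le> Q * r" "Q * r \<le> Q * Q" using r Q1 by (auto intro: mult_left_mono)
  have c1: "\<forall>j<N. \<bar>c1 j\<bar> \<le> L"
  proof (intro allI impI)
    fix j assume "j < N"
    then show "\<bar>c1 j\<bar> \<le> L" using gB[of j] t Qr L by (auto simp: c1_def)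
  qed
  have Dc1: "Div Pos (Q * Q) (lin N e c1)"
    using A.Div_minus[OF Dt] unfolding c1_def leps by (simp add: algebra_simps)
  then have "Div Pos' (Q * Q) (lin N e' c1)" using D[OF c1] QB Q1 L by simp
  then obtain w where w: "null Pos' (lin N e' c1 - of_int (Q * Q) * w)" unfolding Div_def by blast
  define y where "y = of_int r * eps' + of_int Q * w"
  have Qy: "null Pos' (of_int Q * y - (lin N e' g + of_int t * eps'))"
    using B.null_minus[OF w] unfolding c1_def leps y_def by (simp add: algebra_simps)
  \<comment> \<open>The difference is divisible by Q^2. If it were negative it would be at most -
    Q^2 eps, contrary to g \<le> Q x and t < Q^2.\<close>
  have Qx: "Pos (of_int Q * x - (lin N e g + of_int t * eps))"
  proof (rule ccontr)
    assume n: "\<not> ?thesis"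
    have "null Pos (of_int Q * (x - of_int r * eps - of_int Q * z))" using A.null_mult[OF z] .
    then have "Div Pos (Q * Q) (of_int Q * x - of_int (Q * r) * eps)"
      unfolding Div_def by (intro exI[of _ z]) (simp add: algebra_simps)
    from A.Div_diff[OF this Dc1]
    have "Div Pos (Q * Q) (of_int Q * x - (lin N e g + of_int t * eps))"
      unfolding c1_def leps by (simp add: algebra_simps)
    from A.Div_gap[OF _ this n] QB Q1
    have "Pos (lin N e g + of_int t * eps - of_int Q * x - of_int (Q * Q) * eps)"
      by (simp add: algebra_simps)
    moreover have "Pos (of_int Q * x - lin N e g)" using g by (simp add: S_def)
    ultimately have "Pos ((lin N e g + of_int t * eps - of_int Q * x - of_int (Q * Q) * eps) + (of_int Q * x - lin N e g))"
      by (rule A.Pos_add)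
    then have "Pos (of_int (t - Q * Q) * eps)" by (simp add: algebra_simps)
    then show False unfolding A.Pos_of_int_eps using t by simp
  qed
  \<comment> \<open>A form below Q x is below g by maximality, hence below Q y after transfer. A
    form below Q y is at most g + t eps', and after transfer it is below Q x, since g + t eps
    is.\<close>
  have cmp: "Pos (of_int Q * x - lin N e h) \<longleftrightarrow> Pos' (of_int Q * y - lin N e' h)"
    if h: "\<forall>j<N. \<bar>h j\<bar> \<le> B" for h
  proof -
    define h' where "h' = (\<lambda>j. if j < N then h j else 0)"
    have hh: "lin N e h = lin N e h'" "lin N e' h = lin N e' h'"
      by (auto simp: h'_def intro: lin_cong)
    show ?thesis
    proof
      assume "Pos (of_int Q * x - lin N e h)"
      then have "h' \<in> S" using h hh by (auto simp: S_def h'_def abs_le_iff)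
      then have "Pos (lin N e g - lin N e h)" using gmax hh by simp
      moreover have "\<forall>j<N. \<bar>g j - h j\<bar> \<le> L"
      proof (intro allI impI)
        fix j assume "j < N"
        then have "\<bar>g j\<bar> \<le> B" "\<bar>h j\<bar> \<le> B" using gB h by auto
        then show "\<bar>g j - h j\<bar> \<le> L" using L2 by linarith
      qed
      ultimately have 1: "Pos' (lin N e' g - lin N e' h)"
        using P[of "\<lambda>j. g j - h j"] by (simp only: lin_diff)
      have 2: "Pos' (of_int Q * y - (lin N e' g + of_int t * eps'))" using Qy by (simp add: null_def)
      have 3: "Pos' (of_int t * eps')" using t by (simp add: B.Pos_of_int_eps)
      have "(lin N e' g - lin N e' h) + ((of_int Q * y - (lin N e' g + of_int t * eps')) + of_int t * eps')
        = of_int Q * y - lin N e' h" by simp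
      then show "Pos' (of_int Q * y - lin N e' h)" using B.Pos_add[OF 1 B.Pos_add[OF 2 3]] by metis
    next
      assume y: "Pos' (of_int Q * y - lin N e' h)"
      have "Pos' ((lin N e' g + of_int t * eps') - of_int Q * y)"
        using B.null_minus[OF Qy] by (simp add: null_def)
      from B.Pos_add[OF this y] have "Pos' (lin N e' g - lin N e' h + of_int t * eps')"
        by (simp add: algebra_simps)
      moreover have "\<forall>j<N. \<bar>(g j - h j) + (if j = 1 then t else 0)\<bar> \<le> L"
      proof (intro allI impI)
        fix j assume "j < N"
        then have "\<bar>g j\<bar> \<le> B" "\<bar>h j\<bar> \<le> B" using gB h by auto
        moreover define s where "s = (if j = 1 then t else 0)"
        have "0 \<le> s" "s \<le> Q * Q" using t QB Q1 by (auto simp: s_def)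
        ultimately show "\<bar>(g j - h j) + (if j = 1 then t else 0)\<bar> \<le> L"
          unfolding s_def[symmetric] using L2 by linarith
      qed
      ultimately have "Pos (lin N e g - lin N e h + of_int t * eps)"
        using P[of "\<lambda>j. (g j - h j) + (if j = 1 then t else 0)"] by (simp only: lin_diff leps)
      from A.Pos_add[OF this Qx] show "Pos (of_int Q * x - lin N e h)" by (simp add: algebra_simps)
    qed
  qed
  have kdvd: "k dvd Q" if "1 \<le> k" "k \<le> M" for k
  proof -
    have "nat k dvd fact (nat M)" using that by (intro dvd_fact) auto
    then have "int (nat k) dvd int (fact (nat M))" by (simp only: int_dvd_int_iff)
    then show ?thesis using that by (simp add: Q)
  qed
  \<comment> \<open>The comparison of k x with h is multiplied by Q / k, which turns it into one
    with Q x.\<close>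
  have ge: "Pos (of_int k * x - lin N e h) \<longleftrightarrow> Pos' (of_int k * y - lin N e' h)"
    if k: "1 \<le> k" "k \<le> M" and h: "\<forall>j<N. \<bar>h j\<bar> \<le> M + 1" for k h
  proof -
    obtain q where q: "Q = k * q" using kdvd[OF k] by auto
    have q0: "q > 0" using q Q1 k zero_less_mult_iff[of k q] by linarith
    have "q \<le> Q" using mult_right_mono[OF k(1), of q] q q0 by simp
    then have "\<bar>q * h j\<bar> \<le> B" if "j < N" for j
      unfolding B_def abs_mult using h that q0 by (intro mult_mono) auto
    then have "Pos (of_int Q * x - lin N e (\<lambda>j. q * h j)) \<longleftrightarrow> Pos' (of_int Q * y - lin N e' (\<lambda>j. q * h j))"
      by (intro cmp) blast
    moreover have "of_int Q * x - lin N e (\<lambda>j. q * h j) = of_int q * (of_int k * x - lin N e h)"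
      "of_int Q * y - lin N e' (\<lambda>j. q * h j) = of_int q * (of_int k * y - lin N e' h)"
      by (simp_all add: lin_scale[symmetric] q algebra_simps)
    ultimately show ?thesis using A.Pos_cancel[OF q0] B.Pos_cancel[OF q0] by simp
  qed
  have "lin_eq Pos Pos' N M (e(i := x)) (e'(i := y))"
    unfolding lin_eq_def lin_upd[OF i(2)]
  proof (intro allI impI conjI ballI)
    fix c assume c: "\<forall>j<N. \<bar>c j\<bar> \<le> M"
    define k where "k = c i"
    define f where "f = c(i := 0)"
    have f: "\<bar>f j\<bar> \<le> M" if "j < N" for j using c that M by (simp add: f_def)
    have k: "\<bar>k\<bar> \<le> M" using c i by (simp add: k_def)
    have "Pos (of_int k * x + lin N e f) \<longleftrightarrow> Pos' (of_int k * y + lin N e' f)"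
    proof (cases k "0 :: int" rule: linorder_cases)
      case equal
      have "\<forall>j<N. \<bar>f j\<bar> \<le> L" using f L by force
      then show ?thesis using equal P[of f] by simp
    next
      case greater
      have "\<forall>j<N. \<bar>- 1 * f j\<bar> \<le> M + 1" using f by force
      from ge[OF _ _ this, of k] show ?thesis
        using greater k unfolding lin_scale[symmetric] by simp
    next
      case less
      \<comment> \<open>For negative k the statement is negated: k x + f < 0 means (- k) x \<ge> f +
        eps.\<close>
      have "\<bar>f j + (if j = 1 then 1 else 0)\<bar> \<le> M + 1" if "j < N" for j
        using f[OF that] by (cases "j = 1") auto
      then have "Pos (of_int (- k) * x - (lin N e f + eps)) \<longleftrightarrow> Pos' (of_int (- k) * y - (lin N e' f + eps'))"
        using ge[of "- k" "\<lambda>j. f j + (if j = 1 then 1 else 0)"] less k unfolding leps by simp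
      then show ?thesis
        using A.not_Pos[of "of_int k * x + lin N e f"] B.not_Pos[of "of_int k * y + lin N e' f"]
        by (auto simp: algebra_simps)
    qed
    then show "Pos (of_int (c i) * x + lin N e (c(i := 0))) = Pos' (of_int (c i) * y + lin N e' (c(i := 0)))"
      by (simp add: k_def f_def)
    fix m assume m: "m \<in> {1..M}"
    have mQ: "m dvd Q" using kdvd m by simp
    \<comment> \<open>Modulo a divisor m of Q both x and y are r times the atom, so divisibility
      only concerns the old form f shifted by k r.\<close>
    have "null Pos (of_int k * (x - of_int r * eps - of_int Q * z))" using A.null_mult[OF z] .
    then have "Div Pos m ((of_int k * x + lin N e f) - (lin N e f + of_int (k * r) * eps))
        \<longleftrightarrow> Div Pos m (of_int (k * Q) * z)"
      by (intro A.Div_null) (simp add: algebra_simps)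
    then have 1: "Div Pos m (of_int k * x + lin N e f) \<longleftrightarrow> Div Pos m (lin N e f + of_int (k * r) * eps)"
      using A.Div_cong A.Div_dvd_mult mQ by (metis dvd_mult)
    have "(of_int k * y + lin N e' f) - (lin N e' f + of_int (k * r) * eps') = of_int (k * Q) * w"
      by (simp add: y_def algebra_simps)
    then have 2: "Div Pos' m (of_int k * y + lin N e' f) \<longleftrightarrow> Div Pos' m (lin N e' f + of_int (k * r) * eps')"
      using B.Div_cong B.Div_dvd_mult mQ by (metis dvd_mult)
    have kr: "\<bar>k * r\<bar> \<le> M * Q" unfolding abs_mult using k r by (intro mult_mono) auto
    have "\<forall>j<N. \<bar>f j + (if j = 1 then k * r else 0)\<bar> \<le> L"
    proof (intro allI impI)
      fix j assume "j < N"
      define s where "s = (if j = 1 then k * r else 0)"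
      have "\<bar>s\<bar> \<le> Q * M" using kr M Q1 by (auto simp: s_def mult.commute)
      then show "\<bar>f j + (if j = 1 then k * r else 0)\<bar> \<le> L"
        unfolding s_def[symmetric] using f[OF \<open>j < N\<close>] L(3) M by linarith
    qed
    from D[OF this, of m] m L
    have "Div Pos m (lin N e f + of_int (k * r) * eps) \<longleftrightarrow> Div Pos' m (lin N e' f + of_int (k * r) * eps')"
      unfolding leps by simp
    with 1 2 show "Div Pos m (of_int (c i) * x + lin N e (c(i := 0))) = Div Pos' m (of_int (c i) * y + lin N e' (c(i := 0)))"
      by (simp add: k_def f_def)
  qed
  then show ?thesis by blast
qed

section \<open>First-order formulas over MV-algebras\<close>

definition FImp where "FImp \<phi> \<psi> = FNot (FAnd \<phi> (FNot \<psi>))"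
definition FEx where "FEx x \<phi> = FNot (FAll x (FNot \<phi>))"
definition FOr where "FOr \<phi> \<psi> = FNot (FAnd (FNot \<phi>) (FNot \<psi>))"
definition FAnds where "FAnds \<phi>s = foldr FAnd \<phi>s (FEq Zero Zero)"
definition FOrs where "FOrs \<phi>s = FNot (FAnds (map FNot \<phi>s))"
definition FAlls where "FAlls xs \<phi> = foldr FAll xs \<phi>"
definition TTimes where "TTimes s t = Neg (Plus (Neg s) (Neg t))"

primrec TMult :: "nat \<Rightarrow> mv_term \<Rightarrow> mv_term" where
  "TMult 0 t = Zero"
| "TMult (Suc k) t = Plus (TMult k t) t"

lemma sat_simps [simp]:
  "sat A c v (FImp \<phi> \<psi>) \<longleftrightarrow> (sat A c v \<phi> \<longrightarrow> sat A c v \<psi>)"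
  "sat A c v (FEx x \<phi>) \<longleftrightarrow> (\<exists>a\<in>carrier A. sat A c (v(x := a)) \<phi>)"
  "sat A c v (FOr \<phi> \<psi>) \<longleftrightarrow> sat A c v \<phi> \<or> sat A c v \<psi>"
  by (auto simp: FImp_def FEx_def FOr_def)

lemma sat_FAnds [simp]: "sat A c v (FAnds \<phi>s) \<longleftrightarrow> (\<forall>\<phi>\<in>set \<phi>s. sat A c v \<phi>)"
  unfolding FAnds_def by (induction \<phi>s) auto

lemma sat_FOrs [simp]: "sat A c v (FOrs \<phi>s) \<longleftrightarrow> (\<exists>\<phi>\<in>set \<phi>s. sat A c v \<phi>)"
  by (simp add: FOrs_def)

lemma term_val_simps [simp]:
  "term_val A c v (TTimes s t) = mv_times A (term_val A c v s) (term_val A c v t)"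
  "term_val A c v (TMult k t) = mv_mult A k (term_val A c v t)"
  by (induction k) (simp_all add: TTimes_def mv_times_def)

lemma form_consts_simps [simp]:
  "form_consts (FImp \<phi> \<psi>) = form_consts \<phi> \<union> form_consts \<psi>"
  "form_consts (FEx x \<phi>) = form_consts \<phi>"
  "form_consts (FOr \<phi> \<psi>) = form_consts \<phi> \<union> form_consts \<psi>"
  "term_consts (TTimes s t) = term_consts s \<union> term_consts t"
  by (auto simp: FImp_def FEx_def FOr_def TTimes_def)

lemma form_consts_FAnds [simp]: "form_consts (FAnds \<phi>s) = (\<Union>\<phi>\<in>set \<phi>s. form_consts \<phi>)"
  unfolding FAnds_def by (induction \<phi>s) auto

lemma form_consts_FOrs [simp]: "form_consts (FOrs \<phi>s) = (\<Union>\<phi>\<in>set \<phi>s. form_consts \<phi>)"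
  by (simp add: FOrs_def)

lemma form_consts_FAlls [simp]: "form_consts (FAlls xs \<phi>) = form_consts \<phi>"
  unfolding FAlls_def by (induction xs) auto

lemma free_vars_FAlls: "free_vars (FAlls xs \<phi>) = free_vars \<phi> - set xs"
  unfolding FAlls_def by (induction xs) auto

lemma term_val_cong:
  "(\<And>x. x \<in> term_vars t \<Longrightarrow> v x = v' x) \<Longrightarrow> (\<And>i. i \<in> term_consts t \<Longrightarrow> c i = c' i)
    \<Longrightarrow> term_val A c v t = term_val A c' v' t"
  by (induction t) auto

lemma sat_cong:
  "(\<And>x. x \<in> free_vars \<phi> \<Longrightarrow> v x = v' x) \<Longrightarrow> (\<And>i. i \<in> form_consts \<phi> \<Longrightarrow> c i = c' i)
    \<Longrightarrow> sat A c v \<phi> \<longleftrightarrow> sat A c' v' \<phi>"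
proof (induction \<phi> arbitrary: v v')
  case (FEq s t)
  then have "term_val A c v s = term_val A c' v' s" "term_val A c v t = term_val A c' v' t"
    by (auto intro!: term_val_cong)
  then show ?case by simp
next
  case (FNot \<phi>)
  then show ?case by simp
next
  case (FAnd \<phi> \<psi>)
  have "sat A c v \<phi> \<longleftrightarrow> sat A c' v' \<phi>" "sat A c v \<psi> \<longleftrightarrow> sat A c' v' \<psi>"
    by (rule FAnd.IH; use FAnd.prems in simp)+
  then show ?case by simp
next
  case (FAll x \<phi>)
  have "sat A c (v(x := a)) \<phi> \<longleftrightarrow> sat A c' (v'(x := a)) \<phi>" for a
    by (rule FAll.IH) (use FAll.prems in auto)
  then show ?case by simp
qed

lemma sat_FAlls:
  assumes "\<And>x. v x \<in> carrier A"
  shows "sat A c v (FAlls xs \<phi>) \<longleftrightarrow>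
    (\<forall>w. (\<forall>x. w x \<in> carrier A) \<longrightarrow> (\<forall>x. x \<notin> set xs \<longrightarrow> w x = v x) \<longrightarrow> sat A c w \<phi>)"
  using assms
proof (induction xs arbitrary: v)
  case Nil
  then have "(\<forall>x. w x = v x) \<longleftrightarrow> w = v" for w by auto
  then show ?case using Nil by (auto simp: FAlls_def)
next
  case (Cons y xs)
  have "sat A c v (FAlls (y # xs) \<phi>) \<longleftrightarrow> (\<forall>a\<in>carrier A. sat A c (v(y := a)) (FAlls xs \<phi>))"
    by (simp add: FAlls_def)
  also have "\<dots> \<longleftrightarrow> (\<forall>a\<in>carrier A. \<forall>w. (\<forall>x. w x \<in> carrier A) \<longrightarrow>
      (\<forall>x. x \<notin> set xs \<longrightarrow> w x = (v(y := a)) x) \<longrightarrow> sat A c w \<phi>)"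
  proof (rule ball_cong)
    fix a assume "a \<in> carrier A"
    then show "sat A c (v(y := a)) (FAlls xs \<phi>) \<longleftrightarrow> (\<forall>w. (\<forall>x. w x \<in> carrier A) \<longrightarrow>
      (\<forall>x. x \<notin> set xs \<longrightarrow> w x = (v(y := a)) x) \<longrightarrow> sat A c w \<phi>)"
      by (intro Cons.IH) (simp add: Cons.prems)
  qed simp
  also have "\<dots> \<longleftrightarrow> (\<forall>w. (\<forall>x. w x \<in> carrier A) \<longrightarrow>
      (\<forall>x. x \<notin> set (y # xs) \<longrightarrow> w x = v x) \<longrightarrow> sat A c w \<phi>)"
  proof (intro iffI allI impI ballI)
    fix w assume *: "\<forall>a\<in>carrier A. \<forall>w. (\<forall>x. w x \<in> carrier A) \<longrightarrow>
      (\<forall>x. x \<notin> set xs \<longrightarrow> w x = (v(y := a)) x) \<longrightarrow> sat A c w \<phi>"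
      and w: "\<forall>x. w x \<in> carrier A" "\<forall>x. x \<notin> set (y # xs) \<longrightarrow> w x = v x"
    show "sat A c w \<phi>" by (rule *[rule_format, of "w y" w]) (use w in auto)
  next
    fix a w assume *: "\<forall>w. (\<forall>x. w x \<in> carrier A) \<longrightarrow>
      (\<forall>x. x \<notin> set (y # xs) \<longrightarrow> w x = v x) \<longrightarrow> sat A c w \<phi>"
      and w: "\<forall>x. w x \<in> carrier A" "\<forall>x. x \<notin> set xs \<longrightarrow> w x = (v(y := a)) x"
    show "sat A c w \<phi>" by (rule *[rule_format]) (use w in auto)
  qed
  finally show ?case .
qed

section \<open>Validity and universal closures\<close>

definition valid :: "'a mv \<Rightarrow> (nat \<Rightarrow> 'a) \<Rightarrow> mv_form \<Rightarrow> bool" where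
  "valid A c \<phi> \<longleftrightarrow> (\<forall>v. (\<forall>x. v x \<in> carrier A) \<longrightarrow> sat A c v \<phi>)"

lemma finite_term_vars: "finite (term_vars t)"
  by (induction t) auto

lemma finite_free_vars: "finite (free_vars \<phi>)"
  by (induction \<phi>) (auto simp: finite_term_vars)

text \<open>The inserted 0 keeps \<open>Max\<close> meaningful when there are no free
  variables.\<close>

definition univ_closure where
  "univ_closure \<phi> = FAlls [0..<Suc (Max (insert 0 (free_vars \<phi>)))] \<phi>"

lemma free_vars_bound: "free_vars \<phi> \<subseteq> set [0..<Suc (Max (insert 0 (free_vars \<phi>)))]"
proof
  fix x assume "x \<in> free_vars \<phi>"
  then have "x \<le> Max (insert 0 (free_vars \<phi>))" by (intro Max_ge) (simp_all add: finite_free_vars)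
  then show "x \<in> set [0..<Suc (Max (insert 0 (free_vars \<phi>)))]" by auto
qed

lemma univ_closure_sentence: "form_consts \<phi> \<subseteq> {1..n} \<Longrightarrow> univ_closure \<phi> \<in> mv_sentences n"
  using free_vars_bound[of \<phi>] by (auto simp: univ_closure_def mv_sentences_def free_vars_FAlls)

lemma sat_univ_closure:
  assumes v: "\<And>x. v x \<in> carrier A"
  shows "sat A c v (univ_closure \<phi>) \<longleftrightarrow> valid A c \<phi>"
proof -
  define xs where "xs = [0..<Suc (Max (insert 0 (free_vars \<phi>)))]"
  show ?thesis
    unfolding univ_closure_def xs_def[symmetric] sat_FAlls[of v, OF v] valid_def
  proof (intro iffI allI impI)
    fix w :: "nat \<Rightarrow> _"
    assume *: "\<forall>w. (\<forall>x. w x \<in> carrier A) \<longrightarrow> (\<forall>x. x \<notin> set xs \<longrightarrow> w x = v x) \<longrightarrow> sat A c w \<phi>"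
      and w: "\<forall>x. w x \<in> carrier A"
    have "sat A c (\<lambda>x. if x \<in> set xs then w x else v x) \<phi>" by (rule *[rule_format]) (use w v in auto)
    moreover have "sat A c (\<lambda>x. if x \<in> set xs then w x else v x) \<phi> \<longleftrightarrow> sat A c w \<phi>"
      by (rule sat_cong) (use free_vars_bound[of \<phi>] in \<open>auto simp: xs_def\<close>)
    ultimately show "sat A c w \<phi>" by simp
  qed auto
qed

lemma elem_equiv_valid:
  assumes "mv_elem_equiv n A c B d" "form_consts \<phi> \<subseteq> {1..n}" "mv_algebra A" "mv_algebra B"
  shows "valid A c \<phi> \<longleftrightarrow> valid B d \<phi>"
proof -
  have "sat A c (\<lambda>_. mv_zero A) (univ_closure \<phi>) \<longleftrightarrow> valid A c \<phi>"
    "sat B d (\<lambda>_. mv_zero B) (univ_closure \<phi>) \<longleftrightarrow> valid B d \<phi>"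
    using sat_univ_closure[of "\<lambda>_. mv_zero A" A] sat_univ_closure[of "\<lambda>_. mv_zero B" B]
      mv_algebra.zero_closed[OF assms(3)] mv_algebra.zero_closed[OF assms(4)] by auto
  then show ?thesis using assms(1) univ_closure_sentence[OF assms(2)] unfolding mv_elem_equiv_def by blast
qed

section \<open>Invariance of satisfaction under isomorphisms\<close>

lemma iso_closed: "h \<in> mv_iso A B \<Longrightarrow> x \<in> carrier A \<Longrightarrow> h x \<in> carrier B"
  by (auto simp: mv_iso_def bij_betw_def)

lemma iso_term_val:
  assumes "mv_algebra A" "h \<in> mv_iso A B" "\<And>x. v x \<in> carrier A" "\<And>i. i \<in> term_consts t \<Longrightarrow> c i \<in> carrier A"
  shows "term_val A c v t \<in> carrier A \<and> h (term_val A c v t) = term_val B (\<lambda>i. h (c i)) (\<lambda>x. h (v x)) t"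
proof -
  interpret mv_algebra A by fact
  show ?thesis using assms by (induction t) (auto simp: mv_iso_def closed)
qed

lemma iso_sat:
  assumes A: "mv_algebra A" and h: "h \<in> mv_iso A B"
    and "\<And>x. v x \<in> carrier A" "\<And>i. i \<in> form_consts \<phi> \<Longrightarrow> c i \<in> carrier A"
  shows "sat A c v \<phi> \<longleftrightarrow> sat B (\<lambda>i. h (c i)) (\<lambda>x. h (v x)) \<phi>"
  using assms(3,4)
proof (induction \<phi> arbitrary: v)
  case (FEq s t)
  have inj: "inj_on h (carrier A)" using h by (auto simp: mv_iso_def bij_betw_def)
  have "term_val A c v s \<in> carrier A \<and> h (term_val A c v s) = term_val B (\<lambda>i. h (c i)) (\<lambda>x. h (v x)) s"
    "term_val A c v t \<in> carrier A \<and> h (term_val A c v t) = term_val B (\<lambda>i. h (c i)) (\<lambda>x. h (v x)) t"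
    using FEq by (auto intro!: iso_term_val[OF A h])
  then show ?case using inj by (metis inj_on_eq_iff sat.simps(1))
next
  case (FAll x \<phi>)
  have "sat A c (v(x := a)) \<phi> \<longleftrightarrow> sat B (\<lambda>i. h (c i)) ((\<lambda>x. h (v x))(x := h a)) \<phi>"
    if "a \<in> carrier A" for a
    using FAll.IH[of "v(x := a)"] FAll.prems that by (simp add: fun_upd_def if_distrib cong: if_cong)
  moreover have "carrier B = h ` carrier A" using h by (auto simp: mv_iso_def bij_betw_def)
  ultimately show ?case by simp
qed auto

section \<open>Ehrenfeucht-Fraisse games\<close>

text \<open>
  Since there are function symbols, the positions that are winning at the end of the game are
  those that agree on the equations between terms of a bounded size.
\<close>

primrec term_size :: "mv_term \<Rightarrow> nat" where
  "term_size (Var x) = 1"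
| "term_size (Const i) = 1"
| "term_size Zero = 1"
| "term_size (Plus s t) = term_size s + term_size t + 1"
| "term_size (Neg t) = term_size t + 1"

definition ef_atomic :: "nat set \<Rightarrow> nat \<Rightarrow> nat \<Rightarrow> 'a mv \<Rightarrow> (nat \<Rightarrow> 'a) \<Rightarrow> 'b mv \<Rightarrow> (nat \<Rightarrow> 'b)
    \<Rightarrow> (nat \<Rightarrow> 'a) \<Rightarrow> (nat \<Rightarrow> 'b) \<Rightarrow> bool" where
  "ef_atomic K V s A c A' c' v v' \<longleftrightarrow> (\<forall>t t'.
     term_size t \<le> s \<longrightarrow> term_size t' \<le> s \<longrightarrow> term_vars t \<union> term_vars t' \<subseteq> {..<V} \<longrightarrow>
     term_consts t \<union> term_consts t' \<subseteq> K \<longrightarrow>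
     (term_val A c v t = term_val A c v t' \<longleftrightarrow> term_val A' c' v' t = term_val A' c' v' t'))"

text \<open>A move overwrites one of the first V variables, as in a pebble game. Variables that are
  quantified repeatedly then need no renaming, and the forms to be compared always have V + 2
  arguments.\<close>

primrec ef :: "nat set \<Rightarrow> nat \<Rightarrow> nat \<Rightarrow> 'a mv \<Rightarrow> (nat \<Rightarrow> 'a) \<Rightarrow> 'b mv \<Rightarrow> (nat \<Rightarrow> 'b)
    \<Rightarrow> nat \<Rightarrow> (nat \<Rightarrow> 'a) \<Rightarrow> (nat \<Rightarrow> 'b) \<Rightarrow> bool" where
  "ef K V s A c A' c' 0 = (\<lambda>v v'. ef_atomic K V s A c A' c' v v')"
| "ef K V s A c A' c' (Suc k) = (\<lambda>v v'. ef_atomic K V s A c A' c' v v' \<and> (\<forall>i<V.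
     (\<forall>a\<in>carrier A. \<exists>a'\<in>carrier A'. ef K V s A c A' c' k (v(i := a)) (v'(i := a')))
     \<and> (\<forall>a'\<in>carrier A'. \<exists>a\<in>carrier A. ef K V s A c A' c' k (v(i := a)) (v'(i := a')))))"

lemma ef_imp_atomic: "ef K V s A c A' c' k v v' \<Longrightarrow> ef_atomic K V s A c A' c' v v'"
  by (cases k) auto

primrec form_vars :: "mv_form \<Rightarrow> nat set" where
  "form_vars (FEq s t) = term_vars s \<union> term_vars t"
| "form_vars (FNot \<phi>) = form_vars \<phi>"
| "form_vars (FAnd \<phi> \<psi>) = form_vars \<phi> \<union> form_vars \<psi>"
| "form_vars (FAll x \<phi>) = insert x (form_vars \<phi>)"

primrec form_size :: "mv_form \<Rightarrow> nat" where
  "form_size (FEq s t) = max (term_size s) (term_size t)"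
| "form_size (FNot \<phi>) = form_size \<phi>"
| "form_size (FAnd \<phi> \<psi>) = max (form_size \<phi>) (form_size \<psi>)"
| "form_size (FAll x \<phi>) = form_size \<phi>"

primrec form_rank :: "mv_form \<Rightarrow> nat" where
  "form_rank (FEq s t) = 0"
| "form_rank (FNot \<phi>) = form_rank \<phi>"
| "form_rank (FAnd \<phi> \<psi>) = max (form_rank \<phi>) (form_rank \<psi>)"
| "form_rank (FAll x \<phi>) = Suc (form_rank \<phi>)"

lemma finite_form_vars: "finite (form_vars \<phi>)"
  by (induction \<phi>) (auto simp: finite_term_vars)

theorem ef_sat:
  assumes "ef K V s A c A' c' k v v'" "form_rank \<phi> \<le> k" "form_size \<phi> \<le> s"
    "form_vars \<phi> \<subseteq> {..<V}" "form_consts \<phi> \<subseteq> K"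
  shows "sat A c v \<phi> \<longleftrightarrow> sat A' c' v' \<phi>"
  using assms
proof (induction \<phi> arbitrary: k v v')
  case (FEq s t)
  then show ?case using ef_imp_atomic[OF FEq.prems(1)] by (simp add: ef_atomic_def)
next
  case (FNot \<phi>)
  then show ?case by simp
next
  case (FAnd \<phi> \<psi>)
  have "sat A c v \<phi> \<longleftrightarrow> sat A' c' v' \<phi>" "sat A c v \<psi> \<longleftrightarrow> sat A' c' v' \<psi>"
    by (rule FAnd.IH[OF FAnd.prems(1)]; use FAnd.prems in simp)+
  then show ?case by simp
next
  case (FAll x \<phi>)
  then obtain k' where k: "k = Suc k'" "form_rank \<phi> \<le> k'" by (cases k) auto
  have IH: "sat A c (v(x := a)) \<phi> \<longleftrightarrow> sat A' c' (v'(x := a')) \<phi>"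
    if "ef K V s A c A' c' k' (v(x := a)) (v'(x := a'))" for a a'
    by (rule FAll.IH[OF that k(2)]) (use FAll.prems in auto)
  have "x < V" using FAll.prems by simp
  then have "\<forall>a\<in>carrier A. \<exists>a'\<in>carrier A'. ef K V s A c A' c' k' (v(x := a)) (v'(x := a'))"
    "\<forall>a'\<in>carrier A'. \<exists>a\<in>carrier A. ef K V s A c A' c' k' (v(x := a)) (v'(x := a'))"
    using FAll.prems(1) k by auto
  then show ?case using IH by (metis sat.simps(4))
qed

subsection \<open>Products\<close>

lemma prod_term_val:
  assumes "mv_algebra A" "h \<in> mv_iso A (mv_prod I C)" "i \<in> I"
    "\<And>x. v x \<in> carrier A" "\<And>j. j \<in> term_consts t \<Longrightarrow> c j \<in> carrier A"
  shows "term_val A c v t \<in> carrier A \<and>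
    h (term_val A c v t) i = term_val (C i) (\<lambda>j. h (c j) i) (\<lambda>x. h (v x) i) t"
proof -
  interpret mv_algebra A by fact
  show ?thesis using assms by (induction t) (auto simp: mv_iso_def mv_prod_def closed)
qed

lemma prod_closed: "h \<in> mv_iso A (mv_prod I C) \<Longrightarrow> x \<in> carrier A \<Longrightarrow> i \<in> I \<Longrightarrow> h x i \<in> carrier (C i)"
  using iso_closed[of h A "mv_prod I C" x] by (auto simp: mv_prod_def)

lemma prod_ext:
  assumes "h \<in> mv_iso A (mv_prod I C)" "x \<in> carrier A" "y \<in> carrier A"
  shows "x = y \<longleftrightarrow> (\<forall>i\<in>I. h x i = h y i)"
proof
  assume "\<forall>i\<in>I. h x i = h y i"
  moreover have "h x \<in> (\<Pi>\<^sub>E i\<in>I. carrier (C i))" "h y \<in> (\<Pi>\<^sub>E i\<in>I. carrier (C i))"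
    using iso_closed[OF assms(1)] assms by (auto simp: mv_prod_def)
  ultimately have "h x = h y" by (intro PiE_ext) auto
  then show "x = y" using assms by (auto simp: mv_iso_def bij_betw_def inj_on_def)
qed simp

lemma prod_surj:
  assumes "h \<in> mv_iso A (mv_prod I C)" "\<And>i. i \<in> I \<Longrightarrow> b i \<in> carrier (C i)"
  obtains x where "x \<in> carrier A" "\<And>i. i \<in> I \<Longrightarrow> h x i = b i"
proof -
  have "restrict b I \<in> carrier (mv_prod I C)" using assms by (auto simp: mv_prod_def)
  then have "restrict b I \<in> h ` carrier A" using assms by (auto simp: mv_iso_def bij_betw_def)
  then obtain x where "x \<in> carrier A" "h x = restrict b I" by auto
  then show ?thesis using that by simp
qed

text \<open>Equality in a product is equality in all coordinates, so a player who answers separately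
  in each coordinate wins on the product.\<close>

theorem ef_prod:
  assumes A: "mv_algebra A" "h \<in> mv_iso A (mv_prod I C)"
    and A': "mv_algebra A'" "h' \<in> mv_iso A' (mv_prod I C')"
    and c: "\<And>j. j \<in> K \<Longrightarrow> c j \<in> carrier A" "\<And>j. j \<in> K \<Longrightarrow> c' j \<in> carrier A'"
  shows "(\<And>x. v x \<in> carrier A) \<Longrightarrow> (\<And>x. v' x \<in> carrier A') \<Longrightarrow>
    (\<And>i. i \<in> I \<Longrightarrow> ef K V s (C i) (\<lambda>j. h (c j) i) (C' i) (\<lambda>j. h' (c' j) i) k
      (\<lambda>x. h (v x) i) (\<lambda>x. h' (v' x) i)) \<Longrightarrow>
    ef K V s A c A' c' k v v'"
proof (induction k arbitrary: v v')
  have atomic: "ef_atomic K V s A c A' c' v v'"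
    if vA: "\<And>x. v x \<in> carrier A" and vA': "\<And>x. v' x \<in> carrier A'" and
      e: "\<And>i. i \<in> I \<Longrightarrow> ef_atomic K V s (C i) (\<lambda>j. h (c j) i) (C' i) (\<lambda>j. h' (c' j) i)
        (\<lambda>x. h (v x) i) (\<lambda>x. h' (v' x) i)" for v v'
    unfolding ef_atomic_def
  proof (intro allI impI)
    fix t t' assume t: "term_size t \<le> s" "term_size t' \<le> s" "term_vars t \<union> term_vars t' \<subseteq> {..<V}"
      "term_consts t \<union> term_consts t' \<subseteq> K"
    have tv: "term_val A c v r \<in> carrier A"
      "i \<in> I \<Longrightarrow> h (term_val A c v r) i = term_val (C i) (\<lambda>j. h (c j) i) (\<lambda>x. h (v x) i) r"
      if "r = t \<or> r = t'" for r i
    proof -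
      have cr: "c j \<in> carrier A" if "j \<in> term_consts r" for j
        by (rule c(1)) (use that t \<open>r = t \<or> r = t'\<close> in blast)
      show "term_val A c v r \<in> carrier A"
        using iso_term_val[OF A, of v r c, OF vA cr] by blast
      show "i \<in> I \<Longrightarrow> h (term_val A c v r) i = term_val (C i) (\<lambda>j. h (c j) i) (\<lambda>x. h (v x) i) r"
        using prod_term_val[OF A, of i v r c, OF _ vA cr] by blast
    qed
    have tv': "term_val A' c' v' r \<in> carrier A'"
      "i \<in> I \<Longrightarrow> h' (term_val A' c' v' r) i = term_val (C' i) (\<lambda>j. h' (c' j) i) (\<lambda>x. h' (v' x) i) r"
      if "r = t \<or> r = t'" for r i
    proof -
      have cr: "c' j \<in> carrier A'" if "j \<in> term_consts r" for j
        by (rule c(2)) (use that t \<open>r = t \<or> r = t'\<close> in blast)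
      show "term_val A' c' v' r \<in> carrier A'"
        using iso_term_val[OF A', of v' r c', OF vA' cr] by blast
      show "i \<in> I \<Longrightarrow> h' (term_val A' c' v' r) i = term_val (C' i) (\<lambda>j. h' (c' j) i) (\<lambda>x. h' (v' x) i) r"
        using prod_term_val[OF A', of i v' r c', OF _ vA' cr] by blast
    qed
    have eqi: "term_val (C i) (\<lambda>j. h (c j) i) (\<lambda>x. h (v x) i) t = term_val (C i) (\<lambda>j. h (c j) i) (\<lambda>x. h (v x) i) t'
        \<longleftrightarrow> term_val (C' i) (\<lambda>j. h' (c' j) i) (\<lambda>x. h' (v' x) i) t = term_val (C' i) (\<lambda>j. h' (c' j) i) (\<lambda>x. h' (v' x) i) t'"
      if "i \<in> I" for i
      using e[OF that] t unfolding ef_atomic_def by blast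
    show "term_val A c v t = term_val A c v t' \<longleftrightarrow> term_val A' c' v' t = term_val A' c' v' t'"
      using prod_ext[OF A(2) tv(1) tv(1), of t t'] prod_ext[OF A'(2) tv'(1) tv'(1), of t t']
        eqi by (simp add: tv(2) tv'(2))
  qed
  {
    case 0
    then show ?case using atomic[of v v'] by simp
  next
    case (Suc k)
    have "\<exists>a'\<in>carrier A'. ef K V s A c A' c' k (v(i := a)) (v'(i := a'))"
      if i: "i < V" and a: "a \<in> carrier A" for i a
    proof -
      have "\<forall>j\<in>I. \<exists>b\<in>carrier (C' j). ef K V s (C j) (\<lambda>l. h (c l) j) (C' j) (\<lambda>l. h' (c' l) j) k
          ((\<lambda>x. h (v x) j)(i := h a j)) ((\<lambda>x. h' (v' x) j)(i := b))"
        using Suc.prems(3) i prod_closed[OF A(2) a] by simp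
      then obtain b where b: "\<And>j. j \<in> I \<Longrightarrow> b j \<in> carrier (C' j)"
        "\<And>j. j \<in> I \<Longrightarrow> ef K V s (C j) (\<lambda>l. h (c l) j) (C' j) (\<lambda>l. h' (c' l) j) k
          ((\<lambda>x. h (v x) j)(i := h a j)) ((\<lambda>x. h' (v' x) j)(i := b j))" by metis
      obtain a' where a': "a' \<in> carrier A'" "\<And>j. j \<in> I \<Longrightarrow> h' a' j = b j"
        using prod_surj[OF A'(2) b(1)] by blast
      have upd: "(\<lambda>x. h (v x) j)(i := h a j) = (\<lambda>x. h ((v(i := a)) x) j)"
        "(\<lambda>x. h' (v' x) j)(i := h' a' j) = (\<lambda>x. h' ((v'(i := a')) x) j)" for j by auto
      have "ef K V s A c A' c' k (v(i := a)) (v'(i := a'))"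
      proof (rule Suc.IH)
        fix j assume j: "j \<in> I"
        show "ef K V s (C j) (\<lambda>l. h (c l) j) (C' j) (\<lambda>l. h' (c' l) j) k
            (\<lambda>x. h ((v(i := a)) x) j) (\<lambda>x. h' ((v'(i := a')) x) j)"
          using b(2)[OF j] by (simp only: a'(2)[OF j, symmetric] upd)
      qed (use Suc.prems(1,2) a a' in auto)
      then show ?thesis using a' by blast
    qed
    moreover have "\<exists>a\<in>carrier A. ef K V s A c A' c' k (v(i := a)) (v'(i := a'))"
      if i: "i < V" and a': "a' \<in> carrier A'" for i a'
    proof -
      have "\<forall>j\<in>I. \<exists>b\<in>carrier (C j). ef K V s (C j) (\<lambda>l. h (c l) j) (C' j) (\<lambda>l. h' (c' l) j) k
          ((\<lambda>x. h (v x) j)(i := b)) ((\<lambda>x. h' (v' x) j)(i := h' a' j))"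
        using Suc.prems(3) i prod_closed[OF A'(2) a'] by simp
      then obtain b where b: "\<And>j. j \<in> I \<Longrightarrow> b j \<in> carrier (C j)"
        "\<And>j. j \<in> I \<Longrightarrow> ef K V s (C j) (\<lambda>l. h (c l) j) (C' j) (\<lambda>l. h' (c' l) j) k
          ((\<lambda>x. h (v x) j)(i := b j)) ((\<lambda>x. h' (v' x) j)(i := h' a' j))" by metis
      obtain a where a: "a \<in> carrier A" "\<And>j. j \<in> I \<Longrightarrow> h a j = b j"
        using prod_surj[OF A(2) b(1)] by blast
      have upd: "(\<lambda>x. h (v x) j)(i := h a j) = (\<lambda>x. h ((v(i := a)) x) j)"
        "(\<lambda>x. h' (v' x) j)(i := h' a' j) = (\<lambda>x. h' ((v'(i := a')) x) j)" for j by auto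
      have "ef K V s A c A' c' k (v(i := a)) (v'(i := a'))"
      proof (rule Suc.IH)
        fix j assume j: "j \<in> I"
        show "ef K V s (C j) (\<lambda>l. h (c l) j) (C' j) (\<lambda>l. h' (c' l) j) k
            (\<lambda>x. h ((v(i := a)) x) j) (\<lambda>x. h' ((v'(i := a')) x) j)"
          using b(2)[OF j] by (simp only: a(2)[OF j, symmetric] upd)
      qed (use Suc.prems(1,2) a a' in auto)
      then show ?thesis using a by blast
    qed
    moreover have "ef_atomic K V s A c A' c' v v'"
      using atomic[of v v'] Suc.prems ef_imp_atomic by blast
    ultimately show ?case by simp
  }
qed

section \<open>Ultraproducts\<close>

context
  fixes I :: "'i set" and F :: "'i filter" and B :: "'i \<Rightarrow> 'a mv"
  assumes F: "ultrafilter_on I F" and B: "\<And>i. i \<in> I \<Longrightarrow> mv_algebra (B i)"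
begin

private abbreviation "P \<equiv> mv_prod I B"
private abbreviation "R \<equiv> ultra_rel I F B"
private abbreviation "U \<equiv> mv_ultraproduct I F B"
private abbreviation "cls f \<equiv> R `` {f}"

lemma eventually_index: "eventually (\<lambda>i. i \<in> I) F"
  using F unfolding ultrafilter_on_def by (simp add: le_principal)

lemma eventually_not_ultra: "eventually (\<lambda>i. \<not> p i) F \<longleftrightarrow> \<not> eventually p F"
proof -
  have "\<not> (eventually p F \<and> eventually (\<lambda>i. \<not> p i) F)"
    using F eventually_conj[of p F "\<lambda>i. \<not> p i"] unfolding ultrafilter_on_def
    by (auto simp: eventually_False)
  then show ?thesis using F unfolding ultrafilter_on_def by blast
qed

lemma equiv_ultra: "equiv (carrier P) R"
proof (rule equivI)
  show "refl_on (carrier P) R" by (auto simp: refl_on_def ultra_rel_def)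
  show "sym R" by (auto simp: sym_def ultra_rel_def eq_commute)
  show "trans R"
    by (auto simp: trans_def ultra_rel_def elim: eventually_elim2)
qed (auto simp: ultra_rel_def)

lemma prod_ops_closed:
  "f \<in> carrier P \<Longrightarrow> g \<in> carrier P \<Longrightarrow> mv_plus P f g \<in> carrier P"
  "f \<in> carrier P \<Longrightarrow> mv_neg P f \<in> carrier P" "mv_zero P \<in> carrier P"
  by (auto simp: mv_prod_def dest: PiE_mem
      intro!: mv_algebra.plus_closed[OF B] mv_algebra.neg_closed[OF B] mv_algebra.zero_closed[OF B])

lemma cls_eq: "f \<in> carrier P \<Longrightarrow> g \<in> carrier P \<Longrightarrow> cls f = cls g \<longleftrightarrow> eventually (\<lambda>i. f i = g i) F"
  using eq_equiv_class_iff[OF equiv_ultra] by (auto simp: ultra_rel_def)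

lemma ultra_ops:
  "f \<in> carrier P \<Longrightarrow> g \<in> carrier P \<Longrightarrow> mv_plus U (cls f) (cls g) = cls (mv_plus P f g)"
  "f \<in> carrier P \<Longrightarrow> mv_neg U (cls f) = cls (mv_neg P f)"
  "mv_zero U = cls (mv_zero P)" "carrier U = carrier P // R"
proof -
  have "cls (mv_plus P f g) = cls (mv_plus P f' g')" if "(f, f') \<in> R" "(g, g') \<in> R" for f f' g g'
  proof -
    have "eventually (\<lambda>i. f i = f' i) F" "eventually (\<lambda>i. g i = g' i) F"
      using that by (auto simp: ultra_rel_def)
    then have "eventually (\<lambda>i. mv_plus P f g i = mv_plus P f' g' i) F"
      by eventually_elim (simp add: mv_prod_def)
    then show ?thesis using that cls_eq prod_ops_closed by (auto simp: ultra_rel_def)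
  qed
  then have "congruent2 R R (\<lambda>f g. cls (mv_plus P f g))" by (intro congruent2I') blast
  from UN_equiv_class2[OF equiv_ultra equiv_ultra this]
  show "f \<in> carrier P \<Longrightarrow> g \<in> carrier P \<Longrightarrow> mv_plus U (cls f) (cls g) = cls (mv_plus P f g)"
    by (simp add: mv_ultraproduct_def Let_def)
  have "cls (mv_neg P f) = cls (mv_neg P f')" if "(f, f') \<in> R" for f f'
  proof -
    have "eventually (\<lambda>i. f i = f' i) F" using that by (auto simp: ultra_rel_def)
    then have "eventually (\<lambda>i. mv_neg P f i = mv_neg P f' i) F"
      by eventually_elim (simp add: mv_prod_def)
    then show ?thesis using that cls_eq prod_ops_closed by (auto simp: ultra_rel_def)
  qed
  then have "congruent R (\<lambda>f. cls (mv_neg P f))" by (intro congruentI) blast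
  from UN_equiv_class[OF equiv_ultra this]
  show "f \<in> carrier P \<Longrightarrow> mv_neg U (cls f) = cls (mv_neg P f)"
    by (simp add: mv_ultraproduct_def Let_def)
qed (simp_all add: mv_ultraproduct_def Let_def)

lemma ultra_term_val:
  assumes "\<And>x. w x \<in> carrier P" "term_consts t = {}"
  shows "(\<lambda>i\<in>I. term_val (B i) (d i) (\<lambda>x. w x i) t) \<in> carrier P
    \<and> term_val U c (\<lambda>x. cls (w x)) t = cls (\<lambda>i\<in>I. term_val (B i) (d i) (\<lambda>x. w x i) t)"
  using assms(2)
proof (induction t)
  case (Var x)
  have "(\<lambda>i\<in>I. w x i) = w x" using assms(1)[of x] by (auto simp: mv_prod_def PiE_def extensional_restrict)
  then show ?case using assms(1)[of x] by simp
next
  case Zero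
  have "(\<lambda>i\<in>I. term_val (B i) (d i) (\<lambda>x. w x i) Zero) = mv_zero P" by (simp add: mv_prod_def)
  then show ?case using ultra_ops(3) prod_ops_closed(3) by (simp del: restrict_apply)
next
  case (Plus s t)
  let ?f = "\<lambda>t. \<lambda>i\<in>I. term_val (B i) (d i) (\<lambda>x. w x i) t"
  have "mv_plus P (?f s) (?f t) = ?f (Plus s t)" by (auto simp: mv_prod_def)
  then show ?case using Plus ultra_ops(1)[of "?f s" "?f t"] prod_ops_closed(1)[of "?f s" "?f t"]
    by (simp del: restrict_apply)
next
  case (Neg t)
  let ?f = "\<lambda>t. \<lambda>i\<in>I. term_val (B i) (d i) (\<lambda>x. w x i) t"
  have "mv_neg P (?f t) = ?f (Neg t)" by (auto simp: mv_prod_def)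
  then show ?case using Neg ultra_ops(2)[of "?f t"] prod_ops_closed(2)[of "?f t"]
    by (simp del: restrict_apply)
qed simp

theorem Los:
  assumes "\<And>x. w x \<in> carrier P" "form_consts \<phi> = {}"
  shows "sat U c (\<lambda>x. cls (w x)) \<phi> \<longleftrightarrow> eventually (\<lambda>i. sat (B i) (d i) (\<lambda>x. w x i) \<phi>) F"
  using assms
proof (induction \<phi> arbitrary: w)
  case (FEq s t)
  let ?f = "\<lambda>t. \<lambda>i\<in>I. term_val (B i) (d i) (\<lambda>x. w x i) t"
  have "?f s \<in> carrier P" "?f t \<in> carrier P" "term_val U c (\<lambda>x. cls (w x)) s = cls (?f s)"
    "term_val U c (\<lambda>x. cls (w x)) t = cls (?f t)"
    using ultra_term_val[of w s d c] ultra_term_val[of w t d c] FEq by auto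
  then have "sat U c (\<lambda>x. cls (w x)) (FEq s t) \<longleftrightarrow> eventually (\<lambda>i. ?f s i = ?f t i) F"
    using cls_eq by simp
  also have "\<dots> \<longleftrightarrow> eventually (\<lambda>i. sat (B i) (d i) (\<lambda>x. w x i) (FEq s t)) F"
    by (rule eventually_cong[OF eventually_index]) simp
  finally show ?case .
next
  case (FNot \<phi>)
  then show ?case by (simp add: eventually_not_ultra)
next
  case (FAnd \<phi> \<psi>)
  then show ?case by (simp add: eventually_conj_iff)
next
  case (FAll x \<phi>)
  have "sat U c (\<lambda>x. cls (w x)) (FAll x \<phi>) \<longleftrightarrow> (\<forall>f\<in>carrier P. sat U c (\<lambda>y. cls ((w(x := f)) y)) \<phi>)"
  proof -
    have "(\<lambda>x. cls (w x))(x := cls f) = (\<lambda>y. cls ((w(x := f)) y))" for f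
      by (rule ext) simp
    moreover have "carrier U = cls ` carrier P" by (auto simp: ultra_ops(4) quotient_def)
    ultimately show ?thesis by simp
  qed
  also have "\<dots> \<longleftrightarrow> (\<forall>f\<in>carrier P. eventually (\<lambda>i. sat (B i) (d i) (\<lambda>y. (w(x := f)) y i) \<phi>) F)"
    using FAll.IH[of "w(x := _)"] FAll.prems by simp
  also have "\<dots> \<longleftrightarrow> eventually (\<lambda>i. \<forall>a\<in>carrier (B i). sat (B i) (d i) ((\<lambda>y. w y i)(x := a)) \<phi>) F"
    (is "?L \<longleftrightarrow> eventually ?r F")
  proof
    have upd: "(\<lambda>y. (w(x := f)) y i) = (\<lambda>y. w y i)(x := f i)" for f i by auto
    {
      assume L: ?L
      \<comment> \<open>In each factor a counterexample to \<phi> is chosen if there is one. If the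
        class of this family satisfies \<phi>, then almost no factor has a counterexample.\<close>
      define a where "a = (\<lambda>i. SOME a. a \<in> carrier (B i) \<and> (?r i \<or> \<not> sat (B i) (d i) ((\<lambda>y. w y i)(x := a)) \<phi>))"
      have a: "a i \<in> carrier (B i) \<and> (?r i \<or> \<not> sat (B i) (d i) ((\<lambda>y. w y i)(x := a i)) \<phi>)" if "i \<in> I" for i
      proof -
        have "\<exists>a. a \<in> carrier (B i) \<and> (?r i \<or> \<not> sat (B i) (d i) ((\<lambda>y. w y i)(x := a)) \<phi>)"
          using mv_algebra.zero_closed[OF B[OF that]] by blast
        then show ?thesis unfolding a_def by (rule someI_ex)
      qed
      have "restrict a I \<in> carrier P" using a by (auto simp: mv_prod_def)
      then have "eventually (\<lambda>i. sat (B i) (d i) (\<lambda>y. (w(x := restrict a I)) y i) \<phi>) F"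
        using L by blast
      then have "eventually (\<lambda>i. sat (B i) (d i) ((\<lambda>y. w y i)(x := restrict a I i)) \<phi>) F"
        by (simp only: upd)
      then show "eventually ?r F" using eventually_index
        by eventually_elim (use a in auto)
    next
      assume ev: "eventually ?r F"
      show ?L
      proof
        fix f assume "f \<in> carrier P"
        then have f: "f i \<in> carrier (B i)" if "i \<in> I" for i using that by (auto simp: mv_prod_def)
        show "eventually (\<lambda>i. sat (B i) (d i) (\<lambda>y. (w(x := f)) y i) \<phi>) F"
          unfolding upd using ev eventually_index by eventually_elim (use f in auto)
      qed
    }
  qed
  finally show ?case by simp
qed

corollary Los_sentence:
  assumes "\<phi> \<in> mv_sentences 0"
  shows "sat U c (\<lambda>_. mv_zero U) \<phi> \<longleftrightarrow> eventually (\<lambda>i. sat (B i) (d i) (\<lambda>_. mv_zero (B i)) \<phi>) F"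
proof -
  have "form_consts \<phi> = {}" using assms by (simp add: mv_sentences_def)
  from Los[of "\<lambda>_. mv_zero P", OF _ this, of c d]
  have "sat U c (\<lambda>_. mv_zero U) \<phi> \<longleftrightarrow> eventually (\<lambda>i. sat (B i) (d i) (\<lambda>_. mv_zero P i) \<phi>) F"
    using prod_ops_closed(3) by (simp add: ultra_ops)
  also have "\<dots> \<longleftrightarrow> eventually (\<lambda>i. sat (B i) (d i) (\<lambda>_. mv_zero (B i)) \<phi>) F"
    by (rule eventually_cong[OF eventually_index]) (simp add: mv_prod_def)
  finally show ?thesis .
qed

end

section \<open>Chains as intervals of discrete groups\<close>

text \<open>The chain is the interval [0, u] up to null elements. The truncated sum is described by
  two overlapping cases instead of a minimum, which a preordered group does not determine uniquely.
  The unit u may be null, so the one-element algebra is included.\<close>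

locale chain_rep = discrete_group Pos eps + mv_algebra A
  for Pos :: "'g::comm_ring_1 \<Rightarrow> bool" and eps and A :: "'a mv" +
  fixes u :: 'g and emb :: "'a \<Rightarrow> 'g"
  assumes emb_nonneg: "x \<in> carrier A \<Longrightarrow> Pos (emb x)"
    and emb_le_unit: "x \<in> carrier A \<Longrightarrow> Pos (u - emb x)"
    and emb_surj: "Pos g \<Longrightarrow> Pos (u - g) \<Longrightarrow> \<exists>x\<in>carrier A. null Pos (emb x - g)"
    and emb_inj: "x \<in> carrier A \<Longrightarrow> y \<in> carrier A \<Longrightarrow> null Pos (emb x - emb y) \<Longrightarrow> x = y"
    and emb_zero: "null Pos (emb (mv_zero A))"
    and emb_neg: "x \<in> carrier A \<Longrightarrow> null Pos (emb (mv_neg A x) - (u - emb x))"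
    and emb_plus: "x \<in> carrier A \<Longrightarrow> y \<in> carrier A \<Longrightarrow> Pos (u - (emb x + emb y)) \<Longrightarrow>
      null Pos (emb (mv_plus A x y) - (emb x + emb y))"
    and emb_plus_top: "x \<in> carrier A \<Longrightarrow> y \<in> carrier A \<Longrightarrow> Pos (emb x + emb y - u) \<Longrightarrow>
      null Pos (emb (mv_plus A x y) - u)"
begin

lemma Pos_u: "Pos u"
  using Pos_add[OF emb_nonneg emb_le_unit, of "mv_zero A" "mv_zero A"] zero_closed by simp

lemma emb_one: "null Pos (emb unity - u)"
  using null_diff[OF emb_neg[OF zero_closed] emb_zero] by (simp add: mv_one_def)

lemma emb_eq_iff: "x \<in> K \<Longrightarrow> y \<in> K \<Longrightarrow> null Pos (emb x - emb y) \<longleftrightarrow> x = y"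
  using emb_inj null_0 by auto

lemma le_emb: "x \<in> K \<Longrightarrow> y \<in> K \<Longrightarrow> x \<preceq> y \<longleftrightarrow> Pos (emb y - emb x)"
proof
  assume xy: "x \<in> K" "y \<in> K" and "x \<preceq> y"
  then obtain z where z: "z \<in> K" "y = x \<boxplus> z" unfolding mv_le_def by blast
  show "Pos (emb y - emb x)"
  proof (cases "Pos (u - (emb x + emb z))")
    case True
    then have "null Pos (emb y - (emb x + emb z))" using emb_plus z xy by simp
    then have "Pos (emb y - emb x) \<longleftrightarrow> Pos (emb z)" by (intro Pos_null) (simp add: algebra_simps)
    then show ?thesis using emb_nonneg z by simp
  next
    case False
    then have "Pos (emb x + emb z - u)" using Pos_total[of "u - (emb x + emb z)"] by simp
    then have "null Pos (emb y - u)" using emb_plus_top z xy by simp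
    then have "Pos (emb y - emb x) \<longleftrightarrow> Pos (u - emb x)" by (intro Pos_null) simp
    then show ?thesis using emb_le_unit xy by simp
  qed
next
  assume xy: "x \<in> K" "y \<in> K" and P: "Pos (emb y - emb x)"
  have "Pos (u - (emb y - emb x))"
    using Pos_add[OF emb_le_unit[OF xy(2)] emb_nonneg[OF xy(1)]] by (simp add: algebra_simps)
  then obtain z where z: "z \<in> K" "null Pos (emb z - (emb y - emb x))" using emb_surj P by blast
  have "Pos (u - (emb x + emb z)) \<longleftrightarrow> Pos (u - emb y)"
    by (rule Pos_null) (use null_minus[OF z(2)] in \<open>simp add: algebra_simps\<close>)
  then have "null Pos (emb (x \<boxplus> z) - (emb x + emb z))" using emb_plus emb_le_unit z xy by simp
  from null_add[OF this z(2)] have "null Pos (emb (x \<boxplus> z) - emb y)" by (simp add: algebra_simps)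
  then show "x \<preceq> y" using emb_inj xy z plus_closed unfolding mv_le_def by blast
qed

lemma less_emb: "x \<in> K \<Longrightarrow> y \<in> K \<Longrightarrow> mv_less A x y \<longleftrightarrow> \<not> Pos (emb x - emb y)"
  using le_emb[of x y] emb_eq_iff[of y x] null_def[of Pos "emb y - emb x"] Pos_total[of "emb x - emb y"]
  unfolding mv_less_def by auto

lemma chain: "mv_chain A"
  unfolding mv_chain_def
  using le_emb mv_algebra_axioms Pos_total[of "emb _ - emb _"] by (metis minus_diff_eq)

lemma emb_mult:
  assumes "x \<in> K"
  shows "(Pos (u - of_int (int k) * emb x) \<longrightarrow> null Pos (emb (mv_mult A k x) - of_int (int k) * emb x))
    \<and> (Pos (of_int (int k) * emb x - u) \<longrightarrow> null Pos (emb (mv_mult A k x) - u))"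
proof (induction k)
  case 0
  have "null Pos (emb nought - u)" if "Pos (- u)"
    using that Pos_u emb_zero null_diff[of "emb nought" u] by (simp add: null_def)
  then show ?case using emb_zero by simp
next
  case (Suc k)
  let ?k = "of_int (int k) * emb x" and ?m = "mv_mult A k x"
  have m: "?m \<in> K" using mult_closed assms by simp
  have Sk: "of_int (int (Suc k)) * emb x = ?k + emb x" by (simp add: algebra_simps)
  show ?case
  proof (cases "Pos (u - ?k)")
    case True
    then have n: "null Pos (emb ?m - ?k)" using Suc by blast
    have 1: "null Pos (emb (?m \<boxplus> x) - (?k + emb x))" if "Pos (u - (?k + emb x))"
    proof -
      have "Pos (u - (emb ?m + emb x)) \<longleftrightarrow> Pos (u - (?k + emb x))"
        by (rule Pos_null) (use null_minus[OF n] in \<open>simp add: algebra_simps\<close>)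
      then have "null Pos (emb (?m \<boxplus> x) - (emb ?m + emb x))" using emb_plus[OF m assms] that by blast
      from null_add[OF this n] show ?thesis by (simp add: algebra_simps)
    qed
    have 2: "null Pos (emb (?m \<boxplus> x) - u)" if "Pos (?k + emb x - u)"
    proof -
      have "Pos (emb ?m + emb x - u) \<longleftrightarrow> Pos (?k + emb x - u)"
        by (rule Pos_null) (use n in \<open>simp add: algebra_simps\<close>)
      then show ?thesis using emb_plus_top[OF m assms] that by blast
    qed
    show ?thesis unfolding Sk using 1 2 by simp
  next
    case False
    then have k: "Pos (?k - u)" using Pos_total[of "u - ?k"] by simp
    then have n: "null Pos (emb ?m - u)" using Suc by blast
    have "Pos (emb ?m + emb x - u) \<longleftrightarrow> Pos (emb x)"
      by (rule Pos_null) (use n in \<open>simp add: algebra_simps\<close>)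
    then have 1: "null Pos (emb (?m \<boxplus> x) - u)" using emb_plus_top[OF m assms] emb_nonneg assms by blast
    have "\<not> Pos (u - (?k + emb x))"
    proof
      assume "Pos (u - (?k + emb x))"
      from Pos_add[OF this emb_nonneg[OF assms]] show False using False by simp
    qed
    then show ?thesis unfolding Sk using 1 by simp
  qed
qed

text \<open>Truncated multiples of a positive x grow strictly exactly as long as the previous one is
  below u, so only the last comparison, (k - 1) x < u, matters.\<close>

lemma increasing_multiples_emb:
  assumes x: "x \<in> K" and k: "k \<ge> 1"
  shows "mv_increasing_multiples A k x \<longleftrightarrow> \<not> Pos (- emb x) \<and> \<not> Pos (of_int (int k - 1) * emb x - u)"
proof -
  have pos: "mv_less A nought x \<longleftrightarrow> \<not> Pos (- emb x)"
  proof -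
    have "Pos (emb nought - emb x) \<longleftrightarrow> Pos (- emb x)" by (rule Pos_null) (use emb_zero in simp)
    then show ?thesis using less_emb[OF zero_closed x] by simp
  qed
  have step: "mv_less A (mv_mult A j x) (mv_mult A (j + 1) x) \<longleftrightarrow> \<not> Pos (of_int (int j) * emb x - u)"
    if x0: "\<not> Pos (- emb x)" for j
  proof (cases "Pos (of_int (int j) * emb x - u)")
    case True
    have "Pos (of_int (int (j + 1)) * emb x - u)"
      using Pos_add[OF True emb_nonneg[OF x]] by (simp add: algebra_simps)
    then have "null Pos (emb (mv_mult A j x) - u)" "null Pos (emb (mv_mult A (j + 1) x) - u)"
      using True emb_mult[OF x] by blast+
    then have "null Pos (emb (mv_mult A j x) - emb (mv_mult A (j + 1) x))"
      using null_diff by fastforce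
    then show ?thesis using True less_emb mult_closed x unfolding null_def by blast
  next
    case False
    then have "Pos (u - of_int (int j) * emb x)" using Pos_total[of "of_int (int j) * emb x - u"] by simp
    then have n: "null Pos (emb (mv_mult A j x) - of_int (int j) * emb x)" using emb_mult[OF x] by blast
    have "\<not> Pos (emb (mv_mult A j x) - emb (mv_mult A (j + 1) x))"
    proof (cases "Pos (u - of_int (int (j + 1)) * emb x)")
      case True
      then have "null Pos (emb (mv_mult A (j + 1) x) - of_int (int (j + 1)) * emb x)"
        using emb_mult[OF x] by blast
      from null_diff[OF n this] have
        "Pos (emb (mv_mult A j x) - emb (mv_mult A (j + 1) x)) \<longleftrightarrow> Pos (- emb x)"
        by (intro Pos_null) (simp add: algebra_simps)
      then show ?thesis using x0 by simp
    next
      case F: False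
      then have "Pos (of_int (int (j + 1)) * emb x - u)"
        using Pos_total[of "u - of_int (int (j + 1)) * emb x"] by simp
      then have "null Pos (emb (mv_mult A (j + 1) x) - u)" using emb_mult[OF x] by blast
      from null_diff[OF n this] have
        "Pos (emb (mv_mult A j x) - emb (mv_mult A (j + 1) x)) \<longleftrightarrow> Pos (of_int (int j) * emb x - u)"
        by (intro Pos_null) (simp add: algebra_simps)
      then show ?thesis using False by simp
    qed
    then show ?thesis using False less_emb mult_closed x by blast
  qed
  have mono: "\<not> Pos (of_int (int j) * emb x - u)" if "\<not> Pos (of_int (int k - 1) * emb x - u)" "j < k" for j
  proof
    assume P: "Pos (of_int (int j) * emb x - u)"
    have "Pos (of_int (int k - 1 - int j) * emb x)" by (rule Pos_mult) (use that emb_nonneg[OF x] in auto)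
    from Pos_add[OF this P] show False using that by (simp add: algebra_simps)
  qed
  show ?thesis
  proof (cases "\<not> Pos (- emb x)")
    case True
    have "(\<forall>j\<in>{1..<k}. \<not> Pos (of_int (int j) * emb x - u)) \<longleftrightarrow> \<not> Pos (of_int (int k - 1) * emb x - u)"
    proof
      assume *: "\<forall>j\<in>{1..<k}. \<not> Pos (of_int (int j) * emb x - u)"
      show "\<not> Pos (of_int (int k - 1) * emb x - u)"
      proof (cases "k = 1")
        case True
        \<comment> \<open>For k = 1 the claim is u > 0, which follows from 0 < x \<le> u.\<close>
        have "\<not> Pos (- u)"
        proof
          assume "Pos (- u)"
          from Pos_add[OF this emb_le_unit[OF x]] show False using \<open>\<not> Pos (- emb x)\<close> by simp
        qed
        then show ?thesis using True by simp
      next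
        case False
        then have "k - 1 \<in> {1..<k}" using k by auto
        then have "\<not> Pos (of_int (int (k - 1)) * emb x - u)" using * by blast
        then show ?thesis using k by (simp add: of_nat_diff)
      qed
    qed (use mono in auto)
    then show ?thesis unfolding mv_increasing_multiples_def pos using step True by blast
  qed (simp add: mv_increasing_multiples_def pos)
qed

end

lemma chain_rep_iso:
  assumes "chain_rep Pos eps B u emb" "mv_algebra A" "h \<in> mv_iso A B"
  shows "chain_rep Pos eps A u (\<lambda>x. emb (h x))"
proof -
  interpret B: chain_rep Pos eps B u emb by fact
  interpret A: mv_algebra A by fact
  have bij: "bij_betw h (carrier A) (carrier B)" using assms by (simp add: mv_iso_def)
  have h: "h (mv_zero A) = mv_zero B" "x \<in> carrier A \<Longrightarrow> h (mv_neg A x) = mv_neg B (h x)"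
    "x \<in> carrier A \<Longrightarrow> y \<in> carrier A \<Longrightarrow> h (mv_plus A x y) = mv_plus B (h x) (h y)"
    "x \<in> carrier A \<Longrightarrow> h x \<in> carrier B" for x y
    using assms iso_closed[OF assms(3)] by (auto simp: mv_iso_def)
  show ?thesis
  proof
    fix g assume "Pos g" "Pos (u - g)"
    then obtain y where "y \<in> carrier B" "null Pos (emb y - g)" using B.emb_surj by blast
    moreover have "carrier B = h ` carrier A" using bij by (simp add: bij_betw_def)
    ultimately show "\<exists>x\<in>carrier A. null Pos (emb (h x) - g)" by auto
  next
    fix x y assume "x \<in> carrier A" "y \<in> carrier A" "null Pos (emb (h x) - emb (h y))"
    then show "x = y" using B.emb_inj h bij by (metis bij_betw_inv_into_left)
  qed (simp_all add: h B.emb_nonneg B.emb_le_unit B.emb_zero B.emb_neg B.emb_plus B.emb_plus_top)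
qed

section \<open>Games on chains\<close>

text \<open>The unit and the atom occupy the indices 0 and 1, where \<open>lin_eq_step\<close>
  expects the atom; the variables follow from 2 on.\<close>

definition env :: "'g::comm_ring_1 \<Rightarrow> 'g \<Rightarrow> ('a \<Rightarrow> 'g) \<Rightarrow> (nat \<Rightarrow> 'a) \<Rightarrow> nat \<Rightarrow> 'g" where
  "env u eps emb v i = (if i = 0 then u else if i = 1 then eps else emb (v (i - 2)))"

lemma env_simps [simp]: "env u eps emb v 0 = u" "env u eps emb v (Suc 0) = eps"
    "env u eps emb v (Suc (Suc i)) = emb (v i)"
  by (simp_all add: env_def)

lemma env_upd: "env u eps emb (v(i := a)) = (env u eps emb v)(i + 2 := emb a)"
  by (rule ext) (auto simp: env_def)

text \<open>In a component the constant for 1_k is either the bottom or the top, so no other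
  interpretations of constants occur in games on chains.\<close>

definition const_agree :: "nat set \<Rightarrow> 'a mv \<Rightarrow> (nat \<Rightarrow> 'a) \<Rightarrow> 'b mv \<Rightarrow> (nat \<Rightarrow> 'b) \<Rightarrow> bool" where
  "const_agree K A c B d \<longleftrightarrow> (\<forall>k\<in>K. (c k = mv_zero A \<and> d k = mv_zero B) \<or> (c k = mv_one A \<and> d k = mv_one B))"

lemma (in discrete_group) null_cong: "null Pos (x - y) \<Longrightarrow> null Pos x \<longleftrightarrow> null Pos y"
  using null_add[of "x - y" y] null_diff[of x "x - y"] by auto

lemma lin_plus: "lin N e c + lin N e d = lin N e (\<lambda>i. c i + d i)"
  by (simp add: lin_def sum.distrib algebra_simps)

lemma lin_zero: "lin N e (\<lambda>_. 0) = 0"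
  by (simp add: lin_def)

lemma (in discrete_group) lin_null:
  assumes "\<And>i. i < N \<Longrightarrow> null Pos (e i - d i)" shows "null Pos (lin N e c - lin N d c)"
  using assms
proof (induction N)
  case 0
  then show ?case by (simp add: lin_def null_0)
next
  case (Suc N)
  then have "null Pos (lin N e c - lin N d c)" "null Pos (of_int (c N) * (e N - d N))"
    using null_mult by auto
  from null_add[OF this] show ?case by (simp add: lin_def algebra_simps)
qed

lemma lin_eq_null:
  assumes "discrete_group Pos' eps'" "lin_eq Pos Pos' N M e e'" "\<And>i. i < N \<Longrightarrow> null Pos' (e' i - d' i)"
  shows "lin_eq Pos Pos' N M e d'"
proof -
  interpret discrete_group Pos' eps' by fact
  have "null Pos' (lin N e' c - lin N d' c)" for c using lin_null assms(3) by blast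
  then have "Pos' (lin N e' c) \<longleftrightarrow> Pos' (lin N d' c)" "Div Pos' m (lin N e' c) \<longleftrightarrow> Div Pos' m (lin N d' c)" for c m
    using Pos_null Div_null by blast+
  then show ?thesis using assms(2) unfolding lin_eq_def by simp
qed

text \<open>By induction on terms the same linear form describes a term in both chains. At a sum the
  invariant makes both chains decide alike whether to truncate, and the term size bounds the
  coefficients.\<close>

lemma term_lin:
  assumes A: "chain_rep Pos eps A u emb" and B: "chain_rep Pos' eps' B u' emb'"
    and eq: "lin_eq Pos Pos' (V + 2) M (env u eps emb v) (env u' eps' emb' w)"
    and v: "\<And>x. v x \<in> carrier A" and w: "\<And>x. w x \<in> carrier B"
    and c: "const_agree K A c B d"
  shows "term_vars t \<subseteq> {..<V} \<Longrightarrow> term_consts t \<subseteq> K \<Longrightarrow> int (term_size t) \<le> M \<Longrightarrow>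
    \<exists>f. (\<forall>i<V + 2. \<bar>f i\<bar> \<le> int (term_size t)) \<and>
      term_val A c v t \<in> carrier A \<and> term_val B d w t \<in> carrier B \<and>
      null Pos (emb (term_val A c v t) - lin (V + 2) (env u eps emb v) f) \<and>
      null Pos' (emb' (term_val B d w t) - lin (V + 2) (env u' eps' emb' w) f)"
proof -
  interpret A: chain_rep Pos eps A u emb by fact
  interpret B: chain_rep Pos' eps' B u' emb' by fact
  let ?e = "lin (V + 2) (env u eps emb v)" and ?e' = "lin (V + 2) (env u' eps' emb' w)"
  define f0 :: "nat \<Rightarrow> int" where "f0 = (\<lambda>j. if j = 0 then 1 else 0)"
  have f0: "?e f0 = u" "?e' f0 = u'" unfolding f0_def by (subst lin_single; simp)+
  show "term_vars t \<subseteq> {..<V} \<Longrightarrow> term_consts t \<subseteq> K \<Longrightarrow> int (term_size t) \<le> M \<Longrightarrow> ?thesis"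
  proof (induction t)
    case (Var x)
    then have x: "x + 2 < V + 2" by simp
    show ?case using lin_single[OF x, of "env u eps emb v" 1] lin_single[OF x, of "env u' eps' emb' w" 1] v w A.null_0 B.null_0
      by (intro exI[of _ "\<lambda>j. if j = x + 2 then 1 else 0"]) simp
  next
    case (Const k)
    then consider "c k = mv_zero A" "d k = mv_zero B" | "c k = mv_one A" "d k = mv_one B"
      using c unfolding const_agree_def by auto
    then show ?case
    proof cases
      case 1
      then show ?thesis using A.closed B.closed A.emb_zero B.emb_zero
        by (intro exI[of _ "\<lambda>_. 0"]) (simp add: lin_zero)
    next
      case 2
      moreover have "\<forall>i<V + 2. \<bar>f0 i\<bar> \<le> 1" by (simp add: f0_def)
      ultimately show ?thesis using A.closed B.closed A.emb_one B.emb_one f0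
        by (intro exI[of _ f0]) simp
    qed
  next
    case Zero
    then show ?case using A.closed B.closed A.emb_zero B.emb_zero
      by (intro exI[of _ "\<lambda>_. 0"]) (simp add: lin_zero)
  next
    case (Neg t)
    then obtain f where f: "\<forall>i<V + 2. \<bar>f i\<bar> \<le> int (term_size t)"
      and cl: "term_val A c v t \<in> carrier A" "term_val B d w t \<in> carrier B"
      and n: "null Pos (emb (term_val A c v t) - ?e f)" "null Pos' (emb' (term_val B d w t) - ?e' f)"
      by auto
    have "null Pos (emb (mv_neg A (term_val A c v t)) - ?e (\<lambda>i. f0 i - f i))"
      using A.null_diff[OF A.emb_neg[OF cl(1)] n(1)] unfolding lin_diff[symmetric] f0
      by (simp add: algebra_simps)
    moreover have "null Pos' (emb' (mv_neg B (term_val B d w t)) - ?e' (\<lambda>i. f0 i - f i))"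
      using B.null_diff[OF B.emb_neg[OF cl(2)] n(2)] unfolding lin_diff[symmetric] f0
      by (simp add: algebra_simps)
    moreover have "\<bar>f0 i - f i\<bar> \<le> int (term_size (Neg t))" if "i < V + 2" for i
      using f[rule_format, OF that] by (auto simp: f0_def)
    ultimately show ?case using A.closed(4)[OF cl(1)] B.closed(4)[OF cl(2)]
      by (intro exI[of _ "\<lambda>i. f0 i - f i"]) simp
  next
    case (Plus s t)
    then obtain f where f: "\<forall>i<V + 2. \<bar>f i\<bar> \<le> int (term_size s)"
      and cl: "term_val A c v s \<in> carrier A" "term_val B d w s \<in> carrier B"
      and n: "null Pos (emb (term_val A c v s) - ?e f)" "null Pos' (emb' (term_val B d w s) - ?e' f)"
      by auto
    from Plus obtain g where g: "\<forall>i<V + 2. \<bar>g i\<bar> \<le> int (term_size t)"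
      and cl': "term_val A c v t \<in> carrier A" "term_val B d w t \<in> carrier B"
      and n': "null Pos (emb (term_val A c v t) - ?e g)" "null Pos' (emb' (term_val B d w t) - ?e' g)"
      by auto
    let ?x = "term_val A c v s" and ?y = "term_val A c v t" and ?x' = "term_val B d w s" and ?y' = "term_val B d w t"
    \<comment> \<open>The sign of this form decides the truncation. Its coefficients are at most 1
      plus the two term sizes, which is the size of the sum term.\<close>
    define b where "b = (\<lambda>i. f0 i - (f i + g i))"
    have b: "?e b = u - (?e f + ?e g)" "?e' b = u' - (?e' f + ?e' g)"
      unfolding b_def lin_diff[symmetric] lin_plus[symmetric] f0 by simp_all
    have "\<bar>b i\<bar> \<le> M" if "i < V + 2" for i
      using f[rule_format, OF that] g[rule_format, OF that] Plus.prems(3) by (auto simp: b_def f0_def)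
    then have iff: "Pos (u - (?e f + ?e g)) \<longleftrightarrow> Pos' (u' - (?e' f + ?e' g))"
      using eq unfolding lin_eq_def b[symmetric] by blast
    have P: "Pos (u - (emb ?x + emb ?y)) \<longleftrightarrow> Pos (u - (?e f + ?e g))"
      by (rule A.Pos_null) (use A.null_minus[OF A.null_add[OF n(1) n'(1)]] in \<open>simp add: algebra_simps\<close>)
    have P': "Pos' (u' - (emb' ?x' + emb' ?y')) \<longleftrightarrow> Pos' (u' - (?e' f + ?e' g))"
      by (rule B.Pos_null) (use B.null_minus[OF B.null_add[OF n(2) n'(2)]] in \<open>simp add: algebra_simps\<close>)
    show ?case
    proof (cases "Pos (u - (?e f + ?e g))")
      case True
      have "null Pos (emb (mv_plus A ?x ?y) - ?e (\<lambda>i. f i + g i))"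
        using A.null_add[OF A.emb_plus[OF cl(1) cl'(1)] A.null_add[OF n(1) n'(1)]] P True
        unfolding lin_plus[symmetric] by (simp add: algebra_simps)
      moreover have "null Pos' (emb' (mv_plus B ?x' ?y') - ?e' (\<lambda>i. f i + g i))"
        using B.null_add[OF B.emb_plus[OF cl(2) cl'(2)] B.null_add[OF n(2) n'(2)]] P' iff True
        unfolding lin_plus[symmetric] by (simp add: algebra_simps)
      moreover have "\<bar>f i + g i\<bar> \<le> int (term_size (Plus s t))" if "i < V + 2" for i
        using f[rule_format, OF that] g[rule_format, OF that] by auto
      ultimately show ?thesis using A.closed(3)[OF cl(1) cl'(1)] B.closed(3)[OF cl(2) cl'(2)]
        by (intro exI[of _ "\<lambda>i. f i + g i"]) simp
    next
      case False
      then have "Pos (emb ?x + emb ?y - u)" "Pos' (emb' ?x' + emb' ?y' - u')"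
        using P P' iff A.Pos_total[of "u - (emb ?x + emb ?y)"] B.Pos_total[of "u' - (emb' ?x' + emb' ?y')"]
        by simp_all
      then have "null Pos (emb (mv_plus A ?x ?y) - ?e f0)" "null Pos' (emb' (mv_plus B ?x' ?y') - ?e' f0)"
        unfolding f0 using A.emb_plus_top[OF cl(1) cl'(1)] B.emb_plus_top[OF cl(2) cl'(2)] by blast+
      moreover have "\<bar>f0 i\<bar> \<le> int (term_size (Plus s t))" for i by (simp add: f0_def)
      ultimately show ?thesis using A.closed(3)[OF cl(1) cl'(1)] B.closed(3)[OF cl(2) cl'(2)]
        by (intro exI[of _ f0]) simp
    qed
  qed
qed

text \<open>At the end of the game two terms of size at most s are compared, so differences of forms
  have coefficients up to 2 s; the added 1 ensures a bound of at least 1 also for s = 0. The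
  recursion uses the bound required by \<open>lin_eq_step\<close>.\<close>

primrec ef_bound :: "nat \<Rightarrow> nat \<Rightarrow> int" where
  "ef_bound s 0 = 2 * int s + 1"
| "ef_bound s (Suc k) = 4 * (fact (nat (ef_bound s k)) * fact (nat (ef_bound s k)) * (ef_bound s k + 1))"

lemma ef_bound_ge: "ef_bound s k \<ge> 2 * int s + 1" "ef_bound s (Suc k) \<ge> ef_bound s k"
proof -
  have step: "4 * (fact (nat m) * fact (nat m) * (m + 1)) \<ge> m" if "m \<ge> 0" for m :: int
  proof -
    have "fact (nat m) * fact (nat m) \<ge> (1::int) * 1" by (intro mult_mono fact_ge_1) auto
    then have "fact (nat m) * fact (nat m) * (m + 1) \<ge> 1 * (m + 1)" by (intro mult_right_mono) (use that in auto)
    moreover have "4 * x \<ge> m" if "x \<ge> 1 * (m + 1)" for x using that \<open>m \<ge> 0\<close> by simp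
    ultimately show ?thesis by blast
  qed
  show "ef_bound s k \<ge> 2 * int s + 1"
  proof (induction k)
    case (Suc k)
    then show ?case using step[of "ef_bound s k"] by simp
  qed simp
  then show "ef_bound s (Suc k) \<ge> ef_bound s k" using step[of "ef_bound s k"] by simp
qed

text \<open>The answer y found in the group lies in [0, u'] because 0 \<le> x and x \<le> u are
  statements about forms with coefficients at most 1. It is then replaced by the image of a chain
  element that differs from it by a null element.\<close>

lemma ef_chain_step:
  assumes A: "chain_rep Pos eps A u emb" "zgroup Pos eps"
    and B: "chain_rep Pos' eps' B u' emb'" "zgroup Pos' eps'"
    and M: "M \<ge> 1"
    and eq: "lin_eq Pos Pos' (V + 2) (4 * (fact (nat M) * fact (nat M) * (M + 1)))
      (env u eps emb v) (env u' eps' emb' w)"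
    and a: "a \<in> carrier A" and i: "i < V"
  shows "\<exists>b\<in>carrier B. lin_eq Pos Pos' (V + 2) M (env u eps emb (v(i := a))) (env u' eps' emb' (w(i := b)))"
proof -
  interpret A: chain_rep Pos eps A u emb by fact
  interpret B: chain_rep Pos' eps' B u' emb' by fact
  let ?e = "env u eps emb v" and ?e' = "env u' eps' emb' w"
  obtain y where y: "lin_eq Pos Pos' (V + 2) M (?e(i + 2 := emb a)) (?e'(i + 2 := y))"
    using lin_eq_step[OF A(2) B(2) M refl eq _ _ _ _ A.emb_nonneg[OF a], of "i + 2"] i by auto
  have l: "lin (V + 2) (?e(i + 2 := emb a)) (\<lambda>j. if j = i + 2 then 1 else 0) = emb a"
    "lin (V + 2) (?e'(i + 2 := y)) (\<lambda>j. if j = i + 2 then 1 else 0) = y"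
    "lin (V + 2) (?e(i + 2 := emb a)) (\<lambda>j. if j = 0 then 1 else 0) = u"
    "lin (V + 2) (?e'(i + 2 := y)) (\<lambda>j. if j = 0 then 1 else 0) = u'"
    using i by (subst lin_single; simp)+
  have "Pos (lin (V + 2) (?e(i + 2 := emb a)) c) \<longleftrightarrow> Pos' (lin (V + 2) (?e'(i + 2 := y)) c)"
    if "\<And>j. \<bar>c j\<bar> \<le> M" for c using y that unfolding lin_eq_def by blast
  note iff = this[of "\<lambda>j. if j = i + 2 then 1 else 0"]
    this[of "\<lambda>j. (if j = 0 then 1 else 0) - (if j = i + 2 then 1 else 0)"]
  have "Pos' y" "Pos' (u' - y)"
    using iff A.emb_nonneg[OF a] A.emb_le_unit[OF a] M unfolding lin_diff[symmetric] l by simp_all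
  then obtain b where b: "b \<in> carrier B" "null Pos' (emb' b - y)" using B.emb_surj by blast
  have "lin_eq Pos Pos' (V + 2) M (?e(i + 2 := emb a)) (?e'(i + 2 := emb' b))"
    by (rule lin_eq_null[OF B.discrete_group_axioms y])
      (use B.null_minus[OF b(2)] B.null_0 in simp)
  then show ?thesis unfolding env_upd using b by blast
qed

theorem ef_chain:
  assumes A: "chain_rep Pos eps A u emb" "zgroup Pos eps"
    and B: "chain_rep Pos' eps' B u' emb'" "zgroup Pos' eps'"
    and c: "const_agree K A c B d"
  shows "(\<And>x. v x \<in> carrier A) \<Longrightarrow> (\<And>x. w x \<in> carrier B) \<Longrightarrow>
    lin_eq Pos Pos' (V + 2) (ef_bound s k) (env u eps emb v) (env u' eps' emb' w) \<Longrightarrow>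
    ef K V s A c B d k v w"
proof (induction k arbitrary: v w)
  have atomic: "ef_atomic K V s A c B d v w"
    if "\<And>x. v x \<in> carrier A" "\<And>x. w x \<in> carrier B" and
      eq: "lin_eq Pos Pos' (V + 2) (2 * int s + 1) (env u eps emb v) (env u' eps' emb' w)" for v w
    unfolding ef_atomic_def
  proof (intro allI impI)
    interpret A: chain_rep Pos eps A u emb by fact
    interpret B: chain_rep Pos' eps' B u' emb' by fact
    let ?e = "lin (V + 2) (env u eps emb v)" and ?e' = "lin (V + 2) (env u' eps' emb' w)"
    fix t t' assume t: "term_size t \<le> s" "term_size t' \<le> s" "term_vars t \<union> term_vars t' \<subseteq> {..<V}"
      "term_consts t \<union> term_consts t' \<subseteq> K"
    note tl = term_lin[OF A(1) B(1) eq that(1,2) c]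
    from tl[of t] t obtain f where f: "\<forall>i<V + 2. \<bar>f i\<bar> \<le> int (term_size t)"
      and cl: "term_val A c v t \<in> carrier A" "term_val B d w t \<in> carrier B"
      and n: "null Pos (emb (term_val A c v t) - ?e f)" "null Pos' (emb' (term_val B d w t) - ?e' f)"
      by auto
    from tl[of t'] t obtain g where g: "\<forall>i<V + 2. \<bar>g i\<bar> \<le> int (term_size t')"
      and cl': "term_val A c v t' \<in> carrier A" "term_val B d w t' \<in> carrier B"
      and n': "null Pos (emb (term_val A c v t') - ?e g)" "null Pos' (emb' (term_val B d w t') - ?e' g)"
      by auto
    have bd: "\<bar>f i - g i\<bar> \<le> 2 * int s + 1" "\<bar>g i - f i\<bar> \<le> 2 * int s + 1" if "i < V + 2" for i
      using f[rule_format, OF that] g[rule_format, OF that] t by auto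
    have iff: "Pos (?e f - ?e g) \<longleftrightarrow> Pos' (?e' f - ?e' g)" "Pos (?e g - ?e f) \<longleftrightarrow> Pos' (?e' g - ?e' f)"
      unfolding lin_diff
      using eq[unfolded lin_eq_def, rule_format, of "\<lambda>i. f i - g i"]
        eq[unfolded lin_eq_def, rule_format, of "\<lambda>i. g i - f i"] bd by blast+
    \<comment> \<open>Equality of terms is nullness of a difference of forms, that is, two
      inequalities which the invariant transfers.\<close>
    have "term_val A c v t = term_val A c v t' \<longleftrightarrow> null Pos (emb (term_val A c v t) - emb (term_val A c v t'))"
      using A.emb_eq_iff cl cl' by simp
    also have "\<dots> \<longleftrightarrow> null Pos (?e f - ?e g)"
    proof -
      have m: "null Pos ((emb (term_val A c v t) - emb (term_val A c v t')) - (?e f - ?e g))"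
        using A.null_diff[OF n(1) n'(1)] by (simp add: algebra_simps)
      show ?thesis using A.null_cong[OF m] .
    qed
    also have "\<dots> \<longleftrightarrow> null Pos' (?e' f - ?e' g)" using iff by (simp add: null_def)
    also have "\<dots> \<longleftrightarrow> null Pos' (emb' (term_val B d w t) - emb' (term_val B d w t'))"
    proof -
      have m: "null Pos' ((emb' (term_val B d w t) - emb' (term_val B d w t')) - (?e' f - ?e' g))"
        using B.null_diff[OF n(2) n'(2)] by (simp add: algebra_simps)
      show ?thesis using B.null_cong[OF m] by simp
    qed
    also have "\<dots> \<longleftrightarrow> term_val B d w t = term_val B d w t'" using B.emb_eq_iff cl cl' by simp
    finally show "term_val A c v t = term_val A c v t' \<longleftrightarrow> term_val B d w t = term_val B d w t'" .
  qed
  {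
    case 0
    then show ?case using atomic by simp
  next
    case (Suc k)
    have M: "ef_bound s k \<ge> 1" using ef_bound_ge(1)[of s k] by simp
    have at: "ef_atomic K V s A c B d v w"
      using atomic Suc.prems lin_eq_mono ef_bound_ge(1)[of s "Suc k"] by blast
    have forth: "\<exists>b\<in>carrier B. ef K V s A c B d k (v(i := a)) (w(i := b))"
      if i: "i < V" and a: "a \<in> carrier A" for i a
    proof -
      obtain b where b: "b \<in> carrier B"
        "lin_eq Pos Pos' (V + 2) (ef_bound s k) (env u eps emb (v(i := a))) (env u' eps' emb' (w(i := b)))"
        using ef_chain_step[OF A B M Suc.prems(3)[unfolded ef_bound.simps] a i] by blast
      have "ef K V s A c B d k (v(i := a)) (w(i := b))"
        by (rule Suc.IH[OF _ _ b(2)]) (use Suc.prems(1,2) b a in simp_all)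
      then show ?thesis using b by blast
    qed
    have bwd: "\<exists>a\<in>carrier A. ef K V s A c B d k (v(i := a)) (w(i := b))"
      if i: "i < V" and b: "b \<in> carrier B" for i b
    proof -
      obtain a where a: "a \<in> carrier A"
        "lin_eq Pos' Pos (V + 2) (ef_bound s k) (env u' eps' emb' (w(i := b))) (env u eps emb (v(i := a)))"
        using ef_chain_step[OF B A M lin_eq_sym[THEN iffD1, OF Suc.prems(3)[unfolded ef_bound.simps]] b i]
        by blast
      have "ef K V s A c B d k (v(i := a)) (w(i := b))"
        by (rule Suc.IH[OF _ _ lin_eq_sym[THEN iffD1, OF a(2)]]) (use Suc.prems(1,2) a b in simp_all)
      then show ?thesis using a by blast
    qed
    show ?case using at forth bwd by simp
  }
qed

section \<open>Approximation of the unit by integers\<close>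

text \<open>To forms and moduli bounded by M the pair (u, eps) looks like the pair (N, 1) in the
  integers.\<close>

definition approx :: "('g::comm_ring_1 \<Rightarrow> bool) \<Rightarrow> 'g \<Rightarrow> 'g \<Rightarrow> int \<Rightarrow> int \<Rightarrow> bool" where
  "approx Pos eps u M N \<longleftrightarrow> (\<forall>a b. \<bar>a\<bar> \<le> M \<longrightarrow> \<bar>b\<bar> \<le> M \<longrightarrow>
     (Pos (of_int a * u + of_int b * eps) \<longleftrightarrow> a * N + b \<ge> 0)
     \<and> (\<forall>m\<in>{1..M}. Div Pos m (of_int a * u + of_int b * eps) \<longleftrightarrow> m dvd a * N + b))"

lemma (in chain_rep) lin_env_zero:
  "null Pos (lin (V + 2) (env u eps emb (\<lambda>_. nought)) c - (of_int (c 0) * u + of_int (c 1) * eps))"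
proof -
  let ?e = "env u eps emb (\<lambda>_. nought)" and ?d = "\<lambda>i. if i < 2 then env u eps emb (\<lambda>_. nought) i else 0"
  have "lin (V + 2) ?d c = of_int (c 0) * u + of_int (c 1) * eps"
    unfolding lin_def by (induction V) (simp_all add: numeral_2_eq_2)
  moreover have "null Pos (lin (V + 2) ?e c - lin (V + 2) ?d c)"
    by (rule lin_null) (use emb_zero null_0 in \<open>auto simp: env_def\<close>)
  ultimately show ?thesis by simp
qed

lemma approx_lin_eq:
  assumes A: "chain_rep Pos eps A u emb" and B: "chain_rep Pos' eps' B u' emb'"
    and "approx Pos eps u M N" "approx Pos' eps' u' M N"
  shows "lin_eq Pos Pos' (V + 2) M (env u eps emb (\<lambda>_. mv_zero A)) (env u' eps' emb' (\<lambda>_. mv_zero B))"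
  unfolding lin_eq_def
proof (intro allI impI)
  interpret A: chain_rep Pos eps A u emb by fact
  interpret B: chain_rep Pos' eps' B u' emb' by fact
  fix c :: "nat \<Rightarrow> int" assume c: "\<forall>i<V + 2. \<bar>c i\<bar> \<le> M"
  then have cM: "\<bar>c 0\<bar> \<le> M" "\<bar>c 1\<bar> \<le> M" by auto
  show "(Pos (lin (V + 2) (env u eps emb (\<lambda>_. mv_zero A)) c) \<longleftrightarrow> Pos' (lin (V + 2) (env u' eps' emb' (\<lambda>_. mv_zero B)) c))
    \<and> (\<forall>m\<in>{1..M}. Div Pos m (lin (V + 2) (env u eps emb (\<lambda>_. mv_zero A)) c)
        \<longleftrightarrow> Div Pos' m (lin (V + 2) (env u' eps' emb' (\<lambda>_. mv_zero B)) c))"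
    using A.Pos_null[OF A.lin_env_zero] B.Pos_null[OF B.lin_env_zero]
      A.Div_null[OF A.lin_env_zero] B.Div_null[OF B.lin_env_zero]
      assms(3,4)[unfolded approx_def, rule_format, OF cM] by simp
qed

lemma (in discrete_group) approx_finite:
  assumes "null Pos (u - of_int N * eps)" shows "approx Pos eps u M N"
  unfolding approx_def
proof (intro allI impI)
  fix a b :: int
  have n: "null Pos ((of_int a * u + of_int b * eps) - of_int (a * N + b) * eps)"
    using null_mult[OF assms, of a] by (simp add: algebra_simps)
  show "(Pos (of_int a * u + of_int b * eps) \<longleftrightarrow> a * N + b \<ge> 0)
     \<and> (\<forall>m\<in>{1..M}. Div Pos m (of_int a * u + of_int b * eps) \<longleftrightarrow> m dvd a * N + b)"
    using Pos_null[OF n] Div_null[OF n] Pos_of_int_eps Div_eps by (metis atLeastAtMost_iff)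
qed

text \<open>Since u exceeds every multiple of eps, the sign of a u + b eps is that of a unless a =
  0. For \<bar>b\<bar> \<le> M < N the same is true of a N + b.\<close>

lemma (in discrete_group) approx_infinite:
  assumes inf: "\<And>j. Pos (u - of_int j * eps)" and N: "N > M"
    and D: "\<And>m. m \<in> {1..M} \<Longrightarrow> Div Pos m (u - of_int N * eps)"
  shows "approx Pos eps u M N"
  unfolding approx_def
proof (intro allI impI conjI ballI)
  fix a b :: int assume a: "\<bar>a\<bar> \<le> M" and b: "\<bar>b\<bar> \<le> M"
  have Pu: "Pos u" using inf[of 0] by simp
  have pos: "Pos (of_int a * u + of_int b * eps)" if "a > 0" for a b
  proof -
    have "Pos (u - of_int (- b) * eps)" by (rule inf)
    moreover have "Pos (of_int (a - 1) * u)" by (rule Pos_mult) (use that Pu in auto)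
    ultimately have "Pos (u - of_int (- b) * eps + of_int (a - 1) * u)" by (rule Pos_add)
    then show ?thesis by (simp add: algebra_simps)
  qed
  show "Pos (of_int a * u + of_int b * eps) \<longleftrightarrow> a * N + b \<ge> 0"
  proof (cases a "0 :: int" rule: linorder_cases)
    case equal
    then show ?thesis using Pos_of_int_eps by simp
  next
    case greater
    then have "a * N \<ge> 1 * N" using N a by (intro mult_right_mono) auto
    then show ?thesis using pos[OF greater] N b by simp
  next
    case less
    then have "(- a) * N \<ge> 1 * N" using N a by (intro mult_right_mono) auto
    then have 1: "a * N + b < 0" using N b by simp
    \<comment> \<open>The case of a positive coefficient is applied to the negated form minus eps,
      which by \<open>not_Pos\<close> gives strict negativity.\<close>
    have "Pos (of_int (- a) * u + of_int (- b - 1) * eps)" by (rule pos) (use less in simp)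
    then have "Pos (- (of_int a * u + of_int b * eps) - eps)" by (simp add: algebra_simps)
    then show ?thesis using 1 not_Pos[of "of_int a * u + of_int b * eps"] by simp
  qed
  fix m assume m: "m \<in> {1..M}"
  have "(of_int a * u + of_int b * eps) - of_int (a * N + b) * eps = of_int a * (u - of_int N * eps)"
    by (simp add: algebra_simps)
  then have "Div Pos m ((of_int a * u + of_int b * eps) - of_int (a * N + b) * eps)"
    using Div_mult[OF D[OF m]] by simp
  then show "Div Pos m (of_int a * u + of_int b * eps) \<longleftrightarrow> m dvd a * N + b"
    using Div_cong Div_eps[of m "a * N + b"] m by auto
qed

section \<open>The Chang group as a preordered group\<close>

lemma (in nontrivial_chain) fst_chang_mult:
  "g \<in> carrier G \<Longrightarrow> h \<in> carrier G \<Longrightarrow> fst (g \<otimes>\<^bsub>G\<^esub> h) \<ge> fst g + fst h"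
  by (cases g; cases h) (simp add: chang_simps)

lemma (in nontrivial_chain) fst_chang_inv:
  "g \<in> carrier G \<Longrightarrow> fst (inv\<^bsub>G\<^esub> g) = (if snd g = nought then - fst g else - fst g - 1)"
  by (cases g) (simp add: inv_chang chang_inv_def)

lemma (in nontrivial_chain) chang_unit_minus:
  "(m, x) \<in> carrier G \<Longrightarrow> (1, nought) \<otimes>\<^bsub>G\<^esub> inv\<^bsub>G\<^esub> (m, x) = (if x = nought then (1 - m, nought) else (- m, \<sim> x))"
  using nontrivial neg_eq_one[of x]
  by (auto simp: inv_chang chang_inv_def chang_simps zero_plus closed)

lemma (in nontrivial_chain) chang_minus_unit:
  "(m, x) \<in> carrier G \<Longrightarrow> (m, x) \<otimes>\<^bsub>G\<^esub> inv\<^bsub>G\<^esub> (1, nought) = (m - 1, x)"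
  using nontrivial by (auto simp: inv_chang chang_inv_def chang_simps plus_zero closed)

lemma (in nontrivial_chain) chang_embed_closed:
  "x \<in> K \<Longrightarrow> chang_embed A x \<in> carrier G" "chang_unit A \<in> carrier G"
  using nontrivial by (auto simp: chang_embed_def chang_unit_def chang_simps closed)

lemma (in nontrivial_chain) chang_unit_pow:
  "(1, nought) [^]\<^bsub>G\<^esub> (m::int) = (m, nought)"
proof -
  interpret comm_group G by (rule comm_group_chang)
  have U: "(1, nought) \<in> carrier G" using chang_embed_closed by (simp add: chang_unit_def)
  have nat: "(1, nought) [^]\<^bsub>G\<^esub> (n::nat) = (int n, nought)" for n
    by (induction n) (use nontrivial in \<open>auto simp: chang_simps zero_plus closed\<close>)
  show ?thesis
  proof (cases "m \<ge> 0")
    case True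
    then show ?thesis using nat[of "nat m"] int_pow_int[of G "(1, nought)" "nat m"] by simp
  next
    case False
    have "(int (nat (- m)), nought) \<in> carrier G" using nontrivial by (simp add: chang_simps closed)
    then show ?thesis using False nat[of "nat (- m)"] int_pow_int[of G "(1, nought)" "nat (- m)"]
      int_pow_neg[OF U, of "- m"] by (simp add: inv_chang chang_inv_def)
  qed
qed

text \<open>
  The free abelian group on the carrier of the Chang group is preordered by evaluation. It is
  taken in a monoid ring, for the type of multisets of elements, only in order to have a ring type.
\<close>

lemma (in nontrivial_chain) exists_evaluation:
  obtains ev :: "((int \<times> 'a) multiset \<Rightarrow>\<^sub>0 int) \<Rightarrow> int \<times> 'a"
  where "\<And>x. ev x \<in> carrier G" "\<And>x y. ev (x + y) = ev x \<otimes>\<^bsub>G\<^esub> ev y"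
    "\<And>g. g \<in> carrier G \<Longrightarrow> ev (frag_of {#g#}) = g"
proof -
  interpret comm_group G by (rule comm_group_chang)
  \<comment> \<open>Only the singletons of group elements carry information; every other generator
    is sent to the identity.\<close>
  define f where "f X = (if X \<in> (\<lambda>g. {#g#}) ` carrier G then the_elem (set_mset X) else \<one>\<^bsub>G\<^esub>)" for X
  have "f ` UNIV \<subseteq> carrier G" by (auto simp: f_def)
  then obtain ev where ev: "ev \<in> hom (free_Abelian_group UNIV) G" "\<And>X. X \<in> UNIV \<Longrightarrow> ev (frag_of X) = f X"
    using free_Abelian_group_universal by blast
  show ?thesis
  proof
    show "ev x \<in> carrier G" "ev (x + y) = ev x \<otimes>\<^bsub>G\<^esub> ev y" for x y
      using ev(1) by (auto simp: hom_def free_Abelian_group_def)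
    show "ev (frag_of {#g#}) = g" if "g \<in> carrier G" for g using that by (auto simp: ev(2) f_def)
  qed
qed

lemma the_mv_atom:
  assumes "mv_algebra A" "mv_atom A e"
  shows "(THE e. mv_atom A e) = e"
  using assms mv_algebra.le_antisym[OF assms(1)] by (auto simp: mv_atom_def intro!: the_equality)

text \<open>Beyond the interval itself later arguments need that every group element is a multiple
  of u plus an element of the chain, and that \<open>mv_D\<close> can be read off in the preordered
  group.\<close>

theorem (in nontrivial_chain) chang_rep:
  assumes e: "mv_atom A e"
  obtains Pos :: "((int \<times> 'a) multiset \<Rightarrow>\<^sub>0 int) \<Rightarrow> bool" and eps u emb
  where "chain_rep Pos eps A u emb" "\<And>g. \<exists>m. \<exists>x\<in>K. null Pos (g - of_int m * u - emb x)"
    "null Pos (emb e - eps)"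
    "\<And>q k. mv_D A q k \<longleftrightarrow> (\<exists>x\<in>K. mv_increasing_multiples A (q - 1) x
       \<and> (\<exists>j. null Pos (of_int (int q) * emb x - of_int (int k) * eps - of_int j * u)))"
proof -
  interpret G: comm_group G by (rule comm_group_chang)
  obtain ev :: "((int \<times> 'a) multiset \<Rightarrow>\<^sub>0 int) \<Rightarrow> int \<times> 'a"
    where ev: "\<And>x. ev x \<in> carrier G" and ev_add: "\<And>x y. ev (x + y) = ev x \<otimes>\<^bsub>G\<^esub> ev y"
    and ev_of: "\<And>g. g \<in> carrier G \<Longrightarrow> ev (frag_of {#g#}) = g"
    using exists_evaluation by blast
  have ev_0: "ev 0 = \<one>\<^bsub>G\<^esub>" using ev_add[of 0 0] ev[of 0] by (metis G.l_cancel_one add_0)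
  have ev_neg: "ev (- x) = inv\<^bsub>G\<^esub> ev x" for x
    using ev_add[of "- x" x] ev_0 ev by (metis G.inv_equality add.left_inverse)
  have ev_diff: "ev (x - y) = ev x \<otimes>\<^bsub>G\<^esub> inv\<^bsub>G\<^esub> ev y" for x y
    using ev_add[of x "- y"] ev_neg by simp
  have ev_nat: "ev (of_int (int n) * x) = ev x [^]\<^bsub>G\<^esub> n" for n x
    by (induction n) (simp_all add: ev_0 ev_add algebra_simps G.m_comm ev)
  have ev_int: "ev (of_int k * x) = ev x [^]\<^bsub>G\<^esub> k" for k x
  proof (cases "k \<ge> 0")
    case True
    then show ?thesis using ev_nat[of "nat k" x] int_pow_int[of G "ev x" "nat k"] by simp
  next
    case False
    have "ev (of_int k * x) = inv\<^bsub>G\<^esub> ev (of_int (int (nat (- k))) * x)"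
      using False ev_neg[of "of_int (- k) * x"] by simp
    then show ?thesis using False ev_nat[of "nat (- k)" x] int_pow_int[of G "ev x" "nat (- k)"]
      G.int_pow_neg[OF ev, of x "- k"] by (simp add: ev)
  qed
  \<comment> \<open>An element m u + x with 0 \<le> x < u is nonnegative exactly when m is.\<close>
  define Pos where "Pos x \<longleftrightarrow> fst (ev x) \<ge> 0" for x
  define u where "u = (frag_of {#(1, nought)#} :: (int \<times> 'a) multiset \<Rightarrow>\<^sub>0 int)"
  define emb where "emb x = (frag_of {#chang_embed A x#} :: (int \<times> 'a) multiset \<Rightarrow>\<^sub>0 int)" for x
  have eK: "e \<in> K" "e \<noteq> nought" "\<And>x. x \<in> K \<Longrightarrow> x \<noteq> nought \<Longrightarrow> e \<preceq> x" using e by (auto simp: mv_atom_def)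
  have U: "(1, nought) \<in> carrier G" using chang_embed_closed by (simp add: chang_unit_def)
  have ev_u: "ev u = (1, nought)" unfolding u_def using ev_of U by simp
  have ev_emb: "ev (emb x) = chang_embed A x" if "x \<in> K" for x
    unfolding emb_def using ev_of chang_embed_closed that by simp
  have emb_1: "ev (emb unity) = (1, nought)" "ev (emb nought) = (0, nought)"
    using ev_emb closed nontrivial by (simp_all add: chang_embed_def chang_unit_def)
  have emb_lt: "ev (emb x) = (0, x)" if "x \<in> K" "x \<noteq> unity" for x
    using ev_emb that by (simp add: chang_embed_def)
  have Pos_neg: "Pos (- x) \<longleftrightarrow> (if snd (ev x) = nought then fst (ev x) \<le> 0 else fst (ev x) \<le> - 1)" for x
    using fst_chang_inv[OF ev[of x]] by (auto simp: Pos_def ev_neg)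
  have null_iff: "null Pos x \<longleftrightarrow> ev x = \<one>\<^bsub>G\<^esub>" for x
    unfolding null_def Pos_neg by (cases "ev x") (auto simp: Pos_def chang_simps)
  have null_diff_iff: "null Pos (x - y) \<longleftrightarrow> ev x = ev y" for x y
    unfolding null_iff ev_diff
  proof
    assume "ev x \<otimes>\<^bsub>G\<^esub> inv\<^bsub>G\<^esub> ev y = \<one>\<^bsub>G\<^esub>"
    then have "(ev x \<otimes>\<^bsub>G\<^esub> inv\<^bsub>G\<^esub> ev y) \<otimes>\<^bsub>G\<^esub> ev y = ev y" using ev by simp
    then show "ev x = ev y" using ev by (simp add: G.m_assoc)
  qed (simp add: ev)
  have Pos_u_minus: "Pos (u - x) \<longleftrightarrow> fst (ev x) \<le> (if snd (ev x) = nought then 1 else 0)" for x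
    using chang_unit_minus[of "fst (ev x)" "snd (ev x)"] ev[of x] by (simp add: Pos_def ev_diff ev_u)
  have ev_u_minus: "ev (u - x) = (if snd (ev x) = nought then (1 - fst (ev x), nought) else (- fst (ev x), \<sim> (snd (ev x))))" for x
    using chang_unit_minus[of "fst (ev x)" "snd (ev x)"] ev[of x] by (simp add: ev_diff ev_u)
  have Pos_minus_u: "Pos (x - u) \<longleftrightarrow> fst (ev x) \<ge> 1" for x
    using chang_minus_unit[of "fst (ev x)" "snd (ev x)"] ev[of x] by (auto simp: Pos_def ev_diff ev_u)
  have snd_ev: "snd (ev x) \<in> K" "snd (ev x) \<noteq> unity" for x using ev[of x] by (auto simp: chang_simps)
  have rep: "chain_rep Pos (emb e) A u emb"
  proof
    fix x y assume "Pos x" "Pos y"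
    then show "Pos (x + y)" using fst_chang_mult[OF ev ev, of x y] by (simp add: Pos_def ev_add)
  next
    show "Pos x \<or> Pos (- x)" for x unfolding Pos_neg by (auto simp: Pos_def)
  next
    show "\<not> Pos (- emb e)" unfolding Pos_neg using emb_1 emb_lt[OF eK(1)] eK(2) by (cases "e = unity") auto
  next
    fix x assume x: "\<not> Pos (- x)"
    show "Pos (x - emb e)"
    proof (cases "e = unity")
      \<comment> \<open>In the two-element chain the atom is the unit, and it is embedded as (1, 0)
        and not as (0, e).\<close>
      case True
      then have "ev (emb e) = ev u" using emb_1 ev_u by simp
      then have "Pos (x - emb e) \<longleftrightarrow> Pos (x - u)" by (simp add: Pos_def ev_diff)
      moreover have "snd (ev x) = nought"
        using eK(3)[OF snd_ev(1), of x] le_antisym[OF snd_ev(1) one_closed, of x] le_one snd_ev True by metis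
      ultimately show ?thesis using x unfolding Pos_neg Pos_minus_u by auto
    next
      case False
      obtain m y where my: "ev x = (m, y)" by force
      then have y: "y \<in> K" "y \<noteq> unity" using snd_ev[of x] by auto
      have ne: "\<sim> e \<noteq> unity" using neg_eq_one eK by blast
      have "(0, e) \<in> carrier G" using False eK by (simp add: chang_simps)
      then have ev_e: "ev (x - emb e) = (m, y) \<otimes>\<^bsub>G\<^esub> (- 1, \<sim> e)"
        using emb_lt[OF eK(1) False] eK(2) by (simp add: ev_diff my inv_chang chang_inv_def)
      show ?thesis
      proof (cases "y = nought")
        case True
        then have "ev (x - emb e) = (m - 1, \<sim> e)"
          using ev_e ne zero_plus[OF neg_closed[OF eK(1)]] by (simp add: chang_simps)
        then show ?thesis using x my True unfolding Pos_neg by (simp add: Pos_def)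
      next
        case F: False
        then have "y \<boxplus> \<sim> e = unity"
          using eK(3)[OF y(1) F] le_iff[OF eK(1) y(1)] plus_comm[OF y(1) neg_closed[OF eK(1)]] by simp
        then have "ev (x - emb e) = (m, y \<boxdot> \<sim> e)" using ev_e by (simp add: chang_simps)
        then show ?thesis using x my F unfolding Pos_neg by (simp add: Pos_def)
      qed
    qed
  next
    fix x assume x: "x \<in> K"
    show "Pos (emb x)" using ev_emb[OF x] by (auto simp: Pos_def chang_embed_def chang_unit_def)
    show "Pos (u - emb x)" unfolding Pos_u_minus using emb_1 emb_lt[OF x] by (cases "x = unity") auto
    show "null Pos (emb (\<sim> x) - (u - emb x))"
      unfolding null_diff_iff ev_u_minus
    proof -
      consider "x = unity" | "x = nought" | "x \<noteq> unity" "x \<noteq> nought" by blast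
      then show "ev (emb (\<sim> x)) = (if snd (ev (emb x)) = nought then (1 - fst (ev (emb x)), nought)
          else (- fst (ev (emb x)), \<sim> (snd (ev (emb x)))))"
      proof cases
        case 1
        then show ?thesis by (simp add: emb_1 neg_one)
      next
        case 2
        then show ?thesis by (simp add: emb_1 neg_zero)
      next
        case 3
        then have "\<sim> x \<noteq> unity" using neg_eq_one[OF x] by blast
        then show ?thesis using 3 emb_lt[OF x] emb_lt[OF neg_closed[OF x]] by simp
      qed
    qed
  next
    fix g assume g: "Pos g" "Pos (u - g)"
    obtain m x where mx: "ev g = (m, x)" by force
    then have x: "x \<in> K" "x \<noteq> unity" using snd_ev[of g] by auto
    have "m = 0 \<or> m = 1 \<and> x = nought" using g mx unfolding Pos_u_minus by (auto simp: Pos_def split: if_splits)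
    then have "ev (emb x) = ev g \<or> ev (emb unity) = ev g" using emb_lt[OF x] emb_1 mx by auto
    then show "\<exists>x\<in>K. null Pos (emb x - g)" unfolding null_diff_iff using x one_closed by blast
  next
    fix x y assume "x \<in> K" "y \<in> K" "null Pos (emb x - emb y)"
    then show "x = y" unfolding null_diff_iff
      by (auto simp: ev_emb chang_embed_def chang_unit_def split: if_splits)
  next
    show "null Pos (emb nought)" unfolding null_iff using emb_1 by (simp add: chang_simps)
  next
    fix x y assume xy: "x \<in> K" "y \<in> K"
    obtain m z where mz: "ev (emb x + emb y) = (m, z)" by force
    have cases: "x \<boxplus> y \<noteq> unity \<and> m = 0 \<and> z = x \<boxplus> y \<or> x \<boxplus> y = unity \<and> m \<ge> 1"
    proof (cases "x = unity \<or> y = unity")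
      case True
      then have "fst (ev (emb x)) + fst (ev (emb y)) \<ge> 1"
        using ev_emb xy by (auto simp: chang_embed_def chang_unit_def)
      then have "m \<ge> 1" using fst_chang_mult[OF ev ev, of "emb x" "emb y"] mz by (simp add: ev_add)
      moreover have "x \<boxplus> y = unity" using True xy plus_one one_plus by auto
      ultimately show ?thesis by simp
    next
      case False
      then show ?thesis using mz emb_lt xy by (auto simp: ev_add chang_simps split: if_splits)
    qed
    show "null Pos (emb (x \<boxplus> y) - (emb x + emb y))" if "Pos (u - (emb x + emb y))"
    proof -
      have "m \<le> (if z = nought then 1 else 0)" using that mz unfolding Pos_u_minus by simp
      then have "ev (emb (x \<boxplus> y)) = (m, z)"
        using cases emb_1 emb_lt[OF plus_closed[OF xy]] by (auto split: if_splits)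
      then show ?thesis unfolding null_diff_iff using mz by simp
    qed
    show "null Pos (emb (x \<boxplus> y) - u)" if "Pos (emb x + emb y - u)"
    proof -
      have "m \<ge> 1" using that mz unfolding Pos_minus_u by simp
      then have "x \<boxplus> y = unity" using cases by auto
      then show ?thesis unfolding null_diff_iff using emb_1 ev_u by simp
    qed
  qed
  show ?thesis
  proof (rule that[OF rep])
    fix g
    obtain m x where mx: "ev g = (m, x)" by force
    then have x: "x \<in> K" "x \<noteq> unity" using snd_ev[of g] by auto
    have "ev (g - of_int m * u) = (m, x) \<otimes>\<^bsub>G\<^esub> inv\<^bsub>G\<^esub> (m, nought)"
      by (simp add: ev_diff ev_int ev_u chang_unit_pow mx)
    also have "\<dots> = (0, x)"
    proof -
      have "(m, nought) \<in> carrier G" using nontrivial by (simp add: chang_simps closed)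
      then show ?thesis using x by (simp add: inv_chang chang_inv_def chang_simps plus_zero)
    qed
    finally have "null Pos (g - of_int m * u - emb x)" unfolding null_diff_iff using emb_lt x by simp
    then show "\<exists>m. \<exists>x\<in>K. null Pos (g - of_int m * u - emb x)" using x by blast
  next
    show "null Pos (emb e - emb e)" unfolding null_diff_iff by simp
  next
    fix q k
    have "(chang_embed A x [^]\<^bsub>G\<^esub> q) \<otimes>\<^bsub>G\<^esub> inv\<^bsub>G\<^esub> (chang_embed A e [^]\<^bsub>G\<^esub> k) = chang_unit A [^]\<^bsub>G\<^esub> j
      \<longleftrightarrow> null Pos (of_int (int q) * emb x - of_int (int k) * emb e - of_int j * u)" if "x \<in> K" for x and j :: int
      unfolding null_diff_iff ev_diff[of "of_int (int q) * emb x"] ev_nat ev_int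
      using ev_emb[OF that] ev_emb[OF eK(1)] ev_u by (simp add: chang_unit_def int_pow_int)
    then show "mv_D A q k \<longleftrightarrow> (\<exists>x\<in>K. mv_increasing_multiples A (q - 1) x
       \<and> (\<exists>j. null Pos (of_int (int q) * emb x - of_int (int k) * emb e - of_int j * u)))"
      unfolding mv_D_def Let_def the_mv_atom[OF mv_algebra_axioms e] by simp
  qed
qed

section \<open>Finite chains\<close>

text \<open>The Lukasiewicz chain with N + 1 elements, scaled to integers; N = 0 gives the
  one-element algebra.\<close>

definition nat_chain :: "nat \<Rightarrow> nat mv" where
  "nat_chain N = \<lparr>carrier = {..N}, mv_plus = (\<lambda>x y. min (x + y) N), mv_neg = (\<lambda>x. N - x), mv_zero = 0\<rparr>"

lemma nat_chain_simps [simp]: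
  "carrier (nat_chain N) = {..N}" "mv_plus (nat_chain N) x y = min (x + y) N"
  "mv_neg (nat_chain N) x = N - x" "mv_zero (nat_chain N) = 0" "mv_one (nat_chain N) = N"
  by (simp_all add: nat_chain_def mv_one_def)

lemma nat_chain_algebra: "mv_algebra (nat_chain N)"
  by unfold_locales (auto simp: min_def)

lemma zgroup_int: "zgroup (\<lambda>x::int. 0 \<le> x) 1"
proof
  fix m x :: int
  show "\<exists>r. Div (\<lambda>x. 0 \<le> x) m (x - of_int r * 1)"
    by (intro exI[of _ x]) (auto simp: Div_def null_def intro: exI[of _ 0])
qed auto

lemma nat_chain_rep: "chain_rep (\<lambda>x::int. 0 \<le> x) 1 (nat_chain N) (int N) int"
proof -
  interpret zgroup "\<lambda>x::int. 0 \<le> x" 1 by (rule zgroup_int)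
  interpret mv_algebra "nat_chain N" by (rule nat_chain_algebra)
  show ?thesis
  proof
    fix g :: int assume "0 \<le> g" "0 \<le> int N - g"
    then show "\<exists>x\<in>carrier (nat_chain N). null (\<lambda>x. 0 \<le> x) (int x - g)"
      by (intro bexI[of _ "nat g"]) (auto simp: null_def)
  qed (auto simp: null_def)
qed

lemma nat_chain_mult: "mv_mult (nat_chain N) k x = min (k * x) N"
  by (induction k) (auto simp: min_def)

text \<open>By discreteness nothing lies strictly between N eps and (N + 1) eps, so an element
  between 0 and a multiple of eps is itself a multiple up to a null element.\<close>

lemma (in discrete_group) bounded_multiple:
  "Pos x \<Longrightarrow> Pos (of_int (int N) * eps - x) \<Longrightarrow> \<exists>j\<le>N. null Pos (x - of_int (int j) * eps)"
proof (induction N)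
  case 0
  then show ?case by (auto simp: null_def)
next
  case (Suc N)
  show ?case
  proof (cases "Pos (of_int (int N) * eps - x)")
    case True
    then show ?thesis using Suc le_SucI by blast
  next
    case False
    then have "Pos (x - of_int (int (Suc N)) * eps)"
      using not_Pos[of "of_int (int N) * eps - x"] by (simp add: algebra_simps)
    then have "null Pos (x - of_int (int (Suc N)) * eps)" using Suc.prems by (simp add: null_def)
    then show ?thesis by blast
  qed
qed

lemma (in discrete_group) finite_or_infinite:
  assumes "Pos u"
  shows "(\<exists>N. null Pos (u - of_int (int N) * eps)) \<or> (\<forall>j. Pos (u - of_int j * eps))"
proof (rule disjCI)
  assume n: "\<not> (\<forall>j. Pos (u - of_int j * eps))"
  then obtain j where j: "\<not> Pos (u - of_int j * eps)" by blast
  then have "Pos (of_int j * eps - u)" using Pos_total[of "u - of_int j * eps"] by simp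
  moreover have "j \<ge> 0"
  proof (rule ccontr)
    assume "\<not> j \<ge> 0"
    then have "Pos (of_int (- j) * eps)" using Pos_of_int_eps[of "- j"] by simp
    from Pos_add[OF assms this] show False using j by simp
  qed
  ultimately show "\<exists>N. null Pos (u - of_int (int N) * eps)"
    using bounded_multiple[OF assms, of "nat j"] by auto
qed

lemma (in discrete_group) null_multiples_eq:
  "null Pos (x - of_int (int i) * eps) \<Longrightarrow> null Pos (x - of_int (int j) * eps) \<Longrightarrow> i = j"
proof -
  assume "null Pos (x - of_int (int i) * eps)" "null Pos (x - of_int (int j) * eps)"
  from null_diff[OF this(2,1)] have "null Pos (of_int (int i - int j) * eps)" by (simp add: algebra_simps)
  then show "i = j" unfolding null_eps by simp
qed

context chain_rep
begin

lemma infinite_carrier: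
  assumes "\<And>j. Pos (u - of_int j * eps)" shows "infinite K"
proof -
  have "\<exists>x\<in>K. null Pos (emb x - of_int (int j) * eps)" for j
    by (rule emb_surj[OF _ assms]) (simp only: Pos_of_int_eps of_nat_0_le_iff)
  then obtain f where f: "\<And>j. f j \<in> K" "\<And>j. null Pos (emb (f j) - of_int (int j) * eps)" by metis
  have "inj f" using f(2) null_multiples_eq by (metis injI)
  then show ?thesis using f(1) by (metis finite_subset image_subsetI infinite_UNIV_nat range_inj_infinite)
qed

lemma iso_nat_chain:
  assumes u: "null Pos (u - of_int (int N) * eps)"
  shows "\<exists>h. h \<in> mv_iso A (nat_chain N)"
proof -
  define h where "h x = (THE j. null Pos (emb x - of_int (int j) * eps))" for x
  have h_eq: "h x = j" if "null Pos (emb x - of_int (int j) * eps)" for x j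
    unfolding h_def using that null_multiples_eq by blast
  have uN: "Pos (of_int (int N) * eps - u)" "Pos (u - of_int (int N) * eps)"
    using u by (simp_all add: null_def)
  have h: "null Pos (emb x - of_int (int (h x)) * eps) \<and> h x \<le> N" if x: "x \<in> K" for x
  proof -
    have "Pos (of_int (int N) * eps - emb x)" using Pos_add[OF emb_le_unit[OF x] uN(1)] by simp
    then obtain j where "j \<le> N" "null Pos (emb x - of_int (int j) * eps)"
      using bounded_multiple emb_nonneg[OF x] by blast
    then show ?thesis using h_eq by simp
  qed
  have "bij_betw h K {..N}"
  proof (rule bij_betw_imageI)
    show "inj_on h K"
    proof (rule inj_onI)
      fix x y assume xy: "x \<in> K" "y \<in> K" "h x = h y"
      then have "null Pos (emb x - of_int (int (h x)) * eps)" "null Pos (emb y - of_int (int (h x)) * eps)"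
        using h by metis+
      from null_diff[OF this] show "x = y" using emb_inj xy by simp
    qed
    show "h ` K = {..N}"
    proof
      show "{..N} \<subseteq> h ` K"
      proof
        fix j assume "j \<in> {..N}"
        then have "Pos (of_int (int N - int j) * eps)" by (simp add: Pos_of_int_eps del: of_int_diff)
        from Pos_add[OF uN(2) this] have "Pos (u - of_int (int j) * eps)" by (simp add: algebra_simps)
        then obtain x where "x \<in> K" "null Pos (emb x - of_int (int j) * eps)"
          using emb_surj Pos_of_int_eps[of "int j"] by auto
        then show "j \<in> h ` K" using h_eq by force
      qed
    qed (use h in auto)
  qed
  moreover have "h nought = 0" using h_eq[of nought 0] emb_zero by simp
  moreover have "h (\<sim> x) = N - h x" if x: "x \<in> K" for x
  proof (rule h_eq)
    have hx: "null Pos (emb x - of_int (int (h x)) * eps)" "h x \<le> N" using h x by auto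
    show "null Pos (emb (\<sim> x) - of_int (int (N - h x)) * eps)"
      using null_add[OF emb_neg[OF x] null_diff[OF u hx(1)]] hx(2)
      by (simp add: of_nat_diff algebra_simps)
  qed
  moreover have "h (x \<boxplus> y) = min (h x + h y) N" if xy: "x \<in> K" "y \<in> K" for x y
  proof -
    have hx: "null Pos (emb x - of_int (int (h x)) * eps)" and hy: "null Pos (emb y - of_int (int (h y)) * eps)"
      using h xy by auto
    have d: "null Pos ((u - (emb x + emb y)) - of_int (int N - int (h x + h y)) * eps)"
      using null_diff[OF u null_add[OF hx hy]] by (simp add: algebra_simps)
    show ?thesis
    proof (cases "h x + h y \<le> N")
      case True
      then have "Pos (u - (emb x + emb y))"
        using Pos_null[OF d] Pos_of_int_eps[of "int N - int (h x + h y)"] by linarith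
      then have "null Pos (emb (x \<boxplus> y) - (emb x + emb y))" using emb_plus xy by blast
      from null_add[OF this null_add[OF hx hy]] have "h (x \<boxplus> y) = h x + h y"
        by (intro h_eq) (simp add: algebra_simps)
      then show ?thesis using True by simp
    next
      case False
      then have "\<not> Pos (u - (emb x + emb y))"
        using Pos_null[OF d] Pos_of_int_eps[of "int N - int (h x + h y)"] by linarith
      then have "Pos (emb x + emb y - u)" using Pos_total[of "u - (emb x + emb y)"] by simp
      then have "null Pos (emb (x \<boxplus> y) - u)" using emb_plus_top xy by blast
      from null_add[OF this u] have "h (x \<boxplus> y) = N" by (intro h_eq) simp
      then show ?thesis using False by simp
    qed
  qed
  ultimately have "h \<in> mv_iso A (nat_chain N)" by (simp add: mv_iso_def)
  then show ?thesis by blast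
qed

end

lemma exists_least:
  assumes "finite S" "S \<noteq> {}" "\<And>x y. x \<in> S \<Longrightarrow> y \<in> S \<Longrightarrow> r x y \<or> r y x"
    "\<And>x y z. x \<in> S \<Longrightarrow> y \<in> S \<Longrightarrow> z \<in> S \<Longrightarrow> r x y \<Longrightarrow> r y z \<Longrightarrow> r x z"
  shows "\<exists>x\<in>S. \<forall>y\<in>S. r x y"
  using assms
proof (induction rule: finite_ne_induct)
  case (singleton x)
  then show ?case by blast
next
  case (insert x S)
  note total = insert.prems(1) and trans = insert.prems(2)
  have "\<exists>m\<in>S. \<forall>y\<in>S. r m y"
  proof (rule insert.IH)
    show "r a b \<or> r b a" if "a \<in> S" "b \<in> S" for a b using total that by simp
    show "r a c" if "a \<in> S" "b \<in> S" "c \<in> S" "r a b" "r b c" for a b c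
      using trans[of a b c] that by simp
  qed
  then obtain m where m: "m \<in> S" "\<forall>y\<in>S. r m y" by blast
  show ?case
  proof (cases "r m x")
    case True
    then show ?thesis using m by auto
  next
    case False
    then have "r x m" "r x x" using total[of m x] total[of x x] m by auto
    moreover have "r x y" if "y \<in> S" for y using trans[of x m y] m that \<open>r x m\<close> by simp
    ultimately show ?thesis by auto
  qed
qed

text \<open>The least nonzero element makes the Chang group discrete. Its unit cannot exceed all
  multiples of the atom, since these would be infinitely many elements of the chain. The one-element
  chain is treated apart, as Chang's construction needs 0 and 1 to differ.\<close>

theorem finite_chain_iso:
  assumes C: "mv_chain C" and fin: "finite (carrier C)"
  shows "\<exists>N h. h \<in> mv_iso C (nat_chain N)"
proof (cases "mv_zero C = mv_one C")
  case True
  interpret mv_algebra C using C by (rule chain_algebra)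
  have "x = nought" if "x \<in> K" for x using plus_one[OF that] plus_zero[OF that] True by simp
  then have "K = {nought}" using closed by blast
  then have "(\<lambda>_. 0) \<in> mv_iso C (nat_chain 0)" by (auto simp: mv_iso_def bij_betw_def)
  then show ?thesis by blast
next
  case False
  interpret mv_algebra C using C by (rule chain_algebra)
  interpret nontrivial_chain C by unfold_locales (use False chain_total[OF C] in auto)
  have "\<exists>e\<in>K - {nought}. \<forall>x\<in>K - {nought}. mv_le C e x"
  proof (rule exists_least)
    show "K - {nought} \<noteq> {}" using False one_closed by auto
    show "mv_le C x y \<or> mv_le C y x" if "x \<in> K - {nought}" "y \<in> K - {nought}" for x y
      using total that by blast
    show "mv_le C x z" if "x \<in> K - {nought}" "y \<in> K - {nought}" "z \<in> K - {nought}"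
      "mv_le C x y" "mv_le C y z" for x y z
      using le_trans[of x y z] that by blast
  qed (use fin in simp)
  then obtain e where "mv_atom C e" unfolding mv_atom_def by blast
  then obtain Pos :: "((int \<times> 'a) multiset \<Rightarrow>\<^sub>0 int) \<Rightarrow> bool" and eps u emb where rep: "chain_rep Pos eps C u emb"
    by (rule chang_rep)
  interpret R: chain_rep Pos eps C u emb by fact
  show ?thesis using R.finite_or_infinite[OF R.Pos_u] R.infinite_carrier fin R.iso_nat_chain by blast
qed

section \<open>Regular chains and division with remainder\<close>

text \<open>Every element is m u + x with x in the chain, and u itself comes from the chain, so
  remainders are only needed there.\<close>

lemma (in chain_rep) zgroupI:
  assumes gen: "\<And>g. \<exists>m. \<exists>x\<in>K. null Pos (g - of_int m * u - emb x)"
    and div: "\<And>k y. k \<ge> 1 \<Longrightarrow> y \<in> K \<Longrightarrow> \<exists>r. Div Pos k (emb y - of_int r * eps)"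
  shows "zgroup Pos eps"
proof
  fix k g assume k: "(k::int) \<ge> 1"
  obtain m x where x: "x \<in> K" "null Pos (g - of_int m * u - emb x)" using gen by blast
  obtain r where r: "Div Pos k (emb unity - of_int r * eps)" using div k one_closed by blast
  obtain s where s: "Div Pos k (emb x - of_int s * eps)" using div k x by blast
  have "null Pos ((g - of_int (m * r + s) * eps) -
      (of_int m * (emb unity - of_int r * eps) + (emb x - of_int s * eps)))"
    using null_diff[OF x(2) null_mult[OF emb_one, of m]] by (simp add: algebra_simps)
  then have "Div Pos k (g - of_int (m * r + s) * eps)"
    using Div_null Div_add[OF Div_mult[OF r] s] by blast
  then show "\<exists>r. Div Pos k (g - of_int r * eps)" by blast
qed

text \<open>Regularity is applied to the k consecutive elements g + eps, ..., g + k eps. The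
  multiple k.x that it provides between the first and the last is one of them. The room of (k + 1)
  eps below u ensures that k.x is not truncated.\<close>

lemma (in chain_rep) regular_division_low:
  assumes reg: "mv_regular A" and k: "k \<ge> 2"
    and g: "Pos g" "Pos (u - g - of_int (int k + 1) * eps)"
  shows "\<exists>r. Div Pos (int k) (g - of_int r * eps)"
proof -
  have "\<exists>x\<in>K. null Pos (emb x - (g + of_int (int i) * eps))" if "i \<le> k" for i
  proof (rule emb_surj)
    show "Pos (g + of_int (int i) * eps)" by (rule Pos_add) (simp_all add: g Pos_of_int_eps del: of_int_of_nat_eq)
    have "Pos (of_int (int k + 1 - int i) * eps)" unfolding Pos_of_int_eps using that by simp
    from Pos_add[OF g(2) this] show "Pos (u - (g + of_int (int i) * eps))" by (simp add: algebra_simps)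
  qed
  then obtain s where s: "\<And>i. i \<le> k \<Longrightarrow> s i \<in> K"
    "\<And>i. i \<le> k \<Longrightarrow> null Pos (emb (s i) - (g + of_int (int i) * eps))" by metis
  have less: "mv_less A (s i) (s j)" if "i < j" "j \<le> k" for i j
  proof -
    have "null Pos ((emb (s i) - emb (s j)) - of_int (int i - int j) * eps)"
      using null_diff[OF s(2)[of i] s(2)[of j]] that by (simp add: algebra_simps)
    then have "\<not> Pos (emb (s i) - emb (s j))" using Pos_null Pos_of_int_eps that by (metis diff_ge_0_iff_ge not_le of_nat_less_iff)
    then show ?thesis using less_emb s that by simp
  qed
  have "\<not> Pos (- emb (s 1))"
  proof
    assume "Pos (- emb (s 1))"
    moreover have "null Pos (- emb (s 1) - (- (g + eps)))" using null_minus[OF s(2)[of 1]] k by (simp add: algebra_simps)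
    ultimately have "Pos (- (g + eps))" using Pos_null by blast
    from Pos_add[OF this g(1)] show False using eps_pos by simp
  qed
  moreover have "Pos (emb nought - emb (s 1)) \<longleftrightarrow> Pos (- emb (s 1))" by (rule Pos_null) (simp add: emb_zero)
  ultimately have "mv_less A nought (s 1)" using less_emb closed s k by simp
  then have "\<exists>x\<in>K. s 1 \<preceq> mv_mult A k x \<and> mv_mult A k x \<preceq> s k \<and> mv_increasing_multiples A k x"
    using reg[unfolded mv_regular_def, rule_format, of k s] k s less by auto
  then obtain x where x: "x \<in> K" and le: "s 1 \<preceq> mv_mult A k x" "mv_mult A k x \<preceq> s k" by blast
  let ?m = "mv_mult A k x"
  have m: "?m \<in> K" using mult_closed x by blast
  have sk: "null Pos (emb (s k) - (g + of_int (int k) * eps))" and s1: "null Pos (emb (s 1) - (g + eps))"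
    using s(2)[of k] s(2)[of 1] k by auto
  have up: "Pos (g + of_int (int k) * eps - emb ?m)"
  proof -
    have "Pos (emb (s k) - emb ?m)" using le le_emb m s by simp
    moreover have "null Pos ((emb (s k) - emb ?m) - (g + of_int (int k) * eps - emb ?m))" using sk by (simp add: algebra_simps)
    ultimately show ?thesis using Pos_null by blast
  qed
  have low: "Pos (emb ?m - (g + eps))"
  proof -
    have "Pos (emb ?m - emb (s 1))" using le le_emb m s k by simp
    moreover have "null Pos ((emb ?m - emb (s 1)) - (emb ?m - (g + eps)))" using null_minus[OF s1] by (simp add: algebra_simps)
    ultimately show ?thesis using Pos_null by blast
  qed
  have "Pos (u - of_int (int k) * emb x)"
  proof (rule ccontr)
    assume "\<not> ?thesis"
    then have "Pos (of_int (int k) * emb x - u)" using Pos_total[of "u - of_int (int k) * emb x"] by simp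
    then have "null Pos (emb ?m - u)" using emb_mult[OF x] by blast
    then have "Pos (emb ?m - u)" by (simp add: null_def)
    from Pos_add[OF Pos_add[OF this up] g(2)] have "Pos (- eps)" by (simp add: algebra_simps)
    then show False using eps_pos by simp
  qed
  then have n: "null Pos (emb ?m - of_int (int k) * emb x)" using emb_mult[OF x] by blast
  have "Pos (emb ?m - g)" using Pos_add[OF low Pos_eps1] by (simp add: algebra_simps)
  moreover have "Pos (of_int (int k) * eps - (emb ?m - g))" using up by (simp add: algebra_simps)
  ultimately obtain j where j: "null Pos ((emb ?m - g) - of_int (int j) * eps)" using bounded_multiple by blast
  have "null Pos ((g - of_int (- int j) * eps) - of_int (int k) * emb x)"
    using null_diff[OF n j] by (simp add: algebra_simps)
  then show ?thesis unfolding Div_def by blast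
qed

lemma (in chain_rep) regular_zgroup:
  assumes gen: "\<And>g. \<exists>m. \<exists>x\<in>K. null Pos (g - of_int m * u - emb x)"
    and reg: "mv_regular A" and inf: "\<And>j. Pos (u - of_int j * eps)"
  shows "zgroup Pos eps"
proof (rule zgroupI[OF gen])
  fix k y assume k: "(k::int) \<ge> 1" and y: "y \<in> K"
  show "\<exists>r. Div Pos k (emb y - of_int r * eps)"
  proof (cases "k = 1")
    case True
    then show ?thesis using Div_self[of 1 "emb y"] by (intro exI[of _ 0]) simp
  next
    case False
    define n where "n = nat k"
    have n: "n \<ge> 2" "k = int n" using k False by (auto simp: n_def)
    show ?thesis
    proof (cases "Pos (u - emb y - of_int (k + 1) * eps)")
      case True
      then show ?thesis using regular_division_low[OF reg n(1) emb_nonneg[OF y]] n by simp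
    next
      case F: False
      \<comment> \<open>Close to the top y is moved down by a multiple of eps. As u - y \<le> (k +
        1) eps and u \<ge> (3 k + 3) eps, the shifted element is still nonnegative, and it has the
        required distance to u.\<close>
      define g where "g = emb y - of_int (2 * k + 2) * eps"
      have "Pos (of_int (k + 1) * eps - (u - emb y))"
        using F Pos_total[of "u - emb y - of_int (k + 1) * eps"] by simp
      from Pos_add[OF this inf[of "3 * k + 3"]] have "Pos g" by (simp add: g_def algebra_simps)
      moreover have "Pos (u - g - of_int (k + 1) * eps)"
      proof -
        have "Pos (of_int (k + 1) * eps)" unfolding Pos_of_int_eps using k by simp
        from Pos_add[OF emb_le_unit[OF y] this] show ?thesis by (simp add: g_def algebra_simps)
      qed
      ultimately obtain r where "Div Pos k (g - of_int r * eps)"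
        using regular_division_low[OF reg n(1), of g] n by auto
      then have "Div Pos k (emb y - of_int (2 * k + 2 + r) * eps)" by (simp add: g_def algebra_simps)
      then show ?thesis by blast
    qed
  qed
qed

text \<open>Division y = k x + r e stated without the group. If the sum for r - 1 is not yet y, then
  the sum for r is not truncated. Remainders run from 1 to k so that r - 1 makes sense, hence y has
  to be nonzero.\<close>

definition divisible_chain :: "'a mv \<Rightarrow> 'a \<Rightarrow> nat \<Rightarrow> bool" where
  "divisible_chain A e k \<longleftrightarrow> (\<forall>y\<in>carrier A. y \<noteq> mv_zero A \<longrightarrow> (\<exists>x\<in>carrier A. \<exists>r\<in>{1..k}.
     mv_plus A (mv_mult A k x) (mv_mult A r e) = y \<and> mv_plus A (mv_mult A k x) (mv_mult A (r - 1) e) \<noteq> y))"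

context chain_rep
begin

lemma emb_plus_lt: "x \<in> K \<Longrightarrow> y \<in> K \<Longrightarrow> x \<boxplus> y \<noteq> unity \<Longrightarrow> null Pos (emb (x \<boxplus> y) - (emb x + emb y))"
proof (rule emb_plus)
  assume xy: "x \<in> K" "y \<in> K" "x \<boxplus> y \<noteq> unity"
  show "Pos (u - (emb x + emb y))"
  proof (rule ccontr)
    assume "\<not> ?thesis"
    then have "Pos (emb x + emb y - u)" using Pos_total[of "u - (emb x + emb y)"] by simp
    from null_diff[OF emb_plus_top[OF xy(1,2) this] emb_one] show False
      using emb_inj closed xy by simp
  qed
qed

lemma emb_mult_lt: "x \<in> K \<Longrightarrow> mv_mult A k x \<noteq> unity \<Longrightarrow> null Pos (emb (mv_mult A k x) - of_int (int k) * emb x)"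
proof -
  assume x: "x \<in> K" "mv_mult A k x \<noteq> unity"
  have "Pos (u - of_int (int k) * emb x)"
  proof (rule ccontr)
    assume "\<not> ?thesis"
    then have "Pos (of_int (int k) * emb x - u)" using Pos_total[of "u - of_int (int k) * emb x"] by simp
    then have "null Pos (emb (mv_mult A k x) - u)" using emb_mult[OF x(1)] by blast
    from null_diff[OF this emb_one] show False using emb_inj mult_closed closed x by simp
  qed
  then show ?thesis using emb_mult[OF x(1)] by blast
qed

text \<open>The sum for r - 1 is not 1, as otherwise adding e would not change it and it would equal
  y. Hence it is at most u - eps, and the last addition of e is exact.\<close>

lemma exact_division:
  assumes e: "e \<in> K" "null Pos (emb e - eps)" and x: "x \<in> K" and r: "r \<ge> 1"
    and y: "mv_mult A k x \<boxplus> mv_mult A r e = y" "mv_mult A k x \<boxplus> mv_mult A (r - 1) e \<noteq> y"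
  shows "null Pos (emb y - (of_int (int k) * emb x + of_int (int r) * eps))"
proof -
  let ?a = "mv_mult A k x" and ?c = "mv_mult A (r - 1) e"
  let ?b = "?a \<boxplus> ?c"
  have cl: "?a \<in> K" "?c \<in> K" "?b \<in> K" using mult_closed x e closed by auto
  have yb: "y = ?b \<boxplus> e" using y(1) r plus_assoc[OF cl(1,2) e(1)] by (cases r) auto
  have b1: "?b \<noteq> unity" using yb y(2) one_plus e by metis
  have a1: "?a \<noteq> unity" "?c \<noteq> unity" using b1 one_plus plus_one cl by metis+
  have "null Pos (emb ?a - of_int (int k) * emb x)" using emb_mult_lt[OF x a1(1)] .
  moreover have "null Pos (emb ?c - of_int (int (r - 1)) * eps)"
    using null_add[OF emb_mult_lt[OF e(1) a1(2)] null_mult[OF e(2), of "int (r - 1)"]]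
    by (simp add: algebra_simps)
  ultimately have "null Pos ((emb ?b - (emb ?a + emb ?c)) + ((emb ?a - of_int (int k) * emb x) + (emb ?c - of_int (int (r - 1)) * eps)))"
    using null_add emb_plus_lt[OF cl(1,2) b1] by blast
  then have nb: "null Pos (emb ?b - (of_int (int k) * emb x + of_int (int (r - 1)) * eps))"
    by (simp add: algebra_simps)
  have "\<not> Pos (emb ?b - u)"
  proof
    assume "Pos (emb ?b - u)"
    then have "null Pos (emb ?b - u)" using emb_le_unit[OF cl(3)] by (simp add: null_def)
    from null_diff[OF this emb_one] show False using emb_inj cl closed b1 by simp
  qed
  then have P: "Pos (u - emb ?b - eps)" using not_Pos[of "emb ?b - u"] by simp
  have "Pos (u - (emb ?b + emb e)) \<longleftrightarrow> Pos (u - emb ?b - eps)"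
    by (rule Pos_null) (use null_minus[OF e(2)] in simp)
  then have "null Pos (emb y - (emb ?b + emb e))" unfolding yb using emb_plus[OF cl(3) e(1)] P by blast
  from null_add[OF this null_add[OF nb e(2)]] show ?thesis
    using r by (simp add: of_nat_diff algebra_simps)
qed

lemma divisible_zgroup:
  assumes gen: "\<And>g. \<exists>m. \<exists>x\<in>K. null Pos (g - of_int m * u - emb x)"
    and e: "e \<in> K" "null Pos (emb e - eps)" and div: "\<And>k. k \<ge> 1 \<Longrightarrow> divisible_chain A e k"
  shows "zgroup Pos eps"
proof (rule zgroupI[OF gen])
  fix k y assume k: "(k::int) \<ge> 1" and y: "y \<in> K"
  show "\<exists>r. Div Pos k (emb y - of_int r * eps)"
  proof (cases "y = nought")
    case True
    have "Div Pos k (emb nought)" using Div_null[of "emb nought" 0] emb_zero Div_self[of k 0] by simp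
    then show ?thesis using True by (intro exI[of _ 0]) simp
  next
    case False
    then obtain x r where x: "x \<in> K" "r \<in> {1..nat k}" "mv_mult A (nat k) x \<boxplus> mv_mult A r e = y"
      "mv_mult A (nat k) x \<boxplus> mv_mult A (r - 1) e \<noteq> y"
      using div[of "nat k"] k y unfolding divisible_chain_def by fastforce
    then have "null Pos (emb y - (of_int k * emb x + of_int (int r) * eps))"
      using exact_division[OF e x(1) _ x(3,4)] k by simp
    then have "null Pos ((emb y - of_int (int r) * eps) - of_int k * emb x)" by (simp add: algebra_simps)
    then show ?thesis unfolding Div_def by blast
  qed
qed

end

lemma nat_chain_divisible:
  assumes "k \<ge> 1" "N \<ge> 1" shows "divisible_chain (nat_chain N) 1 k"
  unfolding divisible_chain_def
proof (intro ballI impI)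
  fix y assume y: "y \<in> carrier (nat_chain N)" "y \<noteq> mv_zero (nat_chain N)"
  \<comment> \<open>Euclidean division of y - 1 instead of y gives a remainder between 1 and
    k.\<close>
  define x where "x = (y - 1) div k"
  define r where "r = (y - 1) mod k + 1"
  have e: "k * x + r = y" using y by (simp add: x_def r_def)
  have "x \<le> k * x" using mult_le_mono1[OF assms(1), of x] by simp
  moreover have "y \<le> N" using y by simp
  ultimately have "x \<le> N" using e by linarith
  moreover have "r \<in> {1..k}" using assms by (simp add: r_def Suc_leI)
  ultimately show "\<exists>x\<in>carrier (nat_chain N). \<exists>r\<in>{1..k}.
      mv_plus (nat_chain N) (mv_mult (nat_chain N) k x) (mv_mult (nat_chain N) r 1) = y \<and>
      mv_plus (nat_chain N) (mv_mult (nat_chain N) k x) (mv_mult (nat_chain N) (r - 1) 1) \<noteq> y"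
    using e y by (intro bexI[of _ x] bexI[of _ r]) (auto simp: nat_chain_mult min_def)
qed

text \<open>A strictly increasing sequence of k elements spans at least (k - 1) eps, so between its
  ends lies an element s 1 + r eps with 0 \<le> r < k that is divisible by k.\<close>

lemma zgroup_regular:
  assumes "chain_rep Pos eps A u emb" "zgroup Pos eps" shows "mv_regular A"
  unfolding mv_regular_def
proof (intro allI impI)
  interpret chain_rep Pos eps A u emb by fact
  interpret Z: zgroup Pos eps by fact
  fix k :: nat and s :: "nat \<Rightarrow> _"
  assume k: "2 \<le> k" and *: "(\<forall>i\<in>{1..k}. s i \<in> carrier A) \<and> mv_less A (mv_zero A) (s 1) \<and>
    (\<forall>i\<in>{1..<k}. mv_less A (s i) (s (i + 1)))"
  have sK: "s i \<in> K" if "i \<ge> 1" "i \<le> k" for i using * that by auto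
  have inc: "Pos (emb (s (i + 1)) - emb (s 1) - of_int (int i) * eps)" if "i < k" for i
    using that
  proof (induction i)
    case 0
    then show ?case using Pos_0 by simp
  next
    case (Suc i)
    have "mv_less A (s (i + 1)) (s (i + 2))" using * Suc.prems by auto
    then have "\<not> Pos (emb (s (i + 1)) - emb (s (i + 2)))" using less_emb sK Suc.prems by simp
    then have "Pos (emb (s (i + 2)) - emb (s (i + 1)) - eps)"
      using not_Pos[of "emb (s (i + 1)) - emb (s (i + 2))"] by simp
    from Pos_add[OF this Suc.IH] Suc.prems show ?case by (simp add: algebra_simps)
  qed
  have pos: "\<not> Pos (- emb (s 1))"
  proof -
    have "Pos (emb nought - emb (s 1)) \<longleftrightarrow> Pos (- emb (s 1))" by (rule Pos_null) (simp add: emb_zero)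
    then show ?thesis using * less_emb[of nought "s 1"] sK[of 1] k closed by simp
  qed
  \<comment> \<open>The remainder is taken for - s 1, so that adding r eps to s 1 gives a multiple
    of k.\<close>
  obtain r z where r: "0 \<le> r" "r < int k" and z: "null Pos (- emb (s 1) - of_int r * eps - of_int (int k) * z)"
    using Z.remainder[of "int k" 0 "- emb (s 1)"] k unfolding Div_def by auto
  define y where "y = - z"
  have y: "null Pos (of_int (int k) * y - (emb (s 1) + of_int r * eps))"
  proof -
    have "of_int (int k) * y - (emb (s 1) + of_int r * eps) = - emb (s 1) - of_int r * eps - of_int (int k) * z"
      by (simp add: y_def)
    then show ?thesis using z by (simp only:)
  qed
  have low: "Pos (of_int (int k) * y - emb (s 1))"
  proof -
    have "Pos (of_int (int k) * y - (emb (s 1) + of_int r * eps))" using y by (simp add: null_def)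
    moreover have "Pos (of_int r * eps)" using r Pos_of_int_eps by blast
    ultimately have "Pos (of_int (int k) * y - (emb (s 1) + of_int r * eps) + of_int r * eps)" by (rule Pos_add)
    then show ?thesis by (simp add: algebra_simps)
  qed
  have up: "Pos (emb (s k) - of_int (int k) * y)"
  proof -
    have 1: "Pos (emb (s 1) + of_int r * eps - of_int (int k) * y)" using null_minus[OF y] by (simp add: null_def)
    have 2: "Pos (of_int (int (k - 1) - r) * eps)" unfolding Pos_of_int_eps using r k by simp
    have "Pos (emb (s k) - emb (s 1) - of_int (int (k - 1)) * eps)" using inc[of "k - 1"] k by simp
    from Pos_add[OF Pos_add[OF 1 2] this] show ?thesis by (simp add: algebra_simps)
  qed
  have kpos: "int k > 0" using k by simp
  have ypos: "\<not> Pos (- y)"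
  proof
    assume "Pos (- y)"
    then have "Pos (of_int (int k) * (- y))" by (intro Pos_mult) simp_all
    from Pos_add[OF this low] show False using pos by simp
  qed
  then have Py: "Pos y" using Pos_total by blast
  have uk: "Pos (u - of_int (int k) * y)" using Pos_add[OF up emb_le_unit[OF sK[of k]]] k by simp
  have uy: "Pos (u - of_int j * y)" if "j \<le> int k" for j
  proof -
    have "Pos (of_int (int k - j) * y)" using Pos_mult Py that by (metis diff_ge_0_iff_ge)
    from Pos_add[OF uk this] show ?thesis by (simp add: algebra_simps)
  qed
  have "Pos (u - y)" using uy[of 1] k by simp
  then obtain x where x: "x \<in> K" "null Pos (emb x - y)" using emb_surj Py by blast
  have nk: "null Pos (of_int j * emb x - of_int j * y)" for j
    using null_mult[OF x(2), of j] by (simp add: algebra_simps)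
  have "Pos (u - of_int (int k) * emb x) \<longleftrightarrow> Pos (u - of_int (int k) * y)"
    by (rule Pos_null) (use null_minus[OF nk[of "int k"]] in simp)
  then have "null Pos (emb (mv_mult A k x) - of_int (int k) * emb x)" using emb_mult[OF x(1)] uk by blast
  from null_add[OF this nk[of "int k"]]
  have m: "null Pos (emb (mv_mult A k x) - of_int (int k) * y)" by simp
  have "s 1 \<preceq> mv_mult A k x"
  proof -
    have "Pos (emb (mv_mult A k x) - emb (s 1)) \<longleftrightarrow> Pos (of_int (int k) * y - emb (s 1))"
      by (rule Pos_null) (use m in simp)
    then show ?thesis using low le_emb sK[of 1] mult_closed x k by simp
  qed
  moreover have "mv_mult A k x \<preceq> s k"
  proof -
    have "Pos (emb (s k) - emb (mv_mult A k x)) \<longleftrightarrow> Pos (emb (s k) - of_int (int k) * y)"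
      by (rule Pos_null) (use null_minus[OF m] in simp)
    then show ?thesis using up le_emb sK[of k] mult_closed x k by simp
  qed
  moreover have "mv_increasing_multiples A k x"
  proof -
    have "Pos (- emb x) \<longleftrightarrow> Pos (- y)" by (rule Pos_null) (use null_minus[OF x(2)] in simp)
    moreover have "\<not> Pos (of_int (int k - 1) * emb x - u)"
    proof
      assume P: "Pos (of_int (int k - 1) * emb x - u)"
      have "null Pos ((of_int (int k - 1) * emb x - u) - (of_int (int k - 1) * y - u))" using nk[of "int k - 1"] by simp
      then have "Pos (of_int (int k - 1) * y - u)" using P Pos_null by blast
      from Pos_add[OF this uk] show False using ypos by (simp add: algebra_simps)
    qed
    ultimately show ?thesis using increasing_multiples_emb[OF x(1)] k ypos by simp
  qed
  ultimately show "\<exists>x\<in>carrier A. mv_le A (s 1) (mv_mult A k x) \<and> mv_le A (mv_mult A k x) (s k) \<and>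
      mv_increasing_multiples A k x" using x by blast
qed

section \<open>The conditions D and the residues of the unit\<close>

text \<open>One remainder modulo M! serves all moduli up to M at once, and the window beyond
  \<bar>M\<bar> makes it large enough for \<open>approx_infinite\<close>.\<close>

lemma (in zgroup) exists_common_remainder:
  obtains N where "N > M" "N \<ge> 0" "\<And>m. m \<in> {1..M} \<Longrightarrow> Div Pos m (x - of_int N * eps)"
proof -
  define Q :: int where "Q = fact (nat M)"
  have Q: "Q \<ge> 1" by (simp add: Q_def fact_ge_1)
  obtain N where N: "N \<in> {\<bar>M\<bar> + 1..<\<bar>M\<bar> + 1 + Q}" "Div Pos Q (x - of_int N * eps)"
    using remainder[OF Q] by blast
  have "m dvd Q" if "m \<in> {1..M}" for m
  proof -
    have "int (nat m) dvd int (fact (nat M))" unfolding int_dvd_int_iff using that by (intro dvd_fact) auto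
    then show ?thesis using that by (simp add: Q_def)
  qed
  then show ?thesis using N by (intro that[of N] Div_dvd[OF N(2)]) auto
qed

definition same_residues where
  "same_residues Pos eps u Pos' eps' u' \<longleftrightarrow>
    (\<forall>m\<ge>1. \<forall>r. Div Pos m (u - of_int r * eps) \<longleftrightarrow> Div Pos' m (u' - of_int r * eps'))"

lemma same_residues_sym: "same_residues Pos eps u Pos' eps' u' \<Longrightarrow> same_residues Pos' eps' u' Pos eps u"
  by (simp add: same_residues_def)

lemma same_residues_approx:
  assumes A: "zgroup Pos eps" and B: "zgroup Pos' eps'"
    and inf: "\<And>j. Pos (u - of_int j * eps)" "\<And>j. Pos' (u' - of_int j * eps')"
    and same: "same_residues Pos eps u Pos' eps' u'"
  obtains N where "approx Pos eps u M N" "approx Pos' eps' u' M N"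
proof -
  interpret A: zgroup Pos eps by fact
  interpret B: zgroup Pos' eps' by fact
  obtain N where N: "N > M" "\<And>m. m \<in> {1..M} \<Longrightarrow> Div Pos m (u - of_int N * eps)"
    using A.exists_common_remainder by blast
  then have "Div Pos' m (u' - of_int N * eps')" if "m \<in> {1..M}" for m
    using same that unfolding same_residues_def by auto
  then show ?thesis using that A.approx_infinite[OF inf(1) N] B.approx_infinite[OF inf(2) N(1)] by blast
qed

section \<open>The conditions D expressed in the preordered group\<close>

definition D_rep where
  "D_rep Pos eps A u emb q k \<longleftrightarrow> (\<exists>x\<in>carrier A. mv_increasing_multiples A (q - 1) x
     \<and> (\<exists>j. null Pos (of_int (int q) * emb x - of_int (int k) * eps - of_int j * u)))"

text \<open>From q x = k eps + j u and 0 \<le> x \<le> u the multiple j of the infinitely large u is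
  confined to [- q, q]. The bound turns D into a condition on forms with bounded
  coefficients.\<close>

lemma (in chain_rep) D_coefficient_bound:
  assumes inf: "\<And>j. Pos (u - of_int j * eps)" and x: "x \<in> K"
    and n: "null Pos (of_int q * emb x - of_int k * eps - of_int j * u)" and q: "q \<ge> 0"
  shows "\<bar>j\<bar> \<le> q"
proof (rule ccontr)
  assume "\<not> \<bar>j\<bar> \<le> q"
  then consider "j > q" | "j < 0" by linarith
  then show False
  proof cases
    case 1
    have 1: "Pos (of_int q * (u - emb x))" "Pos (of_int (j - q - 1) * u)"
      using Pos_mult[OF q emb_le_unit[OF x]] Pos_mult[OF _ Pos_u, of "j - q - 1"] 1 by auto
    have "Pos (of_int q * emb x - of_int k * eps - of_int j * u)" using n by (simp add: null_def)
    from Pos_add[OF Pos_add[OF this inf[of "1 - k"]] Pos_add[OF 1]] have "Pos (- eps)"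
      by (simp add: algebra_simps)
    then show False using eps_pos by simp
  next
    case 2
    have 1: "Pos (of_int q * emb x)" "Pos (of_int (- j - 1) * u)"
      using Pos_mult[OF q emb_nonneg[OF x]] Pos_mult[OF _ Pos_u, of "- j - 1"] 2 by auto
    have "Pos (- (of_int q * emb x - of_int k * eps - of_int j * u))" using n by (simp add: null_def)
    from Pos_add[OF Pos_add[OF this inf[of "k + 1"]] Pos_add[OF 1]] have "Pos (- eps)"
      by (simp add: algebra_simps)
    then show False using eps_pos by simp
  qed
qed

text \<open>For a fixed j the condition on x consists of inequalities between bounded forms, so a
  single move of the game carries x over. This covers small q as well, where D is not a mere
  divisibility of u + k eps.\<close>

lemma D_rep_transfer:
  assumes A: "chain_rep Pos eps A u emb" "zgroup Pos eps"
    and B: "chain_rep Pos' eps' B u' emb'" "zgroup Pos' eps'"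
    and inf: "\<And>j. Pos (u - of_int j * eps)" "\<And>j. Pos' (u' - of_int j * eps')"
    and same: "same_residues Pos eps u Pos' eps' u'" and q: "q \<ge> 2" "k < q"
    and D: "D_rep Pos eps A u emb q k"
  shows "D_rep Pos' eps' B u' emb' q k"
proof -
  interpret A: chain_rep Pos eps A u emb by fact
  interpret B: chain_rep Pos' eps' B u' emb' by fact
  obtain x j where x: "x \<in> carrier A" "mv_increasing_multiples A (q - 1) x"
    and j: "null Pos (of_int (int q) * emb x - of_int (int k) * eps - of_int j * u)"
    using D unfolding D_rep_def by blast
  have jq: "\<bar>j\<bar> \<le> int q" using A.D_coefficient_bound[OF inf(1) x(1) j] by simp
  \<comment> \<open>All coefficients that occur, namely j, k, q and q - 2, are bounded by q.\<close>
  define M where "M = int q"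
  have M: "M \<ge> 1" using q by (simp add: M_def)
  obtain N where "approx Pos eps u (4 * (fact (nat M) * fact (nat M) * (M + 1))) N"
    "approx Pos' eps' u' (4 * (fact (nat M) * fact (nat M) * (M + 1))) N"
    using same_residues_approx[OF A(2) B(2) inf same] by blast
  from approx_lin_eq[OF A(1) B(1) this, of 1]
  obtain y where y: "y \<in> carrier B" and eq: "lin_eq Pos Pos' (1 + 2) M
      (env u eps emb ((\<lambda>_. mv_zero A)(0 := x))) (env u' eps' emb' ((\<lambda>_. mv_zero B)(0 := y)))"
    using ef_chain_step[OF A B M _ x(1), of 1 "\<lambda>_. mv_zero A" "\<lambda>_. mv_zero B" 0] by auto
  have transfer: "Pos (of_int a * u + of_int b * eps + of_int c * emb x) \<longleftrightarrow>
      Pos' (of_int a * u' + of_int b * eps' + of_int c * emb' y)"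
    if "\<bar>a\<bar> \<le> M" "\<bar>b\<bar> \<le> M" "\<bar>c\<bar> \<le> M" for a b c
  proof -
    let ?c = "\<lambda>i::nat. if i = 0 then a else if i = 1 then b else c"
    have l: "lin (1 + 2) (env u eps emb ((\<lambda>_. mv_zero A)(0 := x))) ?c = of_int a * u + of_int b * eps + of_int c * emb x"
      "lin (1 + 2) (env u' eps' emb' ((\<lambda>_. mv_zero B)(0 := y))) ?c = of_int a * u' + of_int b * eps' + of_int c * emb' y"
      by (simp_all add: lin_def numeral_eq_Suc)
    have b: "\<forall>i<1 + 2. \<bar>?c i\<bar> \<le> M" using that by simp
    show ?thesis
      using eq[unfolded lin_eq_def, THEN spec[of _ ?c], THEN mp, OF b, THEN conjunct1] unfolding l .
  qed
  have q1: "q - 1 \<ge> 1" "int (q - 1) - 1 = int q - 2" using q by auto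
  have "null Pos' (of_int (int q) * emb' y - of_int (int k) * eps' - of_int j * u')"
  proof -
    have bd: "\<bar>j\<bar> \<le> M" "\<bar>- j\<bar> \<le> M" "\<bar>int k\<bar> \<le> M" "\<bar>- int k\<bar> \<le> M" "\<bar>int q\<bar> \<le> M" "\<bar>- int q\<bar> \<le> M"
      using jq q by (auto simp: M_def)
    have "Pos (of_int (- j) * u + of_int (- int k) * eps + of_int (int q) * emb x)"
      "Pos (of_int j * u + of_int (int k) * eps + of_int (- int q) * emb x)"
      using j by (simp_all add: null_def algebra_simps)
    then have "Pos' (of_int (- j) * u' + of_int (- int k) * eps' + of_int (int q) * emb' y)"
      "Pos' (of_int j * u' + of_int (int k) * eps' + of_int (- int q) * emb' y)"
      using transfer[of "- j" "- int k" "int q"] transfer[of j "int k" "- int q"] bd by blast+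
    then show ?thesis by (simp add: null_def algebra_simps)
  qed
  moreover have "mv_increasing_multiples B (q - 1) y"
  proof -
    have bd: "\<bar>0\<bar> \<le> M" "\<bar>- 1\<bar> \<le> M" "\<bar>int q - 2\<bar> \<le> M"
      using q by (auto simp: M_def)
    have "\<not> Pos (of_int 0 * u + of_int 0 * eps + of_int (- 1) * emb x)"
      "\<not> Pos (of_int (- 1) * u + of_int 0 * eps + of_int (int q - 2) * emb x)"
      using A.increasing_multiples_emb[OF x(1) q1(1)] x(2) unfolding q1(2) by (simp_all add: algebra_simps)
    then have "\<not> Pos' (of_int 0 * u' + of_int 0 * eps' + of_int (- 1) * emb' y)"
      "\<not> Pos' (of_int (- 1) * u' + of_int 0 * eps' + of_int (int q - 2) * emb' y)"
      using transfer[of 0 0 "- 1"] transfer[of "- 1" 0 "int q - 2"] bd by blast+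
    then show ?thesis
      using B.increasing_multiples_emb[OF y q1(1)] unfolding q1(2) by (simp add: algebra_simps)
  qed
  ultimately show ?thesis unfolding D_rep_def using y by blast
qed

text \<open>
  For \<open>q < 5\<close> the condition \<open>D\<close> may hold with a multiple of the unit other than the unit itself,
  and it then gives less information on the residue of the unit modulo \<open>q\<close>.
\<close>

lemma (in chain_rep) D_rep_iff:
  assumes inf: "\<And>j. Pos (u - of_int j * eps)" and q: "q \<ge> 5" and k: "k < q"
  shows "D_rep Pos eps A u emb q k \<longleftrightarrow> Div Pos (int q) (u + of_int (int k) * eps)"
proof
  have q1: "q - 1 \<ge> 1" "int (q - 1) - 1 = int q - 2" using q by auto
  have u_pos: "\<not> Pos (of_int (int i) * eps - u)" for i
  proof
    assume "Pos (of_int (int i) * eps - u)"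
    from Pos_add[OF this inf[of "int i + 1"]] show False using eps_pos by (simp add: algebra_simps)
  qed
  {
    assume "D_rep Pos eps A u emb q k"
    then obtain x j where x: "x \<in> K" "mv_increasing_multiples A (q - 1) x"
      and j: "null Pos (of_int (int q) * emb x - of_int (int k) * eps - of_int j * u)"
      unfolding D_rep_def by blast
    have x0: "\<not> Pos (- emb x)" and xq: "\<not> Pos (of_int (int q - 2) * emb x - u)"
      using increasing_multiples_emb[OF x(1) q1(1)] x(2) unfolding q1(2) by auto
    \<comment> \<open>For j \<le> 0 one gets q x \<le> k eps < q eps, although x is at least
      eps.\<close>
    have "j > 0"
    proof (rule ccontr)
      assume "\<not> j > 0"
      then have 1: "Pos (of_int (- j) * u)" using Pos_u by (intro Pos_mult) simp_all
      have 2: "Pos (of_int (int q) * (emb x - eps))" using eps_least[OF x0] by (intro Pos_mult) simp_all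
      have 3: "Pos (- (of_int (int q) * emb x - of_int (int k) * eps - of_int j * u))" using j by (simp add: null_def)
      from Pos_add[OF Pos_add[OF 1 2] 3] have "Pos (of_int (int k - int q) * eps)" by (simp add: algebra_simps)
      then show False unfolding Pos_of_int_eps using k by simp
    qed
    moreover have "j \<le> 1"
    proof (rule ccontr)
      assume "\<not> j \<le> 1"
      then have 1: "Pos (of_int ((j - 2) * (int q - 2)) * u)" using Pos_u q by (intro Pos_mult) simp_all
      have "Pos (u - of_int (int q - 2) * emb x)" using xq Pos_total[of "u - of_int (int q - 2) * emb x"] by simp
      then have 2: "Pos (of_int (int q) * (u - of_int (int q - 2) * emb x))" by (intro Pos_mult) simp_all
      have "Pos (of_int (int q) * emb x - of_int (int k) * eps - of_int j * u)" using j by (simp add: null_def)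
      then have 3: "Pos (of_int (int q - 2) * (of_int (int q) * emb x - of_int (int k) * eps - of_int j * u))"
        using q by (intro Pos_mult) simp_all
      have 4: "Pos (of_int (int q - 5) * u)" using Pos_u q by (intro Pos_mult) simp_all
      have 5: "Pos (of_int ((int q - 2) * int k) * eps)" unfolding Pos_of_int_eps using q by simp
      from Pos_add[OF Pos_add[OF Pos_add[OF 1 2] Pos_add[OF 3 4]] 5] have "Pos (- u)" by (simp add: algebra_simps)
      then show False using u_pos[of 0] by simp
    qed
    ultimately have "j = 1" by simp
    then have "null Pos (u + of_int (int k) * eps - of_int (int q) * emb x)"
      using null_minus[OF j] by (simp add: algebra_simps)
    then show "Div Pos (int q) (u + of_int (int k) * eps)" unfolding Div_def by blast
  }
  assume "Div Pos (int q) (u + of_int (int k) * eps)"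
  then obtain z where z: "null Pos (u + of_int (int k) * eps - of_int (int q) * z)" unfolding Div_def by blast
  then have z1: "Pos (u + of_int (int k) * eps - of_int (int q) * z)"
    and z2: "Pos (of_int (int q) * z - (u + of_int (int k) * eps))" by (simp_all add: null_def)
  have keps: "Pos (of_int (int k) * eps)" unfolding Pos_of_int_eps by simp
  have z0: "\<not> Pos (- z)"
  proof
    assume "Pos (- z)"
    then have "Pos (of_int (int q) * (- z))" by (intro Pos_mult) simp_all
    from Pos_add[OF Pos_add[OF z2 this] keps] show False using u_pos[of 0] by (simp add: algebra_simps)
  qed
  have "Pos (of_int (int q) * (u - z))"
  proof -
    have "Pos (of_int (int q - 2) * u)" using Pos_u q by (intro Pos_mult) simp_all
    from Pos_add[OF Pos_add[OF z1 this] inf[of "int k"]] show ?thesis by (simp add: algebra_simps)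
  qed
  then have "Pos (u - z)" using Pos_cancel[of "int q" "u - z"] q by simp
  then obtain x where x: "x \<in> K" "null Pos (emb x - z)" using emb_surj Pos_total z0 by blast
  have nx: "null Pos (of_int i * emb x - of_int i * z)" for i
    using null_mult[OF x(2), of i] by (simp add: algebra_simps)
  have "\<not> Pos (- emb x)" using z0 Pos_null[of "- emb x" "- z"] null_minus[OF x(2)] by simp
  \<comment> \<open>Since q z = u + k eps, multiplication by q would give 2 u \<le> (q - 2) k eps,
    but u exceeds all multiples of eps.\<close>
  moreover have "\<not> Pos (of_int (int q - 2) * emb x - u)"
  proof
    assume P: "Pos (of_int (int q - 2) * emb x - u)"
    have "null Pos ((of_int (int q - 2) * emb x - u) - (of_int (int q - 2) * z - u))" using nx[of "int q - 2"] by simp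
    then have "Pos (of_int (int q - 2) * z - u)" using P Pos_null by blast
    then have 1: "Pos (of_int (int q) * (of_int (int q - 2) * z - u))" by (intro Pos_mult) simp_all
    have 2: "Pos (of_int (int q - 2) * (u + of_int (int k) * eps - of_int (int q) * z))"
      using z1 q by (intro Pos_mult) simp_all
    from Pos_add[OF Pos_add[OF 1 2] Pos_u] have "Pos (of_int ((int q - 2) * int k) * eps - u)"
      by (simp add: algebra_simps)
    then show False using u_pos[of "(q - 2) * k"] q by (simp add: of_nat_diff)
  qed
  ultimately have "mv_increasing_multiples A (q - 1) x"
    using increasing_multiples_emb[OF x(1) q1(1)] unfolding q1(2) by simp
  moreover have "null Pos (of_int (int q) * emb x - of_int (int k) * eps - of_int 1 * u)"
    using null_diff[OF nx[of "int q"] z] by (simp add: algebra_simps)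
  ultimately show "D_rep Pos eps A u emb q k" unfolding D_rep_def using x by blast
qed

lemma int_dvdI_prime_powers:
  assumes "m \<ge> (1::int)" "\<And>p a. prime (p::nat) \<Longrightarrow> int (p ^ a) dvd m \<Longrightarrow> int (p ^ a) dvd d"
  shows "m dvd d"
proof (cases "d = 0")
  case False
  show ?thesis
  proof (rule multiplicity_le_imp_dvd)
    fix p :: int assume p: "prime p"
    define n where "n = nat p"
    have "p \<ge> 0" using p by (rule prime_ge_0_int)
    moreover have "prime n" using p prime_int_nat_transfer[of p] unfolding n_def by blast
    ultimately have n: "prime n" "p = int n" by (auto simp: n_def)
    have "int (n ^ multiplicity p m) dvd m" using multiplicity_dvd[of p m] n by simp
    then have "p ^ multiplicity p m dvd d" using assms(2)[OF n(1)] n by fastforce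
    then show "multiplicity p m \<le> multiplicity p d"
      using False p by (intro multiplicity_geI) (auto dest: not_prime_unit)
  qed (use assms in simp)
qed simp

text \<open>Residues modulo m are determined by those modulo the prime powers dividing m. For each
  of these \<open>D_rep_iff\<close> is used at a higher power q, with k the remainder of - u modulo
  q.\<close>

lemma same_residuesI:
  assumes A: "chain_rep Pos eps A u emb" "zgroup Pos eps"
    and B: "chain_rep Pos' eps' B u' emb'" "zgroup Pos' eps'"
    and inf: "\<And>j. Pos (u - of_int j * eps)" "\<And>j. Pos' (u' - of_int j * eps')"
    and D: "\<And>p m k. prime (p::nat) \<Longrightarrow> m \<ge> 1 \<Longrightarrow> k \<le> p ^ m - 1 \<Longrightarrow>
      D_rep Pos eps A u emb (p ^ m) k \<longleftrightarrow> D_rep Pos' eps' B u' emb' (p ^ m) k"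
  shows "same_residues Pos eps u Pos' eps' u'"
  unfolding same_residues_def
proof (intro allI impI)
  interpret A: chain_rep Pos eps A u emb by fact
  interpret B: chain_rep Pos' eps' B u' emb' by fact
  interpret AZ: zgroup Pos eps by fact
  interpret BZ: zgroup Pos' eps' by fact
  fix m r :: int assume m: "1 \<le> m"
  obtain s where s: "Div Pos m (u - of_int s * eps)" using AZ.division[OF m] by blast
  obtain t where t: "Div Pos' m (u' - of_int t * eps')" using BZ.division[OF m] by blast
  have "m dvd s - t"
  proof (rule int_dvdI_prime_powers[OF m])
    fix p a assume p: "prime (p::nat)" and a: "int (p ^ a) dvd m"
    \<comment> \<open>The exponent a + 3 makes q at least 8, so that \<open>D_rep_iff\<close>
      applies, and q remains a multiple of p^a.\<close>
    define q where "q = p ^ (a + 3)"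
    have "(2::nat) ^ 3 \<le> p ^ 3" using prime_ge_2_nat[OF p] by (intro power_mono) auto
    moreover have "p ^ 3 \<le> p ^ (a + 3)" using prime_gt_0_nat[OF p] by (intro power_increasing) auto
    ultimately have q: "q \<ge> 5" by (simp add: q_def)
    obtain k where k: "k < q" "Div Pos (int q) (u + of_int (int k) * eps)"
    proof -
      obtain i where i: "i \<in> {0..<0 + int q}" "Div Pos (int q) (- u - of_int i * eps)"
        using AZ.remainder[of "int q" 0 "- u"] q by auto
      then have "Div Pos (int q) (u + of_int i * eps)" using A.Div_minus[OF i(2)] by (simp add: algebra_simps)
      then show thesis using that[of "nat i"] i(1) by auto
    qed
    have "k \<le> p ^ (a + 3) - 1" using k by (simp add: q_def)
    then have "D_rep Pos eps A u emb q k \<longleftrightarrow> D_rep Pos' eps' B u' emb' q k"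
      unfolding q_def by (intro D p) auto
    then have k': "Div Pos' (int q) (u' + of_int (int k) * eps')"
      using k A.D_rep_iff[OF inf(1) q k(1)] B.D_rep_iff[OF inf(2) q k(1)] by blast
    have pq: "int (p ^ a) dvd int q" unfolding int_dvd_int_iff q_def by (simp add: power_add)
    have p1: "int (p ^ a) \<ge> 1" using prime_gt_0_nat[OF p] by (simp add: Suc_leI)
    have "Div Pos (int (p ^ a)) (of_int (int k + s) * eps)"
      using A.Div_diff[OF A.Div_dvd[OF k(2) pq] A.Div_dvd[OF s a]] by (simp add: algebra_simps)
    then have 1: "int (p ^ a) dvd int k + s" unfolding A.Div_eps[OF p1] .
    have "Div Pos' (int (p ^ a)) (of_int (int k + t) * eps')"
      using B.Div_diff[OF B.Div_dvd[OF k' pq] B.Div_dvd[OF t a]] by (simp add: algebra_simps)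
    then have 2: "int (p ^ a) dvd int k + t" unfolding B.Div_eps[OF p1] .
    show "int (p ^ a) dvd s - t" using dvd_diff[OF 1 2] by simp
  qed
  then have st: "m dvd s - r \<longleftrightarrow> m dvd t - r" using dvd_diff[of m "s - r" "s - t"] dvd_add[of m "s - t" "t - r"] by auto
  have "Div Pos m (u - of_int r * eps) \<longleftrightarrow> Div Pos m (of_int (s - r) * eps)"
    by (rule A.Div_cong) (use s in \<open>simp add: algebra_simps\<close>)
  moreover have "Div Pos' m (u' - of_int r * eps') \<longleftrightarrow> Div Pos' m (of_int (t - r) * eps')"
    by (rule B.Div_cong) (use t in \<open>simp add: algebra_simps\<close>)
  ultimately show "Div Pos m (u - of_int r * eps) \<longleftrightarrow> Div Pos' m (u' - of_int r * eps')"
    unfolding A.Div_eps[OF m] B.Div_eps[OF m] using st by simp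
qed

section \<open>Sentences and relativization to intervals\<close>

definition holds :: "'a mv \<Rightarrow> mv_form \<Rightarrow> bool" where
  "holds A \<phi> \<longleftrightarrow> sat A (\<lambda>_. mv_zero A) (\<lambda>_. mv_zero A) \<phi>"

lemma sat_holds: "\<phi> \<in> mv_sentences 0 \<Longrightarrow> sat A c v \<phi> \<longleftrightarrow> holds A \<phi>"
  unfolding holds_def by (rule sat_cong) (auto simp: mv_sentences_def)

lemma iso_holds:
  assumes "mv_algebra A" "h \<in> mv_iso A B" "\<phi> \<in> mv_sentences 0"
  shows "holds A \<phi> \<longleftrightarrow> holds B \<phi>"
proof -
  have "sat A (\<lambda>_. mv_zero A) (\<lambda>_. mv_zero A) \<phi> \<longleftrightarrow> sat B (\<lambda>_. h (mv_zero A)) (\<lambda>_. h (mv_zero A)) \<phi>"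
    by (rule iso_sat[OF assms(1,2)]) (simp_all add: mv_algebra.zero_closed[OF assms(1)])
  then show ?thesis by (simp only: sat_holds[OF assms(3)])
qed

text \<open>For a Boolean element e this is the interval [0, e]. There x \<le> e is equivalent to
  the equation below, which keeps relativized quantifiers free of the existential quantifier hidden
  in the order.\<close>

definition corner :: "'a mv \<Rightarrow> 'a \<Rightarrow> 'a mv" where
  "corner A e = \<lparr>carrier = {x \<in> carrier A. mv_times A x e = x}, mv_plus = mv_plus A,
     mv_neg = (\<lambda>x. mv_times A (mv_neg A x) e), mv_zero = mv_zero A\<rparr>"

lemma corner_simps [simp]:
  "carrier (corner A e) = {x \<in> carrier A. mv_times A x e = x}" "mv_plus (corner A e) = mv_plus A"
  "mv_neg (corner A e) x = mv_times A (mv_neg A x) e" "mv_zero (corner A e) = mv_zero A"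
  by (simp_all add: corner_def)

primrec rel_term :: "mv_term \<Rightarrow> mv_term \<Rightarrow> mv_term" where
  "rel_term E (Var x) = Var x"
| "rel_term E (Const i) = Const i"
| "rel_term E Zero = Zero"
| "rel_term E (Plus s t) = Plus (rel_term E s) (rel_term E t)"
| "rel_term E (Neg t) = TTimes (Neg (rel_term E t)) E"

primrec rel :: "mv_term \<Rightarrow> mv_form \<Rightarrow> mv_form" where
  "rel E (FEq s t) = FEq (rel_term E s) (rel_term E t)"
| "rel E (FNot \<phi>) = FNot (rel E \<phi>)"
| "rel E (FAnd \<phi> \<psi>) = FAnd (rel E \<phi>) (rel E \<psi>)"
| "rel E (FAll x \<phi>) = FAll x (FImp (FEq (TTimes (Var x) E) (Var x)) (rel E \<phi>))"

lemma term_val_rel: "term_val A c v (rel_term E t) = term_val (corner A (term_val A c v E)) c v t"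
  by (induction t) auto

lemma sat_rel:
  "term_vars E \<inter> form_vars \<phi> = {} \<Longrightarrow> sat A c v (rel E \<phi>) \<longleftrightarrow> sat (corner A (term_val A c v E)) c v \<phi>"
proof (induction \<phi> arbitrary: v)
  case (FAll x \<phi>)
  have "term_val A c (v(x := a)) E = term_val A c v E" for a
    by (rule term_val_cong) (use FAll.prems in auto)
  moreover have "sat A c (v(x := a)) (rel E \<phi>) \<longleftrightarrow> sat (corner A (term_val A c (v(x := a)) E)) c (v(x := a)) \<phi>" for a
    by (rule FAll.IH) (use FAll.prems in auto)
  ultimately show ?case by auto
qed (auto simp: term_val_rel)

lemma term_consts_rel: "term_consts (rel_term E t) \<subseteq> term_consts t \<union> term_consts E"
  by (induction t) auto

lemma form_consts_rel: "form_consts (rel E \<phi>) \<subseteq> form_consts \<phi> \<union> term_consts E"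
proof (induction \<phi>)
  case (FEq s t)
  then show ?case using term_consts_rel[of E s] term_consts_rel[of E t] by auto
qed auto

section \<open>Components of a decomposition\<close>

lemma prod_hom:
  assumes "h \<in> mv_iso A (mv_prod I C)" "mv_algebra A" "i \<in> I" "x \<in> carrier A" "y \<in> carrier A"
  shows "h (mv_plus A x y) i = mv_plus (C i) (h x i) (h y i)" "h (mv_neg A x) i = mv_neg (C i) (h x i)"
    "h (mv_zero A) i = mv_zero (C i)" "h (mv_one A) i = mv_one (C i)"
    "h (mv_times A x y) i = mv_times (C i) (h x i) (h y i)" "h (mv_meet A x y) i = mv_meet (C i) (h x i) (h y i)"
proof -
  interpret mv_algebra A by fact
  have p: "h (mv_plus A x y) i = mv_plus (C i) (h x i) (h y i)" if "x \<in> carrier A" "y \<in> carrier A" for x y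
    using assms(1,3) that by (auto simp: mv_iso_def mv_prod_def)
  have n: "h (mv_neg A x) i = mv_neg (C i) (h x i)" if "x \<in> carrier A" for x
    using assms(1,3) that by (auto simp: mv_iso_def mv_prod_def)
  have z: "h (mv_zero A) i = mv_zero (C i)" using assms(1,3) by (auto simp: mv_iso_def mv_prod_def)
  have t: "h (mv_times A x y) i = mv_times (C i) (h x i) (h y i)" if "x \<in> carrier A" "y \<in> carrier A" for x y
    using that by (simp add: mv_times_def p n closed)
  show "h (mv_plus A x y) i = mv_plus (C i) (h x i) (h y i)" "h (mv_neg A x) i = mv_neg (C i) (h x i)"
    "h (mv_zero A) i = mv_zero (C i)" "h (mv_times A x y) i = mv_times (C i) (h x i) (h y i)"
    using p n z t assms(4,5) by auto
  show "h (mv_one A) i = mv_one (C i)" using n[OF zero_closed] z by (simp add: mv_one_def)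
  show "h (mv_meet A x y) i = mv_meet (C i) (h x i) (h y i)"
    using assms(4,5) by (simp add: mv_meet_def p n t closed)
qed

locale decomposition = mv_algebra A for A :: "'a mv" +
  fixes n :: nat and C :: "nat \<Rightarrow> 'c mv" and h
  assumes decomp: "mv_chain_decomposition n A C h"
begin

lemma iso: "h \<in> mv_iso A (mv_prod {1..n} C)"
  using decomp by (simp add: mv_chain_decomposition_def)

lemma chain_C: "i \<in> {1..n} \<Longrightarrow> mv_chain (C i)"
  using decomp by (simp add: mv_chain_decomposition_def)

lemma algebra_C: "i \<in> {1..n} \<Longrightarrow> mv_algebra (C i)"
  by (rule chain_algebra[OF chain_C])

lemma surjective: "(\<And>i. i \<in> {1..n} \<Longrightarrow> b i \<in> carrier (C i)) \<Longrightarrow> \<exists>x\<in>carrier A. \<forall>i\<in>{1..n}. h x i = b i"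
proof -
  assume b: "\<And>i. i \<in> {1..n} \<Longrightarrow> b i \<in> carrier (C i)"
  obtain x where "x \<in> carrier A" "\<And>i. i \<in> {1..n} \<Longrightarrow> h x i = b i"
    by (rule prod_surj[OF iso, of b]) (use b in auto)
  then show ?thesis by blast
qed

lemmas hom = prod_hom[OF iso mv_algebra_axioms]
lemmas ext = prod_ext[OF iso]
lemmas comp_closed = prod_closed[OF iso]

abbreviation "e \<equiv> mv_component_one n A C h"

lemma component_one:
  assumes "i \<in> {1..n}"
  shows "e i \<in> K" "\<And>j. j \<in> {1..n} \<Longrightarrow> h (e i) j = (if j = i then mv_one (C j) else mv_zero (C j))"
proof -
  let ?f = "\<lambda>j\<in>{1..n}. if j = i then mv_one (C j) else mv_zero (C j)"
  have "?f \<in> carrier (mv_prod {1..n} C)"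
    using mv_algebra.one_closed[OF algebra_C] mv_algebra.zero_closed[OF algebra_C] by (auto simp: mv_prod_def)
  then have f: "?f \<in> h ` K" using iso by (simp add: mv_iso_def bij_betw_def)
  show "e i \<in> K" unfolding mv_component_one_def using f by (rule inv_into_into)
  show "h (e i) j = (if j = i then mv_one (C j) else mv_zero (C j))" if "j \<in> {1..n}" for j
    unfolding mv_component_one_def f_inv_into_f[OF f] using that by simp
qed

lemma times_component:
  assumes "i \<in> {1..n}" "j \<in> {1..n}" "x \<in> K"
  shows "h (x \<boxdot> e i) j = (if j = i then h x j else mv_zero (C j))"
proof -
  interpret Cj: mv_algebra "C j" using algebra_C assms by blast
  show ?thesis using assms hom(5)[OF assms(2,3) component_one(1)[OF assms(1)]] component_one(2)[OF assms(1,2)]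
    Cj.times_one[OF comp_closed[OF assms(3,2)]] Cj.times_zero[OF comp_closed[OF assms(3,2)]]
    by (cases "j = i") simp_all
qed

lemma in_corner: 
  assumes "i \<in> {1..n}" "x \<in> K"
  shows "x \<boxdot> e i = x \<longleftrightarrow> (\<forall>j\<in>{1..n}. j \<noteq> i \<longrightarrow> h x j = mv_zero (C j))"
  unfolding ext[OF times_closed[OF assms(2) component_one(1)[OF assms(1)]] assms(2)]
  using times_component[OF assms(1) _ assms(2)] by auto

text \<open>This identifies a factor with the interval [0, 1_i], so that a sentence about the factor
  becomes a relativized formula over the whole algebra.\<close>

lemma corner_iso:
  assumes i: "i \<in> {1..n}" shows "(\<lambda>x. h x i) \<in> mv_iso (corner A (e i)) (C i)"
proof -
  interpret Ci: mv_algebra "C i" using algebra_C i by blast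
  have "inj_on (\<lambda>x. h x i) (carrier (corner A (e i)))"
  proof (rule inj_onI)
    fix x y assume xy: "x \<in> carrier (corner A (e i))" "y \<in> carrier (corner A (e i))" "h x i = h y i"
    then have "h x j = h y j" if "j \<in> {1..n}" for j
      using in_corner[OF i, of x] in_corner[OF i, of y] that by (cases "j = i") auto
    then show "x = y" using ext xy by auto
  qed
  moreover have "(\<lambda>x. h x i) ` carrier (corner A (e i)) = carrier (C i)"
  proof
    show "carrier (C i) \<subseteq> (\<lambda>x. h x i) ` carrier (corner A (e i))"
    proof
      fix b assume b: "b \<in> carrier (C i)"
      have "(if j = i then b else mv_zero (C j)) \<in> carrier (C j)" if "j \<in> {1..n}" for j
        using b mv_algebra.zero_closed[OF algebra_C[OF that]] by simp
      then obtain x where x: "x \<in> K" "\<And>j. j \<in> {1..n} \<Longrightarrow> h x j = (if j = i then b else mv_zero (C j))"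
        using surjective[of "\<lambda>j. if j = i then b else mv_zero (C j)"] by blast
      then have "x \<in> carrier (corner A (e i))" using in_corner[OF i] by simp
      then show "b \<in> (\<lambda>x. h x i) ` carrier (corner A (e i))" using x(2)[OF i] by force
    qed
  qed (use comp_closed i in auto)
  ultimately show ?thesis
    using hom(1-3)[OF i] times_component[OF i i] closed by (simp add: mv_iso_def bij_betw_def)
qed

lemma chain_meet_eq_zero:
  assumes "mv_chain B" "x \<in> carrier B" "y \<in> carrier B"
  shows "mv_meet B x y = mv_zero B \<longleftrightarrow> x = mv_zero B \<or> y = mv_zero B"
proof -
  interpret B: mv_algebra B using assms chain_algebra by blast
  have "mv_meet B x y = x" if "mv_le B x y"
    using that B.le_iff assms B.times_one by (simp add: mv_meet_def)
  moreover have "mv_meet B x y = y" if "mv_le B y x"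
  proof -
    have "mv_le B y (mv_neg B (mv_neg B x))" using that assms B.neg_neg by simp
    then show ?thesis using B.plus_diff[of y "mv_neg B x"] assms B.closed B.plus_comm B.times_comm
      by (simp add: mv_meet_def B.neg_neg)
  qed
  ultimately show ?thesis
    using chain_total[OF assms] assms B.zero_le B.le_antisym[OF B.zero_closed] by metis
qed

text \<open>Orthogonality is a matter of supports: the polar of a consists of the elements vanishing
  where a does not, and the double polar of those vanishing where a does. Each b is therefore split
  along the zero coordinates of a, in exactly one way.\<close>

lemma projectable: "mv_projectable A"
proof -
  have zc: "mv_zero (C i) \<in> carrier (C i)" "mv_one (C i) \<in> carrier (C i)" if "i \<in> {1..n}" for i
    using mv_algebra.zero_closed[OF algebra_C[OF that]] mv_algebra.one_closed[OF algebra_C[OF that]] by auto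
  have meet: "mv_meet A x y = nought \<longleftrightarrow> (\<forall>i\<in>{1..n}. h x i = mv_zero (C i) \<or> h y i = mv_zero (C i))"
    if "x \<in> K" "y \<in> K" for x y
  proof -
    have m: "mv_meet A x y \<in> K" using that closed by (simp add: mv_meet_def)
    show ?thesis unfolding ext[OF m zero_closed]
      using hom(6)[OF _ that] hom(3)[OF _ that] chain_meet_eq_zero[OF chain_C comp_closed[OF that(1)] comp_closed[OF that(2)]]
      by auto
  qed
  have perp: "x \<in> mv_perp A {a} \<longleftrightarrow> x \<in> K \<and> (\<forall>i\<in>{1..n}. h x i = mv_zero (C i) \<or> h a i = mv_zero (C i))"
    if "a \<in> K" for x a using meet that by (auto simp: mv_perp_def)
  have perp2: "x \<in> mv_perp A (mv_perp A {a}) \<longleftrightarrow> x \<in> K \<and> (\<forall>i\<in>{1..n}. h a i = mv_zero (C i) \<longrightarrow> h x i = mv_zero (C i))"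
    if a: "a \<in> K" for x a
  proof
    assume x: "x \<in> mv_perp A (mv_perp A {a})"
    then have xK: "x \<in> K" by (simp add: mv_perp_def)
    have "h x i = mv_zero (C i)" if i: "i \<in> {1..n}" "h a i = mv_zero (C i)" for i
    proof -
      \<comment> \<open>The test element is 1_i, which lies in the polar of a when a vanishes at i.
        It yields no information only if the factor is trivial, and then all its elements are
        0.\<close>
      obtain b where b: "b \<in> K" "\<And>j. j \<in> {1..n} \<Longrightarrow> h b j = (if j = i then mv_one (C j) else mv_zero (C j))"
        using component_one[OF i(1)] by blast
      then have "b \<in> mv_perp A {a}" using perp[OF a] i by auto
      then have "mv_meet A x b = nought" using x by (simp add: mv_perp_def)
      then have "h x i = mv_zero (C i) \<or> mv_one (C i) = mv_zero (C i)" using meet[OF xK b(1)] b(2)[OF i(1)] i by auto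
      moreover have "h x i = mv_zero (C i)" if "mv_one (C i) = mv_zero (C i)"
      proof -
        interpret Ci: mv_algebra "C i" using algebra_C i by blast
        show ?thesis using Ci.plus_one[OF comp_closed[OF xK i(1)]] Ci.plus_zero[OF comp_closed[OF xK i(1)]] that by simp
      qed
      ultimately show ?thesis by blast
    qed
    then show "x \<in> K \<and> (\<forall>i\<in>{1..n}. h a i = mv_zero (C i) \<longrightarrow> h x i = mv_zero (C i))" using xK by blast
  next
    assume x: "x \<in> K \<and> (\<forall>i\<in>{1..n}. h a i = mv_zero (C i) \<longrightarrow> h x i = mv_zero (C i))"
    have "mv_meet A x b = nought" if "b \<in> mv_perp A {a}" for b
      using that meet[of x b] perp[OF a, of b] x by blast
    then show "x \<in> mv_perp A (mv_perp A {a})" using x by (simp add: mv_perp_def)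
  qed
  show ?thesis
    unfolding mv_projectable_def
  proof (intro ballI)
    fix a b assume a: "a \<in> K" and b: "b \<in> K"
    let ?z = "\<lambda>i. h a i = mv_zero (C i)"
    have "(if ?z i then h b i else mv_zero (C i)) \<in> carrier (C i)"
      "(if ?z i then mv_zero (C i) else h b i) \<in> carrier (C i)" if "i \<in> {1..n}" for i
      using comp_closed[OF b that] zc[OF that] by simp_all
    note split = surjective[OF this(1)] surjective[OF this(2)]
    obtain b1 where b1: "b1 \<in> K" "\<And>i. i \<in> {1..n} \<Longrightarrow> h b1 i = (if ?z i then h b i else mv_zero (C i))"
      using split(1) by blast
    obtain b2 where b2: "b2 \<in> K" "\<And>i. i \<in> {1..n} \<Longrightarrow> h b2 i = (if ?z i then mv_zero (C i) else h b i)"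
      using split(2) by blast
    have zp: "mv_plus (C i) x (mv_zero (C i)) = x" "mv_plus (C i) (mv_zero (C i)) x = x"
      if "i \<in> {1..n}" "x \<in> carrier (C i)" for i x
      using mv_algebra.plus_zero[OF algebra_C[OF that(1)] that(2)] mv_algebra.zero_plus[OF algebra_C[OF that(1)] that(2)] by auto
    show "\<exists>!p. fst p \<in> mv_perp A {a} \<and> snd p \<in> mv_perp A (mv_perp A {a}) \<and> b = fst p \<boxplus> snd p"
    proof (rule ex1I)
      have "b = b1 \<boxplus> b2"
        unfolding ext[OF b plus_closed[OF b1(1) b2(1)]]
        using hom(1)[OF _ b1(1) b2(1)] b1(2) b2(2) zp comp_closed[OF b] by simp
      then show "fst (b1, b2) \<in> mv_perp A {a} \<and> snd (b1, b2) \<in> mv_perp A (mv_perp A {a}) \<and> b = fst (b1, b2) \<boxplus> snd (b1, b2)"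
        unfolding perp[OF a] perp2[OF a] using b1 b2 by simp
    next
      fix p assume p: "fst p \<in> mv_perp A {a} \<and> snd p \<in> mv_perp A (mv_perp A {a}) \<and> b = fst p \<boxplus> snd p"
      obtain x y where xy: "p = (x, y)" by force
      have x: "x \<in> K" "\<And>i. i \<in> {1..n} \<Longrightarrow> h x i = mv_zero (C i) \<or> ?z i"
        and y: "y \<in> K" "\<And>i. i \<in> {1..n} \<Longrightarrow> ?z i \<Longrightarrow> h y i = mv_zero (C i)" and bxy: "b = x \<boxplus> y"
        using p unfolding perp[OF a] perp2[OF a] xy by auto
      have "h x i = h b1 i \<and> h y i = h b2 i" if i: "i \<in> {1..n}" for i
      proof -
        have "h b i = mv_plus (C i) (h x i) (h y i)" using hom(1)[OF i x(1) y(1)] bxy by simp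
        then show ?thesis using x(2)[OF i] y(2)[OF i] b1(2)[OF i] b2(2)[OF i] zp[OF i] comp_closed[OF x(1) i] comp_closed[OF y(1) i]
          by (cases "?z i") simp_all
      qed
      then show "p = (b1, b2)" using ext[OF x(1) b1(1)] ext[OF y(1) b2(1)] xy by simp
    qed
  qed
qed

end

section \<open>Elementary descriptions of chains and decompositions\<close>

text \<open>All these formulas use variables below 9, leaving the variables 9 + i free for the
  elements e i. Variable 3 stands for the atom, 4 for an element to be divided and 5 for a
  quotient.\<close>

definition lin_form where
  "lin_form = FAll 0 (FAll 1 (FOr (FEx 2 (FEq (Plus (Var 0) (Var 2)) (Var 1)))
     (FEx 2 (FEq (Plus (Var 1) (Var 2)) (Var 0)))))"

definition atom_form where
  "atom_form = FAnd (FNot (FEq (Var 3) Zero))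
     (FAll 0 (FImp (FNot (FEq (Var 0) Zero)) (FEx 1 (FEq (Plus (Var 3) (Var 1)) (Var 0)))))"

definition exact_form where
  "exact_form k r t = FAnd (FEq (Plus (TMult k (Var 5)) (TMult r (Var 3))) t)
     (FNot (FEq (Plus (TMult k (Var 5)) (TMult (r - 1) (Var 3))) t))"

text \<open>The first disjunct admits the one-element chain, which may occur as a factor and has no
  atom.\<close>

definition divisible_form where
  "divisible_form k = FOr (FEq Zero (Neg Zero)) (FEx 3 (FAnd atom_form
     (FAll 4 (FImp (FNot (FEq (Var 4) Zero))
       (FEx 5 (FOrs (map (\<lambda>r. exact_form k r (Var 4)) [1..<Suc k])))))))"

definition trivial_form where
  "trivial_form = FEq Zero (Neg Zero)"

text \<open>For N \<ge> 1 this singles out the chain with N + 1 elements among the finite ones: the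
  unit is reached at the N-th multiple of the atom and not before.\<close>

definition size_form where
  "size_form N = FEx 3 (FAnd atom_form (FAnd (FEq (TMult N (Var 3)) (Neg Zero))
     (FNot (FEq (TMult (N - 1) (Var 3)) (Neg Zero)))))"

definition residue_form where
  "residue_form k r = FEx 3 (FAnd atom_form (FEx 5 (exact_form k r (Neg Zero))))"

lemmas form_defs = lin_form_def atom_form_def exact_form_def divisible_form_def trivial_form_def
  size_form_def residue_form_def FOr_def FEx_def FImp_def

lemma term_TMult_simps [simp]:
  "term_vars (TMult k t) = (if k = 0 then {} else term_vars t)"
  "term_consts (TMult k t) = (if k = 0 then {} else term_consts t)"
  by (induction k) auto

lemma vars_FAnds:
  "free_vars (FAnds \<phi>s) = (\<Union>\<phi>\<in>set \<phi>s. free_vars \<phi>)" "form_vars (FAnds \<phi>s) = (\<Union>\<phi>\<in>set \<phi>s. form_vars \<phi>)"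
  unfolding FAnds_def by (induction \<phi>s) auto

lemma sentences:
  "lin_form \<in> mv_sentences 0" "divisible_form k \<in> mv_sentences 0" "trivial_form \<in> mv_sentences 0"
  "size_form N \<in> mv_sentences 0" "residue_form k r \<in> mv_sentences 0"
  by (auto simp: form_defs FOrs_def vars_FAnds mv_sentences_def split: if_splits)

lemma form_vars_small:
  "form_vars lin_form \<subseteq> {..<9}" "form_vars (divisible_form k) \<subseteq> {..<9}" "form_vars trivial_form \<subseteq> {..<9}"
  "form_vars (size_form N) \<subseteq> {..<9}" "form_vars (residue_form k r) \<subseteq> {..<9}"
  by (auto simp: form_defs FOrs_def vars_FAnds split: if_splits)

lemma holds_lin_form: "holds B lin_form \<longleftrightarrow> (\<forall>x\<in>carrier B. \<forall>y\<in>carrier B. mv_le B x y \<or> mv_le B y x)"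
  by (simp add: holds_def lin_form_def mv_le_def)

lemma holds_trivial_form: "holds B trivial_form \<longleftrightarrow> mv_zero B = mv_one B"
  by (simp add: holds_def trivial_form_def mv_one_def)

lemma sat_atom_form: "v 3 \<in> carrier B \<Longrightarrow> sat B c v atom_form \<longleftrightarrow> mv_atom B (v 3)"
  by (auto simp: atom_form_def mv_atom_def mv_le_def)

lemma holds_divisible_form:
  "holds B (divisible_form k) \<longleftrightarrow> mv_zero B = mv_one B \<or> (\<exists>e. mv_atom B e \<and> divisible_chain B e k)"
proof -
  have "{1..<Suc k} = {1..k}" by auto
  then show ?thesis
    by (auto simp: holds_def divisible_form_def mv_one_def exact_form_def divisible_chain_def sat_atom_form mv_atom_def
        simp del: upt_Suc)
qed

lemma holds_size_form:
  "holds B (size_form N) \<longleftrightarrow> (\<exists>e. mv_atom B e \<and> mv_mult B N e = mv_one B \<and> mv_mult B (N - 1) e \<noteq> mv_one B)"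
  by (auto simp: holds_def size_form_def mv_one_def sat_atom_form mv_atom_def)

lemma holds_residue_form:
  "holds B (residue_form k r) \<longleftrightarrow> (\<exists>e. mv_atom B e \<and> (\<exists>x\<in>carrier B.
     mv_plus B (mv_mult B k x) (mv_mult B r e) = mv_one B \<and> mv_plus B (mv_mult B k x) (mv_mult B (r - 1) e) \<noteq> mv_one B))"
  by (auto simp: holds_def residue_form_def exact_form_def mv_one_def sat_atom_form mv_atom_def)

text \<open>These equations make multiplication by e a homomorphism onto the corner, without
  mentioning that e is Boolean or 1_i of some decomposition.\<close>

definition corner_hom where
  "corner_hom A e \<longleftrightarrow>
     (\<forall>x\<in>carrier A. \<forall>y\<in>carrier A. mv_times A (mv_plus A x y) e = mv_plus A (mv_times A x e) (mv_times A y e))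
     \<and> (\<forall>x\<in>carrier A. mv_times A (mv_neg A x) e = mv_times A (mv_neg A (mv_times A x e)) e)
     \<and> (\<forall>x\<in>carrier A. mv_times A (mv_times A x e) e = mv_times A x e)"

text \<open>The family f matters only through its n values, so surjectivity onto the product of the
  corners is expressible with n quantifiers; this makes the whole condition first-order in the e
  i.\<close>

definition decomposes where
  "decomposes n A e \<longleftrightarrow> (\<forall>i\<in>{1..n}. corner_hom A (e i))
     \<and> (\<forall>x\<in>carrier A. \<forall>y\<in>carrier A. (\<forall>i\<in>{1..n}. mv_times A x (e i) = mv_times A y (e i)) \<longrightarrow> x = y)
     \<and> (\<forall>f. (\<forall>i\<in>{1..n}. f i \<in> carrier A) \<longrightarrow>
          (\<exists>x\<in>carrier A. \<forall>i\<in>{1..n}. mv_times A x (e i) = mv_times A (f i) (e i)))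
     \<and> (\<forall>i\<in>{1..n}. holds (corner A (e i)) lin_form)"

definition corner_hom_form where
  "corner_hom_form E = FAnds [
     FAll 0 (FAll 1 (FEq (TTimes (Plus (Var 0) (Var 1)) E) (Plus (TTimes (Var 0) E) (TTimes (Var 1) E)))),
     FAll 0 (FEq (TTimes (Neg (Var 0)) E) (TTimes (Neg (TTimes (Var 0) E)) E)),
     FAll 0 (FEq (TTimes (TTimes (Var 0) E) E) (TTimes (Var 0) E))]"

text \<open>The variable \<open>9 + i\<close> stands for \<open>e i\<close>, and the variable \<open>9 + n + i\<close> for \<open>f i\<close>.\<close>

definition decomposes_form where
  "decomposes_form n = FAnds [
     FAnds (map (\<lambda>i. corner_hom_form (Var (9 + i))) [1..<Suc n]),
     FAll 0 (FAll 1 (FImp (FAnds (map (\<lambda>i. FEq (TTimes (Var 0) (Var (9 + i))) (TTimes (Var 1) (Var (9 + i)))) [1..<Suc n]))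
       (FEq (Var 0) (Var 1)))),
     FAlls [10 + n..<10 + 2 * n] (FEx 0 (FAnds (map (\<lambda>i.
       FEq (TTimes (Var 0) (Var (9 + i))) (TTimes (Var (9 + n + i)) (Var (9 + i)))) [1..<Suc n]))),
     FAnds (map (\<lambda>i. rel (Var (9 + i)) lin_form) [1..<Suc n])]"

lemma sat_rel_var:
  assumes "\<phi> \<in> mv_sentences 0" "form_vars \<phi> \<subseteq> {..<9}"
  shows "sat A c v (rel (Var (9 + i)) \<phi>) \<longleftrightarrow> holds (corner A (v (9 + i))) \<phi>"
  using sat_rel[of "Var (9 + i)" \<phi> A c v] assms sat_holds[OF assms(1)] by auto

lemma sat_decomposes_form:
  assumes v: "\<And>x. v x \<in> carrier A"
  shows "sat A c v (decomposes_form n) \<longleftrightarrow> decomposes n A (\<lambda>i. v (9 + i))"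
proof -
  have set: "set [1..<Suc n] = {1..n}" by auto
  have "sat A c v (FAnds (map (\<lambda>i. corner_hom_form (Var (9 + i))) [1..<Suc n])) \<longleftrightarrow> (\<forall>i\<in>{1..n}. corner_hom A (v (9 + i)))"
    unfolding sat_FAnds set_map set ball_simps by (simp add: corner_hom_form_def corner_hom_def)
  moreover have "sat A c v (FAll 0 (FAll 1 (FImp (FAnds (map (\<lambda>i. FEq (TTimes (Var 0) (Var (9 + i)))
        (TTimes (Var 1) (Var (9 + i)))) [1..<Suc n])) (FEq (Var 0) (Var 1)))))
      \<longleftrightarrow> (\<forall>x\<in>carrier A. \<forall>y\<in>carrier A. (\<forall>i\<in>{1..n}. mv_times A x (v (9 + i)) = mv_times A y (v (9 + i))) \<longrightarrow> x = y)"
    by (simp add: atLeastLessThanSuc_atLeastAtMost del: upt_Suc)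
  moreover have "sat A c v (FAnds (map (\<lambda>i. rel (Var (9 + i)) lin_form) [1..<Suc n])) \<longleftrightarrow>
      (\<forall>i\<in>{1..n}. holds (corner A (v (9 + i))) lin_form)"
    unfolding sat_FAnds set_map set ball_simps sat_rel_var[OF sentences(1) form_vars_small(1)] ..
  moreover have "sat A c v (FAlls [10 + n..<10 + 2 * n] (FEx 0 (FAnds (map (\<lambda>i.
       FEq (TTimes (Var 0) (Var (9 + i))) (TTimes (Var (9 + n + i)) (Var (9 + i)))) [1..<Suc n]))))
    \<longleftrightarrow> (\<forall>f. (\<forall>i\<in>{1..n}. f i \<in> carrier A) \<longrightarrow>
          (\<exists>x\<in>carrier A. \<forall>i\<in>{1..n}. mv_times A x (v (9 + i)) = mv_times A (f i) (v (9 + i))))"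
    (is "?l \<longleftrightarrow> ?r")
  proof -
    have "?l \<longleftrightarrow> (\<forall>w. (\<forall>x. w x \<in> carrier A) \<longrightarrow> (\<forall>x. x \<notin> set [10 + n..<10 + 2 * n] \<longrightarrow> w x = v x) \<longrightarrow>
        (\<exists>x\<in>carrier A. \<forall>i\<in>{1..n}. mv_times A x (w (9 + i)) = mv_times A (w (9 + n + i)) (w (9 + i))))"
      (is "_ \<longleftrightarrow> ?m") unfolding sat_FAlls[of v A, OF v] by (simp add: atLeastLessThanSuc_atLeastAtMost del: upt_Suc)
    also have "\<dots> \<longleftrightarrow> ?r"
    proof
      assume m: ?m
      show ?r
      proof (intro allI impI)
        fix f assume f: "\<forall>i\<in>{1..n}. f i \<in> carrier A"
        define w where "w x = (if x \<in> {10 + n..<10 + 2 * n} then f (x - (9 + n)) else v x)" for x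
        have "w x \<in> carrier A" for x
        proof (cases "x \<in> {10 + n..<10 + 2 * n}")
          case True
          then have "x - (9 + n) \<in> {1..n}" by auto
          then show ?thesis using True f by (simp add: w_def)
        next
          case False
          then show ?thesis by (simp only: w_def if_False v)
        qed
        moreover have "\<forall>x. x \<notin> set [10 + n..<10 + 2 * n] \<longrightarrow> w x = v x" by (auto simp: w_def)
        ultimately have "\<exists>x\<in>carrier A. \<forall>i\<in>{1..n}. mv_times A x (w (9 + i)) = mv_times A (w (9 + n + i)) (w (9 + i))"
          using m by blast
        moreover have "w (9 + i) = v (9 + i)" "w (9 + n + i) = f i" if "i \<in> {1..n}" for i
          using that by (auto simp: w_def)
        ultimately show "\<exists>x\<in>carrier A. \<forall>i\<in>{1..n}. mv_times A x (v (9 + i)) = mv_times A (f i) (v (9 + i))"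
          by simp
      qed
    next
      assume r: ?r
      show ?m
      proof (intro allI impI)
        fix w :: "nat \<Rightarrow> _" assume w: "\<forall>x. w x \<in> carrier A" "\<forall>x. x \<notin> set [10 + n..<10 + 2 * n] \<longrightarrow> w x = v x"
        have "w (9 + i) = v (9 + i)" if "i \<in> {1..n}" for i using w(2) that by auto
        then show "\<exists>x\<in>carrier A. \<forall>i\<in>{1..n}. mv_times A x (w (9 + i)) = mv_times A (w (9 + n + i)) (w (9 + i))"
          using r[rule_format, of "\<lambda>i. w (9 + n + i)"] w(1) by simp
      qed
    qed
    finally show ?thesis .
  qed
  ultimately show ?thesis unfolding decomposes_form_def decomposes_def by simp
qed

text \<open>Multiplication by e respects the operations and fixes the corner, so the axioms of the
  corner are those of the algebra multiplied by e. Its unit is e.\<close>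

lemma corner_algebra:
  assumes A: "mv_algebra A" and e: "e \<in> carrier A" "corner_hom A e" shows "mv_algebra (corner A e)"
proof -
  interpret mv_algebra A by fact
  have p: "(x \<boxplus> y) \<boxdot> e = (x \<boxdot> e) \<boxplus> (y \<boxdot> e)" if "x \<in> K" "y \<in> K" for x y
    using e(2) that unfolding corner_hom_def by blast
  have n: "(\<sim> x) \<boxdot> e = (\<sim> (x \<boxdot> e)) \<boxdot> e" if "x \<in> K" for x
    using e(2) that unfolding corner_hom_def by blast
  have i: "x \<boxdot> e \<boxdot> e = x \<boxdot> e" if "x \<in> K" for x
    using e(2) that unfolding corner_hom_def by blast
  have one: "mv_one (corner A e) = e"
    using e times_comm[OF one_closed e(1)] by (simp add: mv_one_def[of "corner A e"] neg_zero times_one)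
  have nn: "\<sim> (\<sim> x \<boxdot> e) \<boxdot> e = x" if "x \<in> K" "x \<boxdot> e = x" for x
    using n[of "\<sim> x"] that closed neg_neg by simp
  have luk: "(\<sim> ((\<sim> x \<boxdot> e) \<boxplus> y) \<boxdot> e) \<boxplus> y = (\<sim> (\<sim> x \<boxplus> y) \<boxplus> y) \<boxdot> e"
    if "x \<in> K" "y \<in> K" "y \<boxdot> e = y" for x y
    using p[of "\<sim> x" y] n[of "\<sim> x \<boxplus> y"] p[of "\<sim> (\<sim> x \<boxplus> y)" y] that closed by simp
  show ?thesis
  proof
    fix x assume x: "x \<in> carrier (corner A e)"
    have "x \<boxplus> e = (x \<boxplus> unity) \<boxdot> e" using p[of x unity] x e closed times_comm[of unity e] times_one by simp
    then have "x \<boxplus> e = unity \<boxdot> e" using x plus_one by simp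
    then show "mv_plus (corner A e) x (mv_one (corner A e)) = mv_one (corner A e)"
      unfolding one using e times_comm closed times_one by simp
  next
    fix x y assume "x \<in> carrier (corner A e)" "y \<in> carrier (corner A e)"
    then show "mv_plus (corner A e) (mv_neg (corner A e) (mv_plus (corner A e) (mv_neg (corner A e) x) y)) y =
      mv_plus (corner A e) (mv_neg (corner A e) (mv_plus (corner A e) (mv_neg (corner A e) y) x)) x"
      using luk[of x y] luk[of y x] lukasiewicz by simp
  qed (use e in \<open>auto simp: closed p i nn plus_assoc plus_comm plus_lcomm plus_zero zero_times\<close>)
qed

lemma decomposes_decomposition:
  assumes A: "mv_algebra A" and e: "\<And>i. e i \<in> carrier A" "decomposes n A e"
  shows "mv_chain_decomposition n A (\<lambda>i. corner A (e i)) (\<lambda>x. \<lambda>i\<in>{1..n}. mv_times A x (e i))"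
proof -
  interpret mv_algebra A by fact
  let ?h = "\<lambda>x. \<lambda>i\<in>{1..n}. x \<boxdot> e i"
  have ch: "corner_hom A (e i)" if "i \<in> {1..n}" for i using e(2) that by (simp add: decomposes_def)
  have inj: "x = y" if "x \<in> K" "y \<in> K" "\<And>i. i \<in> {1..n} \<Longrightarrow> x \<boxdot> e i = y \<boxdot> e i" for x y
    using e(2)[unfolded decomposes_def, THEN conjunct2, THEN conjunct1] that by simp
  have surj: "\<exists>x\<in>K. \<forall>i\<in>{1..n}. x \<boxdot> e i = f i \<boxdot> e i" if "\<And>i. i \<in> {1..n} \<Longrightarrow> f i \<in> K" for f
    by (rule e(2)[unfolded decomposes_def, THEN conjunct2, THEN conjunct2, THEN conjunct1, THEN spec, THEN mp])
      (use that in blast)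
  have "mv_chain (corner A (e i))" if "i \<in> {1..n}" for i
    using corner_algebra[OF A e(1) ch[OF that]] that
      e(2)[unfolded decomposes_def, THEN conjunct2, THEN conjunct2, THEN conjunct2, unfolded holds_lin_form]
    unfolding mv_chain_def by blast
  moreover have "bij_betw ?h K (\<Pi>\<^sub>E i\<in>{1..n}. carrier (corner A (e i)))"
  proof (rule bij_betw_imageI)
    show "inj_on ?h K"
    proof (rule inj_onI)
      fix x y assume xy: "x \<in> K" "y \<in> K" and eq: "?h x = ?h y"
      have "x \<boxdot> e i = y \<boxdot> e i" if "i \<in> {1..n}" for i using fun_cong[OF eq, of i] that by simp
      then show "x = y" using inj xy by blast
    qed
    show "?h ` K = (\<Pi>\<^sub>E i\<in>{1..n}. carrier (corner A (e i)))"
    proof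
      show "?h ` K \<subseteq> (\<Pi>\<^sub>E i\<in>{1..n}. carrier (corner A (e i)))"
      proof (intro image_subsetI restrict_PiE_iff[THEN iffD2] ballI)
        fix x i assume "x \<in> K" "i \<in> {1..n}"
        then show "x \<boxdot> e i \<in> carrier (corner A (e i))"
          using ch e(1) closed unfolding corner_hom_def by simp
      qed
      show "(\<Pi>\<^sub>E i\<in>{1..n}. carrier (corner A (e i))) \<subseteq> ?h ` K"
      proof
        fix f assume f: "f \<in> (\<Pi>\<^sub>E i\<in>{1..n}. carrier (corner A (e i)))"
        then have fi: "f i \<in> K" "f i \<boxdot> e i = f i" if "i \<in> {1..n}" for i using PiE_mem[OF f that] by auto
        then obtain x where x: "x \<in> K" "\<forall>i\<in>{1..n}. x \<boxdot> e i = f i \<boxdot> e i" using surj by blast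
        have "f = ?h x"
        proof
          fix i show "f i = ?h x i" using x(2) fi f by (cases "i \<in> {1..n}") (auto simp: PiE_def extensional_def)
        qed
        then show "f \<in> ?h ` K" using x by blast
      qed
    qed
  qed
  moreover have "?h (\<sim> x) = (\<lambda>i\<in>{1..n}. mv_neg (corner A (e i)) (?h x i))" if "x \<in> K" for x
    by (rule restrict_ext) (use ch that in \<open>simp add: corner_hom_def\<close>)
  moreover have "?h (x \<boxplus> y) = (\<lambda>i\<in>{1..n}. mv_plus (corner A (e i)) (?h x i) (?h y i))" if "x \<in> K" "y \<in> K" for x y
    by (rule restrict_ext) (use ch that in \<open>simp add: corner_hom_def\<close>)
  moreover have "?h nought = (\<lambda>i\<in>{1..n}. mv_zero (corner A (e i)))"
    by (rule restrict_ext) (use e(1) zero_times in simp)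
  ultimately show ?thesis by (simp add: mv_chain_decomposition_def mv_iso_def mv_prod_def)
qed

text \<open>Stated for families that agree with \<open>e\<close> on the indices only, because it is
  applied to entries of a valuation, which are arbitrary elsewhere.\<close>

lemma (in decomposition) decomposes_component_one: 
  assumes "\<And>i. i \<in> {1..n} \<Longrightarrow> f i = e i" shows "decomposes n A f"
proof -
  have f: "f i \<in> K" if "i \<in> {1..n}" for i using component_one(1) assms that by simp
  have t: "h (x \<boxdot> f i) j = (if j = i then h x j else mv_zero (C j))" if "i \<in> {1..n}" "j \<in> {1..n}" "x \<in> K" for i j x
    using times_component that assms by simp
  have ch: "corner_hom A (f i)" if i: "i \<in> {1..n}" for i
  proof -
    note fi = f[OF i] and ti = t[OF i]
    have z: "mv_plus (C j) (mv_zero (C j)) (mv_zero (C j)) = mv_zero (C j)" if "j \<in> {1..n}" for j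
      using mv_algebra.plus_zero[OF algebra_C mv_algebra.zero_closed[OF algebra_C]] that by blast
    have 1: "(x \<boxplus> y) \<boxdot> f i = (x \<boxdot> f i) \<boxplus> (y \<boxdot> f i)" if "x \<in> K" "y \<in> K" for x y
    proof -
      have cl: "(x \<boxplus> y) \<boxdot> f i \<in> K" "(x \<boxdot> f i) \<boxplus> (y \<boxdot> f i) \<in> K" "x \<boxplus> y \<in> K" "x \<boxdot> f i \<in> K" "y \<boxdot> f i \<in> K"
        using that fi closed by auto
      show ?thesis unfolding ext[OF cl(1,2)]
        using ti[OF _ cl(3)] ti[OF _ that(1)] ti[OF _ that(2)] hom(1)[OF _ that] hom(1)[OF _ cl(4,5)] z by simp
    qed
    have 2: "\<sim> x \<boxdot> f i = \<sim> (x \<boxdot> f i) \<boxdot> f i" "x \<boxdot> f i \<boxdot> f i = x \<boxdot> f i" if x: "x \<in> K" for x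
    proof -
      have cl: "\<sim> x \<boxdot> f i \<in> K" "\<sim> (x \<boxdot> f i) \<boxdot> f i \<in> K" "\<sim> x \<in> K" "\<sim> (x \<boxdot> f i) \<in> K" "x \<boxdot> f i \<in> K" "x \<boxdot> f i \<boxdot> f i \<in> K"
        using x fi closed by auto
      show "\<sim> x \<boxdot> f i = \<sim> (x \<boxdot> f i) \<boxdot> f i" unfolding ext[OF cl(1,2)]
        using ti[OF _ cl(3)] ti[OF _ cl(4)] ti[OF _ x] hom(2)[OF _ x x] hom(2)[OF _ cl(5) x] by simp
      show "x \<boxdot> f i \<boxdot> f i = x \<boxdot> f i" unfolding ext[OF cl(6,5)]
        using ti[OF _ cl(5)] ti[OF _ x] by simp
    qed
    show ?thesis unfolding corner_hom_def using 1 2 by blast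
  qed
  have inj: "x = y" if "x \<in> K" "y \<in> K" "\<forall>i\<in>{1..n}. x \<boxdot> f i = y \<boxdot> f i" for x y
  proof -
    have "h x i = h y i" if "i \<in> {1..n}" for i
      using t[OF that that \<open>x \<in> K\<close>] t[OF that that \<open>y \<in> K\<close>] \<open>\<forall>i\<in>{1..n}. x \<boxdot> f i = y \<boxdot> f i\<close> that by simp
    then show ?thesis using ext that by blast
  qed
  have surj: "\<exists>x\<in>K. \<forall>i\<in>{1..n}. x \<boxdot> f i = g i \<boxdot> f i" if g: "\<forall>i\<in>{1..n}. g i \<in> K" for g
  proof -
    obtain x where x: "x \<in> K" "\<And>i. i \<in> {1..n} \<Longrightarrow> h x i = h (g i) i"
      using surjective[of "\<lambda>i. h (g i) i"] comp_closed g by blast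
    have "x \<boxdot> f i = g i \<boxdot> f i" if i: "i \<in> {1..n}" for i
    proof -
      have "x \<boxdot> f i \<in> K" "g i \<boxdot> f i \<in> K" using x g f i closed by auto
      from ext[OF this] show ?thesis using t[OF i _ x(1)] t[OF i, of _ "g i"] g i x(2)[OF i] by simp
    qed
    then show ?thesis using x by blast
  qed
  have "holds (corner A (f i)) lin_form" if i: "i \<in> {1..n}" for i
  proof -
    have "mv_algebra (corner A (f i))" using corner_algebra[OF mv_algebra_axioms f[OF i] ch[OF i]] .
    then have "holds (corner A (f i)) lin_form \<longleftrightarrow> holds (C i) lin_form"
      using iso_holds[OF _ corner_iso[OF i] sentences(1)] assms[OF i] by simp
    then show ?thesis using chain_C[OF i] by (simp add: mv_chain_def holds_lin_form)
  qed
  then show ?thesis unfolding decomposes_def using ch inj surj by blast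
qed

section \<open>Ultrafilters and transport of structure\<close>

text \<open>Zorn's lemma for the proper filters finer than \<open>F0\<close>; the infimum of a
  nonempty chain of proper filters is proper because its members form a filter base.\<close>

lemma exists_ultrafilter:
  fixes F0 :: "'i filter"
  assumes "F0 \<noteq> bot"
  obtains F where "F \<le> F0" "F \<noteq> bot" "\<And>P. eventually P F \<or> eventually (\<lambda>i. \<not> P i) F"
proof -
  define S where "S = {F :: 'i filter. F \<noteq> bot \<and> F \<le> F0}"
  have "\<exists>F\<in>S. \<forall>G\<in>S. G \<le> F \<longrightarrow> G = F"
  proof (rule predicate_Zorn[of S "\<lambda>F G. G \<le> F"])
    show "partial_order_on S (relation_of (\<lambda>F G. G \<le> F) S)"
      by (rule partial_order_on_relation_ofI) auto
  next
    fix Ch assume Ch: "Ch \<in> Chains (relation_of (\<lambda>F G. G \<le> F) S)"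
    then have sub: "Ch \<subseteq> S" by (auto simp: Chains_def relation_of_def)
    have tot: "F \<le> G \<or> G \<le> F" if "F \<in> Ch" "G \<in> Ch" for F G
      using Ch that by (auto simp: Chains_def relation_of_def)
    show "\<exists>F\<in>S. \<forall>G\<in>Ch. F \<le> G"
    proof (cases "Ch = {}")
      case True
      then show ?thesis using assms by (auto simp: S_def)
    next
      case False
      have "\<exists>H\<in>Ch. H \<le> inf F G" if "F \<in> Ch" "G \<in> Ch" for F G
        using tot[OF that] that by (metis inf.orderE inf.commute order_refl)
      then have "eventually (\<lambda>_. False) (Inf Ch) \<longleftrightarrow> (\<exists>F\<in>Ch. eventually (\<lambda>_. False) F)"
        by (rule eventually_Inf_base[OF False])
      then have "Inf Ch \<noteq> bot" using sub by (auto simp: S_def eventually_False)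
      moreover have "Inf Ch \<le> F0" using False sub by (auto simp: S_def intro: Inf_lower2)
      ultimately show ?thesis by (intro bexI[of _ "Inf Ch"]) (auto simp: S_def intro: Inf_lower)
    qed
  qed
  then obtain F where F: "F \<noteq> bot" "F \<le> F0" "\<And>G. G \<noteq> bot \<Longrightarrow> G \<le> F0 \<Longrightarrow> G \<le> F \<Longrightarrow> G = F"
    by (auto simp: S_def)
  show ?thesis
  proof (rule that[OF F(2,1)])
    fix P
    \<comment> \<open>Restricting a minimal proper filter to P gives either the improper filter, and
      then the complement of P is in it, or the filter itself.\<close>
    let ?G = "inf F (principal {i. P i})"
    show "eventually P F \<or> eventually (\<lambda>i. \<not> P i) F"
    proof (cases "?G = bot")
      case True
      then have "eventually (\<lambda>_. False) ?G" by simp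
      then show ?thesis by (simp add: eventually_inf_principal)
    next
      case False
      then have "?G = F" using F(2) by (intro F(3)) (auto intro: le_infI1)
      moreover have "eventually P ?G" by (simp add: eventually_inf_principal)
      ultimately show ?thesis by simp
    qed
  qed
qed

text \<open>Moves a structure along an injection. It is needed to realize finite chains and their
  products inside a prescribed infinite type.\<close>

definition transport :: "'a mv \<Rightarrow> ('a \<Rightarrow> 'b) \<Rightarrow> 'b mv" where
  "transport A g = \<lparr>carrier = g ` carrier A,
     mv_plus = (\<lambda>x y. g (mv_plus A (inv_into (carrier A) g x) (inv_into (carrier A) g y))),
     mv_neg = (\<lambda>x. g (mv_neg A (inv_into (carrier A) g x))), mv_zero = g (mv_zero A)\<rparr>"

lemma transport:
  assumes A: "mv_algebra A" and g: "inj_on g (carrier A)"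
  shows "mv_algebra (transport A g)" "inv_into (carrier A) g \<in> mv_iso (transport A g) A"
    "carrier (transport A g) = g ` carrier A"
proof -
  interpret mv_algebra A by fact
  have s: "carrier (transport A g) = g ` K" "mv_zero (transport A g) = g nought"
    "x \<in> K \<Longrightarrow> mv_neg (transport A g) (g x) = g (\<sim> x)"
    "x \<in> K \<Longrightarrow> y \<in> K \<Longrightarrow> mv_plus (transport A g) (g x) (g y) = g (x \<boxplus> y)" for x y
    using g by (simp_all add: transport_def)
  have one: "mv_one (transport A g) = g unity" by (simp add: mv_one_def[of "transport A g"] s closed neg_zero)
  show "mv_algebra (transport A g)"
  proof
    fix x y assume "x \<in> carrier (transport A g)" "y \<in> carrier (transport A g)"
    then obtain a b where "x = g a" "y = g b" "a \<in> K" "b \<in> K" by (auto simp: s)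
    then show "mv_plus (transport A g) (mv_neg (transport A g) (mv_plus (transport A g) (mv_neg (transport A g) x) y)) y =
      mv_plus (transport A g) (mv_neg (transport A g) (mv_plus (transport A g) (mv_neg (transport A g) y) x)) x"
      using lukasiewicz[of a b] by (simp add: s closed)
  qed (auto simp: s one closed plus_assoc plus_comm plus_lcomm plus_zero neg_neg plus_one)
  show "inv_into K g \<in> mv_iso (transport A g) A"
    using g inj_on_imp_bij_betw[OF g] bij_betw_inv_into[OF inj_on_imp_bij_betw[OF g]]
    by (auto simp: mv_iso_def s closed)
  show "carrier (transport A g) = g ` K" by (rule s)
qed

lemma mv_prod_algebra:
  assumes "\<And>i. i \<in> I \<Longrightarrow> mv_algebra (C i)" shows "mv_algebra (mv_prod I C)"
proof -
  let ?P = "mv_prod I C"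
  have one: "mv_one ?P = (\<lambda>i\<in>I. mv_one (C i))" by (rule ext) (simp add: mv_one_def mv_prod_def)
  have mem: "x i \<in> carrier (C i)" if "x \<in> carrier ?P" "i \<in> I" for x i using that by (auto simp: mv_prod_def)
  have eqI: "x = y" if "x \<in> carrier ?P" "y \<in> carrier ?P" "\<And>i. i \<in> I \<Longrightarrow> x i = y i" for x y
    using that PiE_ext[of x I "\<lambda>i. carrier (C i)" y] by (simp add: mv_prod_def)
  have ops: "mv_plus ?P x y i = mv_plus (C i) (x i) (y i)" "mv_neg ?P x i = mv_neg (C i) (x i)"
    "mv_zero ?P i = mv_zero (C i)" "mv_one ?P i = mv_one (C i)" if "i \<in> I" for x y i
    using that by (simp_all add: one) (simp_all add: mv_prod_def)
  have cl: "mv_zero ?P \<in> carrier ?P" "x \<in> carrier ?P \<Longrightarrow> y \<in> carrier ?P \<Longrightarrow> mv_plus ?P x y \<in> carrier ?P"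
    "x \<in> carrier ?P \<Longrightarrow> mv_neg ?P x \<in> carrier ?P" for x y
    by (auto simp: mv_prod_def dest: PiE_mem intro!: mv_algebra.plus_closed[OF assms]
        mv_algebra.neg_closed[OF assms] mv_algebra.zero_closed[OF assms])
  have cl1: "mv_one ?P \<in> carrier ?P" unfolding mv_one_def by (intro cl)
  show ?thesis
  proof
    fix x y z assume x: "x \<in> carrier ?P" and y: "y \<in> carrier ?P" and z: "z \<in> carrier ?P"
    show "mv_plus ?P (mv_plus ?P x y) z = mv_plus ?P x (mv_plus ?P y z)"
      by (rule eqI) (simp_all add: cl x y z ops mem mv_algebra.plus_assoc[OF assms])
  next
    fix x y assume x: "x \<in> carrier ?P" and y: "y \<in> carrier ?P"
    show "mv_plus ?P x y = mv_plus ?P y x"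
      by (rule eqI) (simp_all add: cl x y ops mem mv_algebra.plus_comm[OF assms])
    show "mv_plus ?P (mv_neg ?P (mv_plus ?P (mv_neg ?P x) y)) y = mv_plus ?P (mv_neg ?P (mv_plus ?P (mv_neg ?P y) x)) x"
      by (rule eqI) (simp_all add: cl x y ops mem mv_algebra.lukasiewicz[OF assms])
  next
    fix x assume x: "x \<in> carrier ?P"
    show "mv_plus ?P x (mv_zero ?P) = x"
      by (rule eqI) (simp_all add: cl x ops mem mv_algebra.plus_zero[OF assms])
    show "mv_neg ?P (mv_neg ?P x) = x"
      by (rule eqI) (simp_all add: cl x ops mem mv_algebra.neg_neg[OF assms])
    show "mv_plus ?P x (mv_one ?P) = mv_one ?P"
      by (rule eqI) (simp_all add: cl cl1 x ops mem mv_algebra.plus_one[OF assms])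
  qed (use cl in auto)
qed

lemma mv_iso_trans: "h \<in> mv_iso A B \<Longrightarrow> k \<in> mv_iso B D \<Longrightarrow> k \<circ> h \<in> mv_iso A D"
  using iso_closed[of h A B] by (auto simp: mv_iso_def intro: bij_betw_trans)

lemma mv_iso_inv:
  assumes A: "mv_algebra A" and h: "h \<in> mv_iso A B" shows "inv_into (carrier A) h \<in> mv_iso B A"
proof -
  interpret mv_algebra A by fact
  have b: "bij_betw h K (carrier B)" using h by (simp add: mv_iso_def)
  have i: "inv_into K h (h x) = x" if "x \<in> K" for x using b that by (simp add: bij_betw_def)
  have hom: "h nought = mv_zero B" "x \<in> K \<Longrightarrow> h (\<sim> x) = mv_neg B (h x)"
    "x \<in> K \<Longrightarrow> y \<in> K \<Longrightarrow> h (x \<boxplus> y) = mv_plus B (h x) (h y)" for x y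
    using h by (simp_all add: mv_iso_def)
  have ex: "\<exists>x\<in>K. y = h x" if "y \<in> carrier B" for y using b that by (auto simp: bij_betw_def)
  have "inv_into K h (mv_neg B y) = \<sim> (inv_into K h y)" if "y \<in> carrier B" for y
    using ex[OF that] by (auto simp: hom(2)[symmetric] i closed)
  moreover have "inv_into K h (mv_plus B y z) = inv_into K h y \<boxplus> inv_into K h z" if "y \<in> carrier B" "z \<in> carrier B" for y z
    using ex[OF that(1)] ex[OF that(2)] by (auto simp: hom(3)[symmetric] i closed)
  moreover have "inv_into K h (mv_zero B) = nought" using i[OF zero_closed] hom(1) by simp
  ultimately show ?thesis using bij_betw_inv_into[OF b] by (simp add: mv_iso_def)
qed

section \<open>Representations of the components\<close>

lemma nat_chain_iso_rep:
  assumes "mv_algebra D" "g \<in> mv_iso D (nat_chain N)"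
  shows "chain_rep (\<lambda>x::int. 0 \<le> x) 1 D (int N) (\<lambda>x. int (g x))" "approx (\<lambda>x::int. 0 \<le> x) 1 (int N) M (int N)"
proof -
  interpret zgroup "\<lambda>x::int. 0 \<le> x" 1 by (rule zgroup_int)
  show "chain_rep (\<lambda>x::int. 0 \<le> x) 1 D (int N) (\<lambda>x. int (g x))"
    by (rule chain_rep_iso[OF nat_chain_rep assms])
  show "approx (\<lambda>x::int. 0 \<le> x) 1 (int N) M (int N)"
    by (rule approx_finite) (simp add: null_def)
qed

lemma infinite_nontrivial:
  assumes "mv_chain C" "infinite (carrier C)" shows "nontrivial_chain C"
proof -
  interpret mv_algebra C using assms chain_algebra by blast
  have "nought \<noteq> unity"
  proof
    assume 0: "nought = unity"
    have "x = nought" if "x \<in> K" for x using plus_one[OF that] plus_zero[OF that] 0 by simp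
    then have "K \<subseteq> {nought}" by blast
    then show False using assms finite_subset by blast
  qed
  then show ?thesis using chain_total[OF assms(1)] by unfold_locales auto
qed

lemma infinite_unit:
  assumes "chain_rep Pos eps C u emb" "infinite (carrier C)" shows "Pos (u - of_int j * eps)"
proof -
  interpret chain_rep Pos eps C u emb by fact
  have "\<not> null Pos (u - of_int (int N) * eps)" for N
  proof
    assume "null Pos (u - of_int (int N) * eps)"
    then obtain h where "h \<in> mv_iso C (nat_chain N)" using iso_nat_chain by blast
    then have "bij_betw h (carrier C) {..N}" by (simp add: mv_iso_def)
    then show False using assms(2) bij_betw_finite by blast
  qed
  then show ?thesis using finite_or_infinite[OF Pos_u] by blast
qed

lemma regular_rep:
  fixes C :: "'a mv"
  assumes C: "mv_chain C" "infinite (carrier C)" "mv_atomic C" "mv_regular C"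
  obtains Pos :: "((int \<times> 'a) multiset \<Rightarrow>\<^sub>0 int) \<Rightarrow> bool" and eps u emb a
  where "chain_rep Pos eps C u emb" "zgroup Pos eps" "\<And>j. Pos (u - of_int j * eps)" "mv_atom C a"
    "null Pos (emb a - eps)" "\<And>q k. mv_D C q k \<longleftrightarrow> D_rep Pos eps C u emb q k"
proof -
  obtain a where a: "mv_atom C a" using C by (auto simp: mv_atomic_def)
  interpret nontrivial_chain C using infinite_nontrivial C by blast
  obtain Pos :: "((int \<times> 'a) multiset \<Rightarrow>\<^sub>0 int) \<Rightarrow> bool" and eps u emb
    where rep: "chain_rep Pos eps C u emb" and gen: "\<And>g. \<exists>m. \<exists>x\<in>K. null Pos (g - of_int m * u - emb x)"
    and e: "null Pos (emb a - eps)"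
    and D: "\<And>q k. mv_D C q k \<longleftrightarrow> (\<exists>x\<in>K. mv_increasing_multiples C (q - 1) x
       \<and> (\<exists>j. null Pos (of_int (int q) * emb x - of_int (int k) * eps - of_int j * u)))"
    by (rule chang_rep[OF a]) blast
  have inf: "Pos (u - of_int j * eps)" for j by (rule infinite_unit[OF rep C(2)])
  show ?thesis
  proof (rule that[OF rep _ inf a e])
    show "zgroup Pos eps" by (rule chain_rep.regular_zgroup[OF rep gen C(4) inf])
    show "mv_D C q k \<longleftrightarrow> D_rep Pos eps C u emb q k" for q k unfolding D D_rep_def ..
  qed
qed

lemma divisible_regular:
  assumes C: "mv_chain C" "infinite (carrier C)" and div: "\<And>k. k \<ge> 1 \<Longrightarrow> holds C (divisible_form k)"
  shows "mv_atomic C \<and> mv_regular C"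
proof -
  interpret nontrivial_chain C using infinite_nontrivial C by blast
  have ex: "\<exists>e. mv_atom C e \<and> divisible_chain C e k" if "k \<ge> 1" for k
    using div[OF that] nontrivial unfolding holds_divisible_form by blast
  then obtain a where a: "mv_atom C a" by blast
  \<comment> \<open>Each sentence provides an atom of its own, but the atom of a chain is unique, so
    one atom serves all k.\<close>
  have dv: "divisible_chain C a k" if "k \<ge> 1" for k
    using ex[OF that] the_mv_atom[OF mv_algebra_axioms] a by metis
  obtain Pos :: "((int \<times> 'a) multiset \<Rightarrow>\<^sub>0 int) \<Rightarrow> bool" and eps u emb
    where rep: "chain_rep Pos eps C u emb" and gen: "\<And>g. \<exists>m. \<exists>x\<in>K. null Pos (g - of_int m * u - emb x)"
    and e: "null Pos (emb a - eps)"
    by (rule chang_rep[OF a]) blast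
  have "a \<in> K" using a by (simp add: mv_atom_def)
  then have "zgroup Pos eps" by (rule chain_rep.divisible_zgroup[OF rep gen _ e dv])
  then show ?thesis using zgroup_regular[OF rep] a by (auto simp: mv_atomic_def)
qed

lemma nat_chain_atom: "mv_atom (nat_chain N) a \<longleftrightarrow> a = 1 \<and> N \<ge> 1"
proof -
  have le: "mv_le (nat_chain N) x y \<longleftrightarrow> x \<le> y" if "x \<le> N" "y \<le> N" for x y
    using that by (auto simp: mv_le_def min_def intro!: bexI[of _ "y - x"])
  show ?thesis
  proof
    assume a: "mv_atom (nat_chain N) a"
    then have "a \<le> N" "a \<noteq> 0" and *: "\<And>x. x \<le> N \<Longrightarrow> x \<noteq> 0 \<Longrightarrow> a \<le> x" using le by (auto simp: mv_atom_def)
    then have "N \<ge> 1" by simp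
    then show "a = 1 \<and> N \<ge> 1" using *[of 1] \<open>a \<noteq> 0\<close> by simp
  qed (use le in \<open>auto simp: mv_atom_def\<close>)
qed

lemma finite_chain_divisible:
  assumes "mv_chain C" "finite (carrier C)" "k \<ge> 1" shows "holds C (divisible_form k)"
proof -
  obtain N h where h: "h \<in> mv_iso C (nat_chain N)" using finite_chain_iso assms by blast
  have "holds (nat_chain N) (divisible_form k)"
    unfolding holds_divisible_form nat_chain_atom using nat_chain_divisible[OF assms(3)] by (cases "N = 0") auto
  then show ?thesis using iso_holds[OF chain_algebra[OF assms(1)] h sentences(2)] by blast
qed

lemma holds_nat_chain_size: "N \<ge> 1 \<Longrightarrow> holds (nat_chain M) (size_form N) \<longleftrightarrow> M = N"
  unfolding holds_size_form nat_chain_atom by (auto simp: nat_chain_mult min_def)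

section \<open>Comparison of chains with finite chains and with each other\<close>

definition good_chain where
  "good_chain C \<longleftrightarrow> mv_chain C \<and>
     (finite (carrier C) \<or> infinite (carrier C) \<and> mv_atomic C \<and> mv_regular C)"

text \<open>N is chosen from the chain and the bound M alone, before the copy of the finite chain
  and the parameters of the game. One finite chain thus serves all sentences whose bound is at most
  M. A finite chain is its own approximation; for an infinite one N is a common large remainder of
  u.\<close>

lemma finite_approximation:
  fixes C :: "'a mv"
  assumes C: "good_chain C"
  shows "\<exists>N. \<forall>(D :: 'd mv) c d K V s k g. mv_algebra D \<longrightarrow> g \<in> mv_iso D (nat_chain N) \<longrightarrow>
    const_agree K C c D d \<longrightarrow> ef_bound s k \<le> M \<longrightarrow> ef K V s C c D d k (\<lambda>_. mv_zero C) (\<lambda>_. mv_zero D)"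
proof -
  have alg: "mv_algebra C" using C chain_algebra by (auto simp: good_chain_def)
  show ?thesis
  proof (cases "finite (carrier C)")
    case True
    then obtain N h where h: "h \<in> mv_iso C (nat_chain N)" using finite_chain_iso[of C] C unfolding good_chain_def by blast
    show ?thesis
    proof (intro exI[of _ N] allI impI)
      fix D :: "'d mv" and c d K V s k g
      assume D: "mv_algebra D" "g \<in> mv_iso D (nat_chain N)" and c: "const_agree K C c D d"
      note C' = nat_chain_iso_rep[OF alg h] and D' = nat_chain_iso_rep[OF D]
      show "ef K V s C c D d k (\<lambda>_. mv_zero C) (\<lambda>_. mv_zero D)"
        by (rule ef_chain[OF C'(1) zgroup_int D'(1) zgroup_int c _ _ approx_lin_eq[OF C'(1) D'(1) C'(2) D'(2)]])
          (simp_all add: mv_algebra.zero_closed alg D)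
    qed
  next
    case False
    then have ch: "mv_chain C" "infinite (carrier C)" "mv_atomic C" "mv_regular C" using C by (auto simp: good_chain_def)
    obtain Pos :: "((int \<times> 'a) multiset \<Rightarrow>\<^sub>0 int) \<Rightarrow> bool" and eps u emb a
      where rep: "chain_rep Pos eps C u emb" "zgroup Pos eps" and inf: "\<And>j. Pos (u - of_int j * eps)"
      by (rule regular_rep[OF ch]) blast
    obtain N where N: "N > M" "N \<ge> 0" "\<And>m. m \<in> {1..M} \<Longrightarrow> Div Pos m (u - of_int N * eps)"
      using zgroup.exists_common_remainder[OF rep(2)] by blast
    have ap: "approx Pos eps u M N"
      by (rule discrete_group.approx_infinite[OF chain_rep.axioms(1)[OF rep(1)] inf N(1,3)])
    show ?thesis
    proof (intro exI[of _ "nat N"] allI impI)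
      fix D :: "'d mv" and c d K V s k g
      assume D: "mv_algebra D" "g \<in> mv_iso D (nat_chain (nat N))" and c: "const_agree K C c D d" and M: "ef_bound s k \<le> M"
      note D' = nat_chain_iso_rep[OF D]
      have "approx (\<lambda>x::int. 0 \<le> x) 1 (int (nat N)) M N" using D'(2) N(2) by simp
      from lin_eq_mono[OF approx_lin_eq[OF rep(1) D'(1) ap this] M]
      show "ef K V s C c D d k (\<lambda>_. mv_zero C) (\<lambda>_. mv_zero D)"
        by (intro ef_chain[OF rep D'(1) zgroup_int c]) (simp_all add: mv_algebra.zero_closed alg D)
    qed
  qed
qed

definition matching_chains where
  "matching_chains C C' \<longleftrightarrow> finite (carrier C) \<and> finite (carrier C') \<and> mv_iso C C' \<noteq> {} \<or>
     infinite (carrier C) \<and> infinite (carrier C') \<and>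
     (\<forall>p m k. prime (p::nat) \<and> m \<ge> 1 \<and> k \<le> p ^ m - 1 \<longrightarrow> (mv_D C (p ^ m) k \<longleftrightarrow> mv_D C' (p ^ m) k))"

text \<open>Equal residues let a single integer N approximate both units, and the agreement of the
  initial positions passes through N. For finite chains both units are equal to the same
  integer.\<close>

lemma ef_matching_chains:
  fixes C :: "'a mv" and C' :: "'b mv"
  assumes C: "good_chain C" "good_chain C'" and match: "matching_chains C C'" and c: "const_agree K C c C' c'"
  shows "ef K V s C c C' c' k (\<lambda>_. mv_zero C) (\<lambda>_. mv_zero C')"
proof -
  have alg: "mv_algebra C" "mv_algebra C'" using C chain_algebra by (auto simp: good_chain_def)
  show ?thesis
  proof (cases "finite (carrier C)")
    case True
    then obtain g where fin: "finite (carrier C')" "g \<in> mv_iso C C'" using match by (auto simp: matching_chains_def)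
    obtain N h where h: "h \<in> mv_iso C' (nat_chain N)"
      using finite_chain_iso[of C'] C(2) fin unfolding good_chain_def by blast
    note r = nat_chain_iso_rep[OF alg(1) mv_iso_trans[OF fin(2) h]] and r' = nat_chain_iso_rep[OF alg(2) h]
    show ?thesis
      by (rule ef_chain[OF r(1) zgroup_int r'(1) zgroup_int c _ _ approx_lin_eq[OF r(1) r'(1) r(2) r'(2)]])
        (simp_all add: mv_algebra.zero_closed alg)
  next
    case False
    then have ch: "mv_chain C" "infinite (carrier C)" "mv_atomic C" "mv_regular C"
      and ch': "mv_chain C'" "infinite (carrier C')" "mv_atomic C'" "mv_regular C'"
      and D: "\<And>p m k. prime (p::nat) \<Longrightarrow> m \<ge> 1 \<Longrightarrow> k \<le> p ^ m - 1 \<Longrightarrow> mv_D C (p ^ m) k \<longleftrightarrow> mv_D C' (p ^ m) k"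
      using C match by (auto simp: good_chain_def matching_chains_def)
    obtain Pos :: "((int \<times> 'a) multiset \<Rightarrow>\<^sub>0 int) \<Rightarrow> bool" and eps u emb a
      where r: "chain_rep Pos eps C u emb" "zgroup Pos eps" and inf: "\<And>j. Pos (u - of_int j * eps)"
      and Dr: "\<And>q k. mv_D C q k \<longleftrightarrow> D_rep Pos eps C u emb q k"
      by (rule regular_rep[OF ch]) blast
    obtain Pos' :: "((int \<times> 'b) multiset \<Rightarrow>\<^sub>0 int) \<Rightarrow> bool" and eps' u' emb' a'
      where r': "chain_rep Pos' eps' C' u' emb'" "zgroup Pos' eps'" and inf': "\<And>j. Pos' (u' - of_int j * eps')"
      and Dr': "\<And>q k. mv_D C' q k \<longleftrightarrow> D_rep Pos' eps' C' u' emb' q k"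
      by (rule regular_rep[OF ch']) blast
    have "same_residues Pos eps u Pos' eps' u'"
      by (rule same_residuesI[OF r r' inf inf' D[unfolded Dr Dr']])
    then obtain N where "approx Pos eps u (ef_bound s k) N" "approx Pos' eps' u' (ef_bound s k) N"
      by (rule same_residues_approx[OF r(2) r'(2) inf inf'])
    from approx_lin_eq[OF r(1) r'(1) this] show ?thesis
      by (intro ef_chain[OF r r' c]) (simp_all add: mv_algebra.zero_closed alg)
  qed
qed

section \<open>Pseudofinite algebras\<close>

lemma pseudofinite_valid:
  fixes A :: "'a mv"
  assumes P: "mv_pseudofinite TYPE('i::infinite) TYPE('c::infinite) n A" and A: "mv_algebra A"
    and \<phi>: "form_consts \<phi> = {}"
    and valid: "\<And>(B :: 'c mv) (C :: nat \<Rightarrow> 'c mv) h. mv_algebra B \<Longrightarrow> finite (carrier B) \<Longrightarrow>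
      mv_chain_decomposition n B C h \<Longrightarrow> valid B (\<lambda>_. mv_zero B) \<phi>"
  shows "valid A (\<lambda>_. mv_zero A) \<phi>"
proof -
  obtain I :: "'i set" and F and B :: "'i \<Rightarrow> 'c mv" where F: "ultrafilter_on I F"
    and B: "\<And>i. i \<in> I \<Longrightarrow> mv_algebra (B i) \<and> finite (carrier (B i))
          \<and> (\<exists>(C :: nat \<Rightarrow> 'c mv) h. mv_chain_decomposition n (B i) C h)"
    and eq: "mv_elem_equiv 0 A (\<lambda>_. mv_zero A) (mv_ultraproduct I F B) (\<lambda>_. mv_zero (mv_ultraproduct I F B))"
    using P unfolding mv_pseudofinite_def by blast
  have Ba: "mv_algebra (B i)" if "i \<in> I" for i using B that by blast
  have s: "univ_closure \<phi> \<in> mv_sentences 0" using \<phi> by (intro univ_closure_sentence) simp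
  have "sat (B i) (\<lambda>_. mv_zero (B i)) (\<lambda>_. mv_zero (B i)) (univ_closure \<phi>)" if i: "i \<in> I" for i
    using B[OF i] valid sat_univ_closure[of "\<lambda>_. mv_zero (B i)" "B i"] mv_algebra.zero_closed[OF Ba[OF i]] by blast
  moreover have "eventually (\<lambda>i. i \<in> I) F" using F by (simp add: ultrafilter_on_def le_principal)
  ultimately have "eventually (\<lambda>i. sat (B i) (\<lambda>_. mv_zero (B i)) (\<lambda>_. mv_zero (B i)) (univ_closure \<phi>)) F"
    by (rule eventually_mono[rotated])
  moreover have "sat (mv_ultraproduct I F B) (\<lambda>_. mv_zero (mv_ultraproduct I F B)) (\<lambda>_. mv_zero (mv_ultraproduct I F B)) (univ_closure \<phi>)
      \<longleftrightarrow> eventually (\<lambda>i. sat (B i) (\<lambda>_. mv_zero (B i)) (\<lambda>_. mv_zero (B i)) (univ_closure \<phi>)) F"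
    by (rule Los_sentence[OF F _ s]) (rule Ba)
  ultimately have "sat (mv_ultraproduct I F B) (\<lambda>_. mv_zero (mv_ultraproduct I F B)) (\<lambda>_. mv_zero (mv_ultraproduct I F B)) (univ_closure \<phi>)"
    by blast
  then have "sat A (\<lambda>_. mv_zero A) (\<lambda>_. mv_zero A) (univ_closure \<phi>)"
    using eq s unfolding mv_elem_equiv_def by blast
  then show ?thesis using sat_univ_closure[of "\<lambda>_. mv_zero A" A] mv_algebra.zero_closed[OF A] by blast
qed

lemma form_consts_decomposes_form: "form_consts (decomposes_form n) = {}"
proof -
  have "form_consts (rel (Var (9 + i)) lin_form) = {}" for i
    using form_consts_rel[of "Var (9 + i)" lin_form] sentences(1) by (auto simp: mv_sentences_def)
  then show ?thesis by (simp add: decomposes_form_def corner_hom_form_def)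
qed

text \<open>One tuple e has to work for infinitely many divisibility conditions, without
  compactness. It is chosen first, and each condition is then obtained from an implication valid for
  every decomposing tuple: in a finite algebra its corners are finite chains, so they have division
  with remainder.\<close>

theorem pseudofinite_decomposition:
  fixes A :: "'a mv"
  assumes P: "mv_pseudofinite TYPE('i::infinite) TYPE('c::infinite) n A" and A: "mv_algebra A"
  shows "\<exists>(C :: nat \<Rightarrow> 'a mv) h. mv_chain_decomposition n A C h \<and> (\<forall>i\<in>{1..n}. good_chain (C i))"
proof -
  interpret mv_algebra A by fact
  note pv = pseudofinite_valid[OF P A]
  \<comment> \<open>This is an existential closure over the variables 10, ..., 9 + n, which stand
    for e 1, ..., e n.\<close>
  have "valid A (\<lambda>_. nought) (FNot (FAlls [10..<10 + n] (FNot (decomposes_form n))))"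
  proof (rule pv)
    fix B :: "'c mv" and C :: "nat \<Rightarrow> 'c mv" and h
    assume B: "mv_algebra B" "mv_chain_decomposition n B C h"
    interpret B: decomposition B n C h using B by (simp add: decomposition_def decomposition_axioms_def)
    show "valid B (\<lambda>_. mv_zero B) (FNot (FAlls [10..<10 + n] (FNot (decomposes_form n))))"
      unfolding valid_def
    proof (intro allI impI)
      fix v :: "nat \<Rightarrow> _" assume v: "\<forall>x. v x \<in> carrier B"
      define w where "w x = (if x \<in> {10..<10 + n} then B.e (x - 9) else v x)" for x
      have w: "w x \<in> carrier B" for x
      proof (cases "x \<in> {10..<10 + n}")
        case True
        then have "x - 9 \<in> {1..n}" by auto
        then show ?thesis using True B.component_one(1) by (simp add: w_def)
      next
        case False
        then show ?thesis by (simp only: w_def if_False v)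
      qed
      have "decomposes n B (\<lambda>i. w (9 + i))" by (rule B.decomposes_component_one) (auto simp: w_def)
      then have "sat B (\<lambda>_. mv_zero B) w (decomposes_form n)" using sat_decomposes_form[of w B] w by blast
      moreover have "\<forall>x. x \<notin> set [10..<10 + n] \<longrightarrow> w x = v x" by (auto simp: w_def)
      ultimately show "sat B (\<lambda>_. mv_zero B) v (FNot (FAlls [10..<10 + n] (FNot (decomposes_form n))))"
        using w v sat_FAlls[of v B "\<lambda>_. mv_zero B" "[10..<10 + n]" "FNot (decomposes_form n)"] by auto
    qed
  qed (simp add: form_consts_decomposes_form)
  then have "\<not> sat A (\<lambda>_. nought) (\<lambda>_. nought) (FAlls [10..<10 + n] (FNot (decomposes_form n)))"
    using zero_closed by (simp add: valid_def)
  then obtain w where w: "\<And>x. w x \<in> K" "sat A (\<lambda>_. nought) w (decomposes_form n)"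
    using sat_FAlls[of "\<lambda>_. nought" A "\<lambda>_. nought" "[10..<10 + n]" "FNot (decomposes_form n)"] zero_closed by auto
  define e where "e i = w (9 + i)" for i
  have e: "e i \<in> K" for i using w by (simp add: e_def)
  have dec: "decomposes n A e" using sat_decomposes_form[of w A] w unfolding e_def by blast
  note dec' = decomposes_decomposition[OF A e dec]
  have div: "holds (corner A (e i)) (divisible_form k)" if k: "k \<ge> 1" and i: "i \<in> {1..n}" for k i
  proof -
    let ?\<psi> = "FImp (decomposes_form n) (FAnds (map (\<lambda>i. rel (Var (9 + i)) (divisible_form k)) [1..<Suc n]))"
    have "form_consts (rel (Var (9 + i)) (divisible_form k)) = {}" for i
      using form_consts_rel[of "Var (9 + i)" "divisible_form k"] sentences(2)[of k] by (auto simp: mv_sentences_def)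
    then have c: "form_consts ?\<psi> = {}" by (simp add: form_consts_decomposes_form)
    have "valid A (\<lambda>_. nought) ?\<psi>"
    proof (rule pv[OF c])
      fix B :: "'c mv" assume B: "mv_algebra B" "finite (carrier B)"
      show "valid B (\<lambda>_. mv_zero B) ?\<psi>"
        unfolding valid_def
      proof (intro allI impI)
        fix v :: "nat \<Rightarrow> _" assume v: "\<forall>x. v x \<in> carrier B"
        have "holds (corner B (v (9 + i))) (divisible_form k)"
          if d: "decomposes n B (\<lambda>i. v (9 + i))" and i: "i \<in> {1..n}" for i
        proof (rule finite_chain_divisible[OF _ _ k])
          have "mv_chain_decomposition n B (\<lambda>i. corner B (v (9 + i))) (\<lambda>x. \<lambda>i\<in>{1..n}. mv_times B x (v (9 + i)))"
            by (rule decomposes_decomposition[OF B(1) _ d]) (use v in blast)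
          then show "mv_chain (corner B (v (9 + i)))" using i unfolding mv_chain_decomposition_def by blast
          show "finite (carrier (corner B (v (9 + i))))" using B(2) by simp
        qed
        then show "sat B (\<lambda>_. mv_zero B) v ?\<psi>"
          using sat_decomposes_form[of v B] v
          by (simp add: sat_rel_var[OF sentences(2) form_vars_small(2)] atLeastLessThanSuc_atLeastAtMost del: upt_Suc)
      qed
    qed
    then have "sat A (\<lambda>_. nought) w ?\<psi>" using w by (simp add: valid_def)
    then show ?thesis
      using w(2) i unfolding e_def
      by (simp add: sat_rel_var[OF sentences(2) form_vars_small(2)] atLeastLessThanSuc_atLeastAtMost del: upt_Suc)
  qed
  have "good_chain (corner A (e i))" if i: "i \<in> {1..n}" for i
  proof -
    have ch: "mv_chain (corner A (e i))" using dec' i unfolding mv_chain_decomposition_def by blast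
    then show ?thesis using divisible_regular[OF ch _ div[OF _ i]] unfolding good_chain_def by blast
  qed
  then show ?thesis using dec' by blast
qed

text \<open>A copy of the natural numbers inside the index type, with an ultrafilter finer than the
  sequential one, so that every final segment is large.\<close>

lemma exists_infinite_filter:
  obtains f :: "nat \<Rightarrow> 'i::infinite" and F where "inj f" "ultrafilter_on (range f) F"
    "\<And>M. eventually (\<lambda>x. M \<le> inv_into UNIV f x) F"
proof -
  obtain f :: "nat \<Rightarrow> 'i" where f: "inj f"
    using infinite_countable_subset[OF infinite_UNIV[where 'a = 'i]] by blast
  have "filtermap f sequentially \<noteq> bot" by (simp add: filtermap_bot_iff)
  then obtain F where F: "F \<le> filtermap f sequentially" "F \<noteq> bot" "\<And>P. eventually P F \<or> eventually (\<lambda>i. \<not> P i) F"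
    by (rule exists_ultrafilter) blast
  have "filtermap f sequentially \<le> principal (range f)"
    by (simp add: le_principal eventually_filtermap)
  then have "ultrafilter_on (range f) F" using F order_trans by (auto simp: ultrafilter_on_def)
  moreover have "eventually (\<lambda>x. M \<le> inv_into UNIV f x) F" for M
  proof (rule filter_leD[OF F(1)])
    show "eventually (\<lambda>x. M \<le> inv_into UNIV f x) (filtermap f sequentially)"
      using f by (simp add: eventually_filtermap inv_f_f eventually_ge_at_top)
  qed
  ultimately show ?thesis using f that by blast
qed

text \<open>The j-th algebra is the product of finite chains approximating the factors up to the
  bound j. A given sentence has a fixed game bound, so it cannot distinguish A from any algebra with
  larger index, and these indices form a large set.\<close>

theorem decomposition_pseudofinite:
  fixes A :: "'a mv" and C :: "nat \<Rightarrow> 'b mv"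
  assumes A: "mv_algebra A" and dec: "mv_chain_decomposition n A C h"
    and good: "\<And>i. i \<in> {1..n} \<Longrightarrow> good_chain (C i)"
  shows "mv_pseudofinite TYPE('i::infinite) TYPE('c::infinite) n A"
proof -
  interpret A: decomposition A n C h using A dec by (simp add: decomposition_def decomposition_axioms_def)
  obtain f :: "nat \<Rightarrow> 'i" and F where f: "inj f" and F: "ultrafilter_on (range f) F"
    and F_large: "\<And>M. eventually (\<lambda>x. M \<le> inv_into UNIV f x) F"
    by (rule exists_infinite_filter) blast
  obtain g :: "nat \<Rightarrow> 'c" where g: "inj g"
    using infinite_countable_subset[OF infinite_UNIV[where 'a = 'c]] by blast
  have "\<exists>N. \<forall>(D :: 'c mv) c d K V s k g. mv_algebra D \<longrightarrow> g \<in> mv_iso D (nat_chain N) \<longrightarrow>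
      const_agree K (C i) c D d \<longrightarrow> ef_bound s k \<le> int j \<longrightarrow> ef K V s (C i) c D d k (\<lambda>_. mv_zero (C i)) (\<lambda>_. mv_zero D)"
    if "i \<in> {1..n}" for i j using finite_approximation[OF good[OF that]] .
  then obtain N where N: "\<And>i j (D :: 'c mv) c d K V s k g. i \<in> {1..n} \<Longrightarrow> mv_algebra D \<Longrightarrow> g \<in> mv_iso D (nat_chain (N i j)) \<Longrightarrow>
      const_agree K (C i) c D d \<Longrightarrow> ef_bound s k \<le> int j \<Longrightarrow> ef K V s (C i) c D d k (\<lambda>_. mv_zero (C i)) (\<lambda>_. mv_zero D)"
    by metis
  define D where "D j i = transport (nat_chain (N i j)) g" for i j
  have D: "mv_algebra (D j i)" "inv_into {..N i j} g \<in> mv_iso (D j i) (nat_chain (N i j))" "finite (carrier (D j i))" for i j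
    using transport[OF nat_chain_algebra, of g "N i j"] inj_on_subset[OF g] by (auto simp: D_def)
  have D_chain: "mv_chain (D j i)" for i j
    by (rule chain_rep.chain[OF nat_chain_iso_rep(1)[OF D(1,2)]])
  define P where "P j = mv_prod {1..n} (D j)" for j
  have P: "mv_algebra (P j)" "finite (carrier (P j))" for j
    unfolding P_def by (rule mv_prod_algebra[OF D(1)]) (simp add: mv_prod_def finite_PiE D(3))
  \<comment> \<open>The product consists of functions into 'c. Being finite, it can be numbered and
    then injected into 'c itself.\<close>
  have "\<exists>g' :: (nat \<Rightarrow> 'c) \<Rightarrow> 'c. inj_on g' (carrier (P j))" for j
  proof -
    obtain g0 :: "(nat \<Rightarrow> 'c) \<Rightarrow> nat" where "inj_on g0 (carrier (P j))"
      using finite_imp_inj_to_nat_seg[OF P(2)] by blast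
    then have "inj_on (g \<circ> g0) (carrier (P j))" using g by (simp add: comp_inj_on inj_on_subset)
    then show ?thesis by blast
  qed
  then obtain g' :: "nat \<Rightarrow> (nat \<Rightarrow> 'c) \<Rightarrow> 'c" where g': "\<And>j. inj_on (g' j) (carrier (P j))" by metis
  define B where "B j = transport (P j) (g' j)" for j
  define h' where "h' j = inv_into (carrier (P j)) (g' j)" for j
  have B: "mv_algebra (B j)" "h' j \<in> mv_iso (B j) (mv_prod {1..n} (D j))" "finite (carrier (B j))" for j
    using transport[OF P(1) g'] P(2) by (auto simp: B_def h'_def P_def)
  have B_dec: "mv_chain_decomposition n (B j) (D j) (h' j)" for j
    unfolding mv_chain_decomposition_def using D_chain B(2) by blast
  define E where "E x = B (inv_into UNIV f x)" for x
  have E: "mv_algebra (E x)" for x using B(1) by (simp add: E_def)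
  let ?U = "mv_ultraproduct (range f) F E"
  have "mv_elem_equiv 0 A (\<lambda>_. mv_zero A) ?U (\<lambda>_. mv_zero ?U)"
    unfolding mv_elem_equiv_def
  proof
    fix \<phi> assume \<phi>: "\<phi> \<in> mv_sentences 0"
    define s where "s = form_size \<phi>"
    define k where "k = form_rank \<phi>"
    obtain V where V: "form_vars \<phi> \<subseteq> {..<V}" using finite_nat_iff_bounded finite_form_vars by blast
    have *: "sat A (\<lambda>_. mv_zero A) (\<lambda>_. mv_zero A) \<phi> \<longleftrightarrow> sat (B j) (\<lambda>_. mv_zero (B j)) (\<lambda>_. mv_zero (B j)) \<phi>"
      if j: "ef_bound s k \<le> int j" for j
    proof -
      have "ef {} V s A (\<lambda>_. mv_zero A) (B j) (\<lambda>_. mv_zero (B j)) k (\<lambda>_. mv_zero A) (\<lambda>_. mv_zero (B j))"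
      proof (rule ef_prod[OF A A.iso B(1,2)])
        fix i assume i: "i \<in> {1..n}"
        have z: "h (mv_zero A) i = mv_zero (C i)" "h' j (mv_zero (B j)) i = mv_zero (D j i)"
          using A.hom(3)[OF i A.zero_closed A.zero_closed]
            prod_hom(3)[OF B(2,1) i mv_algebra.zero_closed[OF B(1)] mv_algebra.zero_closed[OF B(1)]] by auto
        show "ef {} V s (C i) (\<lambda>l. h (mv_zero A) i) (D j i) (\<lambda>l. h' j (mv_zero (B j)) i) k
            (\<lambda>x. h (mv_zero A) i) (\<lambda>x. h' j (mv_zero (B j)) i)"
          unfolding z by (rule N[OF i D(1,2) _ j]) (simp add: const_agree_def)
      qed (simp_all add: A.zero_closed mv_algebra.zero_closed[OF B(1)])
      then show ?thesis
        by (rule ef_sat) (use V \<phi> in \<open>simp_all add: s_def k_def mv_sentences_def\<close>)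
    qed
    have ev: "eventually (\<lambda>x. sat A (\<lambda>_. mv_zero A) (\<lambda>_. mv_zero A) \<phi> \<longleftrightarrow>
        sat (E x) (\<lambda>_. mv_zero (E x)) (\<lambda>_. mv_zero (E x)) \<phi>) F"
      using F_large[of "nat (ef_bound s k)"] by eventually_elim (use * in \<open>simp add: E_def\<close>)
    have "sat ?U (\<lambda>_. mv_zero ?U) (\<lambda>_. mv_zero ?U) \<phi> \<longleftrightarrow>
        eventually (\<lambda>x. sat (E x) (\<lambda>_. mv_zero (E x)) (\<lambda>_. mv_zero (E x)) \<phi>) F"
      by (rule Los_sentence[OF F E \<phi>])
    also have "\<dots> \<longleftrightarrow> eventually (\<lambda>x. sat A (\<lambda>_. mv_zero A) (\<lambda>_. mv_zero A) \<phi>) F"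
      by (rule eventually_cong[OF ev]) auto
    also have "\<dots> \<longleftrightarrow> sat A (\<lambda>_. mv_zero A) (\<lambda>_. mv_zero A) \<phi>"
      using F unfolding ultrafilter_on_def by (auto simp: eventually_const_iff)
    finally show "sat A (\<lambda>_. mv_zero A) (\<lambda>_. mv_zero A) \<phi> \<longleftrightarrow> sat ?U (\<lambda>_. mv_zero ?U) (\<lambda>_. mv_zero ?U) \<phi>" by simp
  qed
  moreover have "mv_algebra (E x) \<and> finite (carrier (E x)) \<and>
      (\<exists>(C :: nat \<Rightarrow> 'c mv) h. mv_chain_decomposition n (E x) C h)" for x
    using B B_dec unfolding E_def by blast
  ultimately show ?thesis unfolding mv_pseudofinite_def using F by blast
qed

section \<open>Elementary equivalence\<close>

text \<open>The constant for 1_i makes the theory of the i-th factor part of the theory in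
  \<open>L_MVn\<close>, by relativization to the interval below it.\<close>

lemma (in decomposition) valid_rel_component:
  assumes i: "i \<in> {1..n}" and \<phi>: "\<phi> \<in> mv_sentences 0"
  shows "valid A e (rel (Const i) \<phi>) \<longleftrightarrow> holds (C i) \<phi>"
proof -
  have "corner_hom A (e i)" using decomposes_component_one[of e] i by (simp add: decomposes_def)
  then have alg: "mv_algebra (corner A (e i))" using corner_algebra[OF mv_algebra_axioms component_one(1)[OF i]] by blast
  have "sat A e v (rel (Const i) \<phi>) \<longleftrightarrow> holds (C i) \<phi>" for v
    using sat_rel[of "Const i" \<phi> A e v] sat_holds[OF \<phi>, of "corner A (e i)" e v] iso_holds[OF alg corner_iso[OF i] \<phi>] by simp
  then show ?thesis unfolding valid_def using zero_closed by auto
qed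

text \<open>A quotient of u - r eps by k automatically lies in [0, u], because u exceeds all
  multiples of eps; so divisibility in the group is already witnessed in the chain.\<close>

lemma holds_residue_form_rep:
  assumes rep: "chain_rep Pos eps C u emb" and inf: "\<And>j. Pos (u - of_int j * eps)"
    and a: "mv_atom C a" "null Pos (emb a - eps)" and r: "r \<ge> 1" and k: "k \<ge> 1"
  shows "holds C (residue_form k r) \<longleftrightarrow> Div Pos (int k) (u - of_int (int r) * eps)"
proof -
  interpret chain_rep Pos eps C u emb by fact
  have aK: "a \<in> K" using a by (simp add: mv_atom_def)
  have "holds C (residue_form k r) \<longleftrightarrow> (\<exists>x\<in>K.
     mv_plus C (mv_mult C k x) (mv_mult C r a) = unity \<and> mv_plus C (mv_mult C k x) (mv_mult C (r - 1) a) \<noteq> unity)"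
    unfolding holds_residue_form using the_mv_atom[OF mv_algebra_axioms] a(1) by metis
  also have "\<dots> \<longleftrightarrow> Div Pos (int k) (u - of_int (int r) * eps)"
  proof
    assume "\<exists>x\<in>K. mv_plus C (mv_mult C k x) (mv_mult C r a) = unity \<and> mv_plus C (mv_mult C k x) (mv_mult C (r - 1) a) \<noteq> unity"
    then obtain x where x: "x \<in> K" "mv_plus C (mv_mult C k x) (mv_mult C r a) = unity"
      "mv_plus C (mv_mult C k x) (mv_mult C (r - 1) a) \<noteq> unity" by blast
    from null_diff[OF exact_division[OF aK a(2) x(1) r x(2,3)] emb_one]
    have "null Pos ((u - of_int (int r) * eps) - of_int (int k) * emb x)"
      using null_commute by (simp add: algebra_simps)
    then show "Div Pos (int k) (u - of_int (int r) * eps)" unfolding Div_def by blast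
  next
    assume "Div Pos (int k) (u - of_int (int r) * eps)"
    then obtain z where z: "null Pos (u - of_int (int r) * eps - of_int (int k) * z)" unfolding Div_def by blast
    have kz: "Pos (of_int (int k) * z)" using Pos_null[OF z] inf by blast
    then have Pz: "Pos z" using Pos_cancel[of "int k" z] k by simp
    have ukz: "null Pos ((u - of_int (int k) * z) - of_int (int r) * eps)" using z by (simp add: algebra_simps)
    have uk: "Pos (u - of_int (int k) * z)"
      using Pos_null[OF ukz] Pos_of_int_eps[of "int r"] by simp
    have "Pos (of_int (int k - 1) * z)" by (rule Pos_mult) (use k Pz in auto)
    from Pos_add[OF uk this] have "Pos (u - z)" by (simp add: algebra_simps)
    then obtain x where x: "x \<in> K" "null Pos (emb x - z)" using emb_surj Pz by blast
    have kx: "null Pos (of_int (int k) * emb x - of_int (int k) * z)"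
      using null_mult[OF x(2), of "int k"] by (simp add: algebra_simps)
    have "Pos (u - of_int (int k) * emb x) \<longleftrightarrow> Pos (u - of_int (int k) * z)"
      by (rule Pos_null) (use null_minus[OF kx] in simp)
    then have "null Pos (emb (mv_mult C k x) - of_int (int k) * emb x)" using emb_mult[OF x(1)] uk by blast
    from null_add[OF this kx] have m: "null Pos (emb (mv_mult C k x) - of_int (int k) * z)" by simp
    have ja: "null Pos (emb (mv_mult C j a) - of_int (int j) * eps)" for j
    proof -
      have n: "null Pos (of_int (int j) * emb a - of_int (int j) * eps)"
        using null_mult[OF a(2), of "int j"] by (simp add: algebra_simps)
      have "Pos (u - of_int (int j) * emb a) \<longleftrightarrow> Pos (u - of_int (int j) * eps)"
        by (rule Pos_null) (use null_minus[OF n] in simp)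
      then have "null Pos (emb (mv_mult C j a) - of_int (int j) * emb a)" using emb_mult[OF aK] inf by blast
      from null_add[OF this n] show ?thesis by simp
    qed
    let ?m = "mv_mult C k x"
    have cl: "?m \<in> K" "mv_mult C j a \<in> K" for j using mult_closed x aK by auto
    have s: "null Pos ((emb ?m + emb (mv_mult C j a)) - (u - of_int (int r - int j) * eps))" for j
      using null_diff[OF null_add[OF m ja[of j]] ukz] by (simp add: algebra_simps)
    \<comment> \<open>Adding j atoms to k.x leaves the distance (r - j) eps to the unit, so the top
      is reached at j = r and not at r - 1.\<close>
    have val: "null Pos (emb (mv_plus C ?m (mv_mult C j a)) - (u - of_int (int r - int j) * eps))" if "j \<le> r" for j
    proof -
      have "Pos (of_int (int r - int j) * eps)" unfolding Pos_of_int_eps using that by simp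
      moreover have "null Pos ((u - (emb ?m + emb (mv_mult C j a))) - of_int (int r - int j) * eps)"
        using null_minus[OF s[of j]] by (simp add: algebra_simps)
      ultimately have "Pos (u - (emb ?m + emb (mv_mult C j a)))" using Pos_null by blast
      from null_add[OF emb_plus[OF cl(1) cl(2) this] s[of j]] show ?thesis by (simp add: algebra_simps)
    qed
    have "mv_plus C ?m (mv_mult C r a) = unity"
      using null_diff[OF val[of r] emb_one] cl closed emb_inj by simp
    moreover have "mv_plus C ?m (mv_mult C (r - 1) a) \<noteq> unity"
    proof
      assume 1: "mv_plus C ?m (mv_mult C (r - 1) a) = unity"
      have "null Pos (of_int 1 * eps)"
        using null_diff[OF val[of "r - 1", unfolded 1] emb_one] r by (simp add: of_nat_diff)
      then show False unfolding null_eps by simp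
    qed
    ultimately show "\<exists>x\<in>K. mv_plus C (mv_mult C k x) (mv_mult C r a) = unity \<and> mv_plus C (mv_mult C k x) (mv_mult C (r - 1) a) \<noteq> unity"
      using x by blast
  qed
  finally show ?thesis .
qed

text \<open>The size sentence has consequences in an infinite chain too: if a finite multiple of the
  atom is 1, then u is a multiple of eps, whereas in an infinite chain u exceeds all of
  these.\<close>

lemma elementarily_finite:
  fixes C :: "'a mv" and C' :: "'b mv"
  assumes C: "good_chain C" "finite (carrier C)" and C': "good_chain C'"
    and eq: "\<And>\<phi>. \<phi> \<in> mv_sentences 0 \<Longrightarrow> holds C \<phi> \<longleftrightarrow> holds C' \<phi>"
  shows "finite (carrier C') \<and> mv_iso C C' \<noteq> {}"
proof -
  have alg: "mv_algebra C" "mv_algebra C'" using C C' chain_algebra by (auto simp: good_chain_def)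
  obtain N h where h: "h \<in> mv_iso C (nat_chain N)" using finite_chain_iso[of C] C unfolding good_chain_def by blast
  note hN = iso_holds[OF alg(1) h]
  have fin: "finite (carrier C')"
  proof (rule ccontr)
    assume inf: "infinite (carrier C')"
    then have ch: "mv_chain C'" "mv_atomic C'" "mv_regular C'" using C' by (auto simp: good_chain_def)
    interpret nontrivial_chain C' using infinite_nontrivial[OF ch(1) inf] .
    have "\<not> holds C' trivial_form" unfolding holds_trivial_form using nontrivial .
    then have "N \<noteq> 0" using eq[OF sentences(3)] hN[OF sentences(3)] by (auto simp: holds_trivial_form)
    then have "holds C' (size_form N)"
      using eq[OF sentences(4)] hN[OF sentences(4)] holds_nat_chain_size[of N N] by auto
    then obtain b where b: "mv_atom C' b" "mv_mult C' N b = unity" unfolding holds_size_form by blast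
    obtain Pos :: "((int \<times> 'b) multiset \<Rightarrow>\<^sub>0 int) \<Rightarrow> bool" and eps u emb
      where rep: "chain_rep Pos eps C' u emb" and e: "null Pos (emb b - eps)"
      by (rule chang_rep[OF b(1)]) blast
    interpret R: chain_rep Pos eps C' u emb by fact
    have bK: "b \<in> K" using b by (simp add: mv_atom_def)
    have n: "null Pos (of_int (int N) * emb b - of_int (int N) * eps)"
      using R.null_mult[OF e, of "int N"] by (simp add: algebra_simps)
    have "Pos (u - of_int (int N) * emb b) \<longleftrightarrow> Pos (u - of_int (int N) * eps)"
      by (rule R.Pos_null) (use R.null_minus[OF n] in simp)
    then have "null Pos (emb unity - of_int (int N) * emb b)"
      using R.emb_mult[OF bK, of N] infinite_unit[OF rep inf, of "int N"] b(2) by simp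
    from R.null_diff[OF R.null_add[OF this n] R.emb_one] have "null Pos (u - of_int (int N) * eps)" by simp
    then have "Pos (of_int (int N) * eps - u)" by (simp add: null_def)
    from R.Pos_add[OF this infinite_unit[OF rep inf, of "int N + 1"]] show False
      using R.eps_pos by (simp add: algebra_simps)
  qed
  obtain N' h' where h': "h' \<in> mv_iso C' (nat_chain N')" using finite_chain_iso[of C'] C' fin unfolding good_chain_def by blast
  note hN' = iso_holds[OF alg(2) h']
  have "N = N'"
  proof (cases "N = 0")
    case True
    then have "holds (nat_chain N') trivial_form"
      using eq[OF sentences(3)] hN[OF sentences(3)] hN'[OF sentences(3)] by (simp add: holds_trivial_form)
    then show ?thesis using True by (simp add: holds_trivial_form)
  next
    case False
    then have "holds (nat_chain N') (size_form N)"
      using eq[OF sentences(4)] hN[OF sentences(4)] hN'[OF sentences(4)] holds_nat_chain_size[of N N] by auto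
    then show ?thesis using False holds_nat_chain_size[of N N'] by simp
  qed
  then have "inv_into (carrier C') h' \<circ> h \<in> mv_iso C C'"
    using mv_iso_trans[OF h] mv_iso_inv[OF alg(2) h'] by blast
  then show ?thesis using fin by blast
qed

text \<open>D is phrased in the Chang group, so the sentences express residues of u instead.
  \<open>D_rep_transfer\<close> leads back from residues to D for all prime powers, including 2, 3
  and 4.\<close>

lemma elementarily_matching:
  fixes C :: "'a mv" and C' :: "'b mv"
  assumes C: "good_chain C" "good_chain C'"
    and eq: "\<And>\<phi>. \<phi> \<in> mv_sentences 0 \<Longrightarrow> holds C \<phi> \<longleftrightarrow> holds C' \<phi>"
  shows "matching_chains C C'"
proof (cases "finite (carrier C) \<or> finite (carrier C')")
  case True
  then have "finite (carrier C)"
    using elementarily_finite[of C' C] C eq by blast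
  then show ?thesis using elementarily_finite[OF C(1) _ C(2) eq] unfolding matching_chains_def by blast
next
  case False
  then have ch: "mv_chain C" "infinite (carrier C)" "mv_atomic C" "mv_regular C"
    and ch': "mv_chain C'" "infinite (carrier C')" "mv_atomic C'" "mv_regular C'"
    using C by (auto simp: good_chain_def)
  obtain Pos :: "((int \<times> 'a) multiset \<Rightarrow>\<^sub>0 int) \<Rightarrow> bool" and eps u emb a
    where r: "chain_rep Pos eps C u emb" "zgroup Pos eps" and inf: "\<And>j. Pos (u - of_int j * eps)"
    and a: "mv_atom C a" "null Pos (emb a - eps)" and D: "\<And>q k. mv_D C q k \<longleftrightarrow> D_rep Pos eps C u emb q k"
    by (rule regular_rep[OF ch]) blast
  obtain Pos' :: "((int \<times> 'b) multiset \<Rightarrow>\<^sub>0 int) \<Rightarrow> bool" and eps' u' emb' a'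
    where r': "chain_rep Pos' eps' C' u' emb'" "zgroup Pos' eps'" and inf': "\<And>j. Pos' (u' - of_int j * eps')"
    and a': "mv_atom C' a'" "null Pos' (emb' a' - eps')" and D': "\<And>q k. mv_D C' q k \<longleftrightarrow> D_rep Pos' eps' C' u' emb' q k"
    by (rule regular_rep[OF ch']) blast
  interpret A: zgroup Pos eps by fact
  interpret B: zgroup Pos' eps' by fact
  have same: "same_residues Pos eps u Pos' eps' u'"
    unfolding same_residues_def
  proof (intro allI impI)
    fix m r :: int assume m: "m \<ge> 1"
    \<comment> \<open>The residue sentences need a positive natural number, so r is replaced by its
      representative between 1 and m.\<close>
    define s where "s = nat ((r - 1) mod m + 1)"
    have r0: "(r - 1) mod m \<ge> 0" using m by simp
    then have s2: "int s = (r - 1) mod m + 1" by (simp add: s_def)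
    then have s: "s \<ge> 1" "int s = (r - 1) mod m + 1" using r0 by linarith+
    have "r - int s = m * ((r - 1) div m)" unfolding s(2) by (simp add: minus_mod_eq_mult_div[symmetric])
    then have d: "m dvd r - int s" "m dvd int s - r" by (auto simp: dvd_diff_commute)
    have "Div Pos m (u - of_int r * eps) \<longleftrightarrow> Div Pos m (u - of_int (int s) * eps)"
      by (rule A.Div_cong) (use A.Div_dvd_mult[OF d(2), of eps] in \<open>simp add: algebra_simps\<close>)
    moreover have "Div Pos' m (u' - of_int r * eps') \<longleftrightarrow> Div Pos' m (u' - of_int (int s) * eps')"
      by (rule B.Div_cong) (use B.Div_dvd_mult[OF d(2), of eps'] in \<open>simp add: algebra_simps\<close>)
    moreover have "Div Pos m (u - of_int (int s) * eps) \<longleftrightarrow> Div Pos' m (u' - of_int (int s) * eps')"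
      using holds_residue_form_rep[OF r(1) inf a s(1), of "nat m"] holds_residue_form_rep[OF r'(1) inf' a' s(1), of "nat m"]
        eq[OF sentences(5), of "nat m" s] m by simp
    ultimately show "Div Pos m (u - of_int r * eps) \<longleftrightarrow> Div Pos' m (u' - of_int r * eps')" by simp
  qed
  have "mv_D C (p ^ m) k \<longleftrightarrow> mv_D C' (p ^ m) k" if "prime p" "m \<ge> 1" "k \<le> p ^ m - 1" for p m k :: nat
  proof -
    have "p ^ 1 \<le> p ^ m" by (rule power_increasing) (use that prime_gt_0_nat[of p] in auto)
    then have q: "p ^ m \<ge> 2" "k < p ^ m" using that prime_ge_2_nat[of p] by auto
    show ?thesis
      unfolding D D' using D_rep_transfer[OF r r' inf inf' same q]
        D_rep_transfer[OF r' r inf' inf same_residues_sym[OF same] q] by blast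
  qed
  then show ?thesis using False unfolding matching_chains_def by blast
qed

text \<open>One direction relativizes sentences to the constants 1_i. The other plays the games of
  the factors simultaneously; it needs the constants in the language to be interpreted by 0 or 1 in
  each factor, at matching places on both sides.\<close>

theorem elem_equiv_iff_matching:
  assumes A: "decomposition A n C h" and A': "decomposition A' n C' h'"
    and C: "\<And>i. i \<in> {1..n} \<Longrightarrow> good_chain (C i)" and C': "\<And>i. i \<in> {1..n} \<Longrightarrow> good_chain (C' i)"
  shows "mv_elem_equiv n A (mv_component_one n A C h) A' (mv_component_one n A' C' h') \<longleftrightarrow>
    (\<forall>i\<in>{1..n}. matching_chains (C i) (C' i))"
proof -
  interpret A: decomposition A n C h by fact
  interpret A': decomposition A' n C' h' by fact
  show ?thesis
  proof
    assume eq: "mv_elem_equiv n A A.e A' A'.e"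
    show "\<forall>i\<in>{1..n}. matching_chains (C i) (C' i)"
    proof
      fix i assume i: "i \<in> {1..n}"
      show "matching_chains (C i) (C' i)"
      proof (rule elementarily_matching[OF C[OF i] C'[OF i]])
        fix \<phi> assume \<phi>: "\<phi> \<in> mv_sentences 0"
        have "form_consts (rel (Const i) \<phi>) \<subseteq> {1..n}"
          using form_consts_rel[of "Const i" \<phi>] \<phi> i by (auto simp: mv_sentences_def)
        from elem_equiv_valid[OF eq this A.mv_algebra_axioms A'.mv_algebra_axioms]
        show "holds (C i) \<phi> \<longleftrightarrow> holds (C' i) \<phi>"
          using A.valid_rel_component[OF i \<phi>] A'.valid_rel_component[OF i \<phi>] by simp
      qed
    qed
  next
    assume match: "\<forall>i\<in>{1..n}. matching_chains (C i) (C' i)"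
    show "mv_elem_equiv n A A.e A' A'.e"
      unfolding mv_elem_equiv_def
    proof
      fix \<phi> assume \<phi>: "\<phi> \<in> mv_sentences n"
      define s where "s = form_size \<phi>"
      define k where "k = form_rank \<phi>"
      obtain V where V: "form_vars \<phi> \<subseteq> {..<V}" using finite_nat_iff_bounded finite_form_vars by blast
      have "ef {1..n} V s A A.e A' A'.e k (\<lambda>_. mv_zero A) (\<lambda>_. mv_zero A')"
      proof (rule ef_prod[OF A.mv_algebra_axioms A.iso A'.mv_algebra_axioms A'.iso])
        fix i assume i: "i \<in> {1..n}"
        have z: "h (mv_zero A) i = mv_zero (C i)" "h' (mv_zero A') i = mv_zero (C' i)"
          using A.hom(3)[OF i A.zero_closed A.zero_closed] A'.hom(3)[OF i A'.zero_closed A'.zero_closed] by auto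
        show "ef {1..n} V s (C i) (\<lambda>j. h (A.e j) i) (C' i) (\<lambda>j. h' (A'.e j) i) k
            (\<lambda>x. h (mv_zero A) i) (\<lambda>x. h' (mv_zero A') i)"
          unfolding z
        proof (rule ef_matching_chains[OF C[OF i] C'[OF i]])
          show "const_agree {1..n} (C i) (\<lambda>j. h (A.e j) i) (C' i) (\<lambda>j. h' (A'.e j) i)"
            unfolding const_agree_def using A.component_one(2)[OF _ i] A'.component_one(2)[OF _ i] by auto
        qed (use match i in blast)
      qed (simp_all add: A.zero_closed A'.zero_closed A.component_one(1) A'.component_one(1))
      then show "sat A A.e (\<lambda>_. mv_zero A) \<phi> \<longleftrightarrow> sat A' A'.e (\<lambda>_. mv_zero A') \<phi>"
        by (rule ef_sat) (use V \<phi> in \<open>simp_all add: s_def k_def mv_sentences_def\<close>)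
    qed
  qed
qed

theorem theorem6p9:
  fixes A :: "'a mv" and A' :: "'b mv" and n :: nat
  assumes "mv_algebra A" and "mv_algebra A'" and "n \<ge> 1"
  shows
    "(mv_pseudofinite TYPE('i::infinite) TYPE('c::infinite) n A \<longleftrightarrow>
        mv_projectable A \<and>
        (\<exists>(C :: nat \<Rightarrow> 'a mv) h. mv_chain_decomposition n A C h \<and>
          (\<forall>i\<in>{1..n}. finite (carrier (C i)) \<or>
             infinite (carrier (C i)) \<and> mv_atomic (C i) \<and> mv_regular (C i))))
     \<and>
     (\<forall>(C :: nat \<Rightarrow> 'e mv) h (C' :: nat \<Rightarrow> 'f mv) h'.
        mv_pseudofinite TYPE('i) TYPE('c) n A \<longrightarrow>
        mv_pseudofinite TYPE('j::infinite) TYPE('d::infinite) n A' \<longrightarrow>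
        mv_chain_decomposition n A C h \<longrightarrow>
        (\<forall>i\<in>{1..n}. finite (carrier (C i)) \<or>
             infinite (carrier (C i)) \<and> mv_atomic (C i) \<and> mv_regular (C i)) \<longrightarrow>
        mv_chain_decomposition n A' C' h' \<longrightarrow>
        (\<forall>i\<in>{1..n}. finite (carrier (C' i)) \<or>
             infinite (carrier (C' i)) \<and> mv_atomic (C' i) \<and> mv_regular (C' i)) \<longrightarrow>
        (mv_elem_equiv n A (mv_component_one n A C h) A' (mv_component_one n A' C' h') \<longleftrightarrow>
         (\<forall>i\<in>{1..n}.
            finite (carrier (C i)) \<and> finite (carrier (C' i)) \<and> mv_iso (C i) (C' i) \<noteq> {}
          \<or> infinite (carrier (C i)) \<and> infinite (carrier (C' i)) \<and>
            mv_regular (C i) \<and> mv_regular (C' i) \<and>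
            (\<forall>p m k. prime (p::nat) \<and> m \<ge> 1 \<and> k \<le> p ^ m - 1 \<longrightarrow>
               (mv_D (C i) (p ^ m) k \<longleftrightarrow> mv_D (C' i) (p ^ m) k)))))"
  (is "?part1 \<and> ?part2")
proof
  show ?part1
  proof
    assume "mv_pseudofinite TYPE('i) TYPE('c) n A"
    then obtain C :: "nat \<Rightarrow> 'a mv" and h where C: "mv_chain_decomposition n A C h" "\<forall>i\<in>{1..n}. good_chain (C i)"
      using pseudofinite_decomposition assms(1) by blast
    have "decomposition A n C h" using C assms(1) by (simp add: decomposition_def decomposition_axioms_def)
    then show "mv_projectable A \<and> (\<exists>(C :: nat \<Rightarrow> 'a mv) h. mv_chain_decomposition n A C h \<and>
        (\<forall>i\<in>{1..n}. finite (carrier (C i)) \<or> infinite (carrier (C i)) \<and> mv_atomic (C i) \<and> mv_regular (C i)))"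
      using decomposition.projectable C unfolding good_chain_def by blast
  next
    assume "mv_projectable A \<and> (\<exists>(C :: nat \<Rightarrow> 'a mv) h. mv_chain_decomposition n A C h \<and>
        (\<forall>i\<in>{1..n}. finite (carrier (C i)) \<or> infinite (carrier (C i)) \<and> mv_atomic (C i) \<and> mv_regular (C i)))"
    then obtain C :: "nat \<Rightarrow> 'a mv" and h where C: "mv_chain_decomposition n A C h"
      "\<forall>i\<in>{1..n}. finite (carrier (C i)) \<or> infinite (carrier (C i)) \<and> mv_atomic (C i) \<and> mv_regular (C i)"
      by blast
    have "good_chain (C i)" if "i \<in> {1..n}" for i
      using C that unfolding good_chain_def mv_chain_decomposition_def by blast
    then show "mv_pseudofinite TYPE('i) TYPE('c) n A" by (rule decomposition_pseudofinite[OF assms(1) C(1)])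
  qed
  show ?part2
  proof (intro allI impI, goal_cases)
    case (1 C h C' h')
    have dec: "decomposition A n C h" "decomposition A' n C' h'"
      using 1 assms by (simp_all add: decomposition_def decomposition_axioms_def)
    have C: "good_chain (C i)" "good_chain (C' i)" if "i \<in> {1..n}" for i
      using 1 that unfolding good_chain_def mv_chain_decomposition_def by blast+
    have reg: "infinite (carrier (C i)) \<Longrightarrow> mv_regular (C i)" "infinite (carrier (C' i)) \<Longrightarrow> mv_regular (C' i)"
      if "i \<in> {1..n}" for i
      using C[OF that] unfolding good_chain_def by blast+
    have match: "matching_chains (C i) (C' i) \<longleftrightarrow>
        (finite (carrier (C i)) \<and> finite (carrier (C' i)) \<and> mv_iso (C i) (C' i) \<noteq> {}
          \<or> infinite (carrier (C i)) \<and> infinite (carrier (C' i)) \<and>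
            mv_regular (C i) \<and> mv_regular (C' i) \<and>
            (\<forall>p m k. prime (p::nat) \<and> m \<ge> 1 \<and> k \<le> p ^ m - 1 \<longrightarrow>
               (mv_D (C i) (p ^ m) k \<longleftrightarrow> mv_D (C' i) (p ^ m) k)))" if "i \<in> {1..n}" for i
      using reg[OF that] unfolding matching_chains_def by blast
    have eq: "mv_elem_equiv n A (mv_component_one n A C h) A' (mv_component_one n A' C' h') \<longleftrightarrow>
        (\<forall>i\<in>{1..n}. matching_chains (C i) (C' i))"
      by (rule elem_equiv_iff_matching[OF dec]) (rule C; assumption)+
    show ?case by (rule trans[OF eq], rule ball_cong[OF refl], rule match)
  qed
qed

end
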